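(* Let $a\in\mathbb{R}$ be quadratic, i.e. $a$ is a solution of a quadratic equation with rational coefficients. Then the first-order theory of the structure $\mathcal{R}_a=(\mathbb{R},<,+,\mathbb{Z},\mathbb{Z}a)$ is decidable.
   Context: $\mathcal{R}_a$ denotes the expansion of the ordered additive group of real numbers $(\mathbb{R},<,+)$ by two unary predicates, one for the set $\mathbb{Z}$ of integers and one for the set $\mathbb{Z}a=\{za: z\in\mathbb{Z}\}$. *)

theory Defs
  imports Complex_Main "HOL-Library.Nat_Bijection"
begin

datatype tm = Var nat | Plus tm tm

text \<open>The remaining connectives and the universal quantifier are the usual abbreviations.\<close>

datatype fm =
    Equal tm tm
  | Less tm tm
  | PredP tm
  | PredQ tm
  | Neg fm
  | Conj fm fm
  | Exists nat fm

text \<open>The universe of a structure is the whole type \<open>'a\<close>.\<close>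

record 'a struct =
  lt_of :: "'a \<Rightarrow> 'a \<Rightarrow> bool"
  plus_of :: "'a \<Rightarrow> 'a \<Rightarrow> 'a"
  P_of :: "'a set"
  Q_of :: "'a set"

primrec eval_tm :: "'a struct \<Rightarrow> (nat \<Rightarrow> 'a) \<Rightarrow> tm \<Rightarrow> 'a" where
  "eval_tm M e (Var n) = e n"
| "eval_tm M e (Plus s t) = plus_of M (eval_tm M e s) (eval_tm M e t)"

primrec sat :: "'a struct \<Rightarrow> (nat \<Rightarrow> 'a) \<Rightarrow> fm \<Rightarrow> bool" where
  "sat M e (Equal s t) \<longleftrightarrow> eval_tm M e s = eval_tm M e t"
| "sat M e (Less s t) \<longleftrightarrow> lt_of M (eval_tm M e s) (eval_tm M e t)"
| "sat M e (PredP t) \<longleftrightarrow> eval_tm M e t \<in> P_of M"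
| "sat M e (PredQ t) \<longleftrightarrow> eval_tm M e t \<in> Q_of M"
| "sat M e (Neg \<phi>) \<longleftrightarrow> \<not> sat M e \<phi>"
| "sat M e (Conj \<phi> \<psi>) \<longleftrightarrow> sat M e \<phi> \<and> sat M e \<psi>"
| "sat M e (Exists n \<phi>) \<longleftrightarrow> (\<exists>x. sat M (e(n := x)) \<phi>)"

primrec vars_tm :: "tm \<Rightarrow> nat set" where
  "vars_tm (Var n) = {n}"
| "vars_tm (Plus s t) = vars_tm s \<union> vars_tm t"

primrec free_vars :: "fm \<Rightarrow> nat set" where
  "free_vars (Equal s t) = vars_tm s \<union> vars_tm t"
| "free_vars (Less s t) = vars_tm s \<union> vars_tm t"
| "free_vars (PredP t) = vars_tm t"
| "free_vars (PredQ t) = vars_tm t"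
| "free_vars (Neg \<phi>) = free_vars \<phi>"
| "free_vars (Conj \<phi> \<psi>) = free_vars \<phi> \<union> free_vars \<psi>"
| "free_vars (Exists n \<phi>) = free_vars \<phi> - {n}"

definition sentence :: "fm \<Rightarrow> bool" where
  "sentence \<phi> \<longleftrightarrow> free_vars \<phi> = {}"

definition Th :: "'a struct \<Rightarrow> fm set" where
  "Th M = {\<phi>. sentence \<phi> \<and> (\<forall>e. sat M e \<phi>)}"

lemma eval_tm_cong:
  "(\<And>n. n \<in> vars_tm t \<Longrightarrow> e n = e' n) \<Longrightarrow> eval_tm M e t = eval_tm M e' t"
  by (induction t) auto

lemma sat_cong:
  "(\<And>n. n \<in> free_vars \<phi> \<Longrightarrow> e n = e' n) \<Longrightarrow> sat M e \<phi> = sat M e' \<phi>"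
proof (induction \<phi> arbitrary: e e')
  case (Equal s t)
  then show ?case using eval_tm_cong[of s e e' M] eval_tm_cong[of t e e' M] by simp
next
  case (Less s t)
  then show ?case using eval_tm_cong[of s e e' M] eval_tm_cong[of t e e' M] by simp
next
  case (PredP t)
  then show ?case using eval_tm_cong[of t e e' M] by simp
next
  case (PredQ t)
  then show ?case using eval_tm_cong[of t e e' M] by simp
next
  case (Neg \<phi>)
  show ?case using Neg.IH[of e e'] Neg.prems by simp
next
  case (Conj \<phi> \<psi>)
  show ?case using Conj.IH(1)[of e e'] Conj.IH(2)[of e e'] Conj.prems by simp
next
  case (Exists n \<phi>)
  have "sat M (e(n := x)) \<phi> = sat M (e'(n := x)) \<phi>" for x
    by (rule Exists.IH) (use Exists.prems in auto)
  then show ?case by simp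
qed

lemma sat_sentence: "sentence \<phi> \<Longrightarrow> sat M e \<phi> = sat M e' \<phi>"
  by (rule sat_cong) (simp add: sentence_def)

text \<open>
  \<open>recursive n f\<close>: \<open>f\<close> is a total recursive function of \<open>n\<close> arguments, where minimisation
  is applied to regular functions only. Only the values of \<open>f\<close> on lists of length \<open>n\<close>
  are meaningful.
\<close>

inductive recursive :: "nat \<Rightarrow> (nat list \<Rightarrow> nat) \<Rightarrow> bool" where
  zero: "recursive n (\<lambda>xs. 0)"
| succ: "recursive 1 (\<lambda>xs. Suc (xs ! 0))"
| proj: "i < n \<Longrightarrow> recursive n (\<lambda>xs. xs ! i)"
| comp: "recursive (length gs) f \<Longrightarrow> (\<forall>g \<in> set gs. recursive n g)
    \<Longrightarrow> recursive n (\<lambda>xs. f (map (\<lambda>g. g xs) gs))"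
| prim_rec: "recursive n f \<Longrightarrow> recursive (Suc (Suc n)) g
    \<Longrightarrow> recursive (Suc n)
          (\<lambda>xs. rec_nat (f (tl xs)) (\<lambda>k r. g (k # r # tl xs)) (hd xs))"
| minimise: "recursive (Suc n) f \<Longrightarrow> (\<forall>xs. length xs = n \<longrightarrow> (\<exists>y. f (y # xs) = 0))
    \<Longrightarrow> recursive n (\<lambda>xs. LEAST y. f (y # xs) = 0)"

definition recursive_set :: "nat set \<Rightarrow> bool" where
  "recursive_set S \<longleftrightarrow> (\<exists>f. recursive 1 f \<and> (\<forall>x. f [x] = (if x \<in> S then 1 else 0)))"

primrec code_tm :: "tm \<Rightarrow> nat" where
  "code_tm (Var n) = prod_encode (0, n)"
| "code_tm (Plus s t) = prod_encode (1, prod_encode (code_tm s, code_tm t))"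

primrec code_fm :: "fm \<Rightarrow> nat" where
  "code_fm (Equal s t) = prod_encode (0, prod_encode (code_tm s, code_tm t))"
| "code_fm (Less s t) = prod_encode (1, prod_encode (code_tm s, code_tm t))"
| "code_fm (PredP t) = prod_encode (2, code_tm t)"
| "code_fm (PredQ t) = prod_encode (3, code_tm t)"
| "code_fm (Neg \<phi>) = prod_encode (4, code_fm \<phi>)"
| "code_fm (Conj \<phi> \<psi>) = prod_encode (5, prod_encode (code_fm \<phi>, code_fm \<psi>))"
| "code_fm (Exists n \<phi>) = prod_encode (6, prod_encode (n, code_fm \<phi>))"

lemma code_tm_inject: "code_tm s = code_tm t \<longleftrightarrow> s = t"
proof (induction s arbitrary: t)
  case (Var n)
  then show ?case by (cases t) auto
next
  case (Plus s1 s2)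
  then show ?case by (cases t) auto
qed

lemma code_fm_inject: "code_fm \<phi> = code_fm \<psi> \<longleftrightarrow> \<phi> = \<psi>"
proof (induction \<phi> arbitrary: \<psi>)
  case (Equal s t) then show ?case by (cases \<psi>) (auto simp: code_tm_inject)
next
  case (Less s t) then show ?case by (cases \<psi>) (auto simp: code_tm_inject)
next
  case (PredP t) then show ?case by (cases \<psi>) (auto simp: code_tm_inject)
next
  case (PredQ t) then show ?case by (cases \<psi>) (auto simp: code_tm_inject)
next
  case (Neg \<phi>) then show ?case by (cases \<psi>) auto
next
  case (Conj \<phi>1 \<phi>2) then show ?case by (cases \<psi>) auto
next
  case (Exists n \<phi>) then show ?case by (cases \<psi>) auto
qed

definition decidable :: "fm set \<Rightarrow> bool" where
  "decidable T \<longleftrightarrow> recursive_set (code_fm ` T)"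

definition R_struct :: "real \<Rightarrow> real struct" where
  "R_struct a = \<lparr>lt_of = (<), plus_of = (+), P_of = \<int>, Q_of = {of_int z * a |z. True}\<rparr>"

text \<open>Rational numbers are quadratic in this sense: the equation may be reducible.\<close>

definition quadratic :: "real \<Rightarrow> bool" where
  "quadratic a \<longleftrightarrow>
    (\<exists>p q r :: rat. p \<noteq> 0 \<and> of_rat p * a\<^sup>2 + of_rat q * a + of_rat r = 0)"

end

theory Submission
  imports Defs "HOL-Library.Ramsey" "HOL-Analysis.Kronecker_Approximation_Theorem"
begin

text \<open>
  Fix a quadratic unit \<open>\<beta> > 1\<close> with conjugate \<open>1 / \<beta>\<close> such that \<open>\<rho> a = p + q \<beta>\<close> for some integers \<open>\<rho> \<noteq> 0\<close>, \<open>p\<close>, \<open>q\<close>;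
  for irrational \<open>a\<close> it comes from a Pell equation, for rational \<open>a\<close> any such \<open>\<beta>\<close> will do. A real number is
  represented by an infinite word whose letter of index \<open>i\<close> carries the digits at \<open>\<beta>\<close> to the powers \<open>i\<close> and \<open>-i\<close>
  of an expansion with bounded digits. A linear relation with coefficients in \<open>\<int>[\<beta>]\<close> holds iff there are
  two sequences of carries in \<open>\<int>[\<beta>]\<close> that are bounded together with their conjugates and hence take
  finitely many values, so it is recognised by a finite automaton. Conjugation exchanges the two digits of a
  letter, so the integers are the values of the finite words that are symmetric (up to index \<open>0\<close>), and
  \<open>x \<in> \<int> a\<close> iff \<open>\<rho> x = (p + q \<beta>) n\<close> for an integer \<open>n\<close>.

  This interprets the structure in the monadic theory of infinite words, which is decided by computing for
  every formula a finite semigroup recognising it. An existential quantifier becomes a power set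
  construction, which is correct by Ramsey's theorem, and the other connectives are immediate.
\<close>

section \<open>Recursive functions\<close>

text \<open>In an expansion to an irrational base the integers are not visible digit by digit. A
  unit of norm 1 removes this obstacle: \<open>\<beta> ^ i + 1 / \<beta> ^ i\<close> is a trace,
  hence an integer, and with the powers \<open>i\<close> and \<open>-i\<close> folded into one
  letter, symmetry becomes a condition on single letters. Digits are signed and redundant, so no
  normal form has to be maintained, and equality of values is just another linear relation.

  Decidability refers to recursive functions on codes, and this shapes the logical part. Types are
  natural numbers, and sets of types are coded by bits. Recursions over codes change their
  parameters and branch over sets of arguments, so they are replaced by a search for tables of
  values. The number \<open>a\<close> enters the algorithm only through the types and products of
  the base relations; these form a finite table, which is computable whatever its entries, so
  nothing about \<open>a\<close> has to be computed. A sentence does not depend on any track, so its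
  truth is read off from a constant word, and only one-letter words need their types
  computed.\<close>

definition recursive_on :: "nat \<Rightarrow> (nat list \<Rightarrow> nat) \<Rightarrow> bool" where
  "recursive_on n f \<longleftrightarrow> (\<exists>g. recursive n g \<and> (\<forall>xs. length xs = n \<longrightarrow> g xs = f xs))"

text \<open>\<open>recursive n f\<close> also pins down \<open>f\<close> on lists of the wrong
  length. The relaxed notion is closed under rewriting the body of \<open>f\<close>, which the
  closure proofs below do all the time.\<close>

lemma recursive_on_cong:
  "recursive_on n f \<Longrightarrow> (\<And>xs. length xs = n \<Longrightarrow> f xs = f' xs) \<Longrightarrow> recursive_on n f'"
  unfolding recursive_on_def by metis

lemma recursive_onI: "recursive n f \<Longrightarrow> recursive_on n f"
  unfolding recursive_on_def by blast

lemma recursive_on_comp: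
  assumes f: "recursive_on (length gs) f" and gs: "\<And>g. g \<in> set gs \<Longrightarrow> recursive_on n g"
  shows "recursive_on n (\<lambda>xs. f (map (\<lambda>g. g xs) gs))"
proof -
  obtain f' where f': "recursive (length gs) f'" "\<And>xs. length xs = length gs \<Longrightarrow> f' xs = f xs"
    using f unfolding recursive_on_def by blast
  have "\<forall>g\<in>set gs. \<exists>g'. recursive n g' \<and> (\<forall>xs. length xs = n \<longrightarrow> g' xs = g xs)"
    using gs unfolding recursive_on_def by blast
  then obtain h where h: "\<And>g. g \<in> set gs \<Longrightarrow> recursive n (h g)"
    "\<And>g xs. g \<in> set gs \<Longrightarrow> length xs = n \<Longrightarrow> h g xs = g xs"
    by metis
  have "recursive n (\<lambda>xs. f' (map (\<lambda>g. g xs) (map h gs)))"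
    by (rule recursive.comp) (use f' h in auto)
  moreover have "f' (map (\<lambda>g. g xs) (map h gs)) = f (map (\<lambda>g. g xs) gs)" if "length xs = n" for xs
  proof -
    have "map (\<lambda>g. g xs) (map h gs) = map (\<lambda>g. g xs) gs"
      using h(2) that by simp
    then show ?thesis using f'(2)[of "map (\<lambda>g. g xs) gs"] by (simp only: length_map)
  qed
  ultimately show ?thesis unfolding recursive_on_def by blast
qed

lemma recursive_on_comp1:
  "recursive_on (Suc 0) f \<Longrightarrow> recursive_on n g \<Longrightarrow> recursive_on n (\<lambda>xs. f [g xs])"
  using recursive_on_comp[of "[g]" f n] by simp

lemma recursive_on_proj: "i < n \<Longrightarrow> recursive_on n (\<lambda>xs. xs ! i)"
  by (intro recursive_onI recursive.proj)

lemma recursive_on_Suc: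
  assumes "recursive_on n f" shows "recursive_on n (\<lambda>xs. Suc (f xs))"
proof -
  have "recursive_on (Suc 0) (\<lambda>xs. Suc (xs ! 0))"
    using recursive_onI[OF recursive.succ] by simp
  from recursive_on_comp1[OF this assms] show ?thesis by simp
qed

lemma recursive_on_const: "recursive_on n (\<lambda>xs. k)"
proof (induction k)
  case 0 show ?case by (intro recursive_onI recursive.zero)
next
  case (Suc k) then show ?case by (rule recursive_on_Suc)
qed

text \<open>In \<open>prim_rec\<close> the recursion variable is the head of the argument list;
  composing with \<open>h\<close> followed by all projections puts a computed value there.\<close>

lemma recursive_on_shift:
  assumes f: "recursive_on (Suc n) f" and h: "recursive_on n h"
  shows "recursive_on n (\<lambda>xs. f (h xs # xs))"
proof -
  have "recursive_on n (\<lambda>xs. f (map (\<lambda>g. g xs) (h # map (\<lambda>i xs. xs ! i) [0..<n])))"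
    by (rule recursive_on_comp) (use f h in \<open>auto intro: recursive_on_proj\<close>)
  then show ?thesis
  proof (rule recursive_on_cong)
    fix xs :: "nat list" assume "length xs = n"
    then have "map (\<lambda>i. xs ! i) [0..<n] = xs" by (metis map_nth)
    then show "f (map (\<lambda>g. g xs) (h # map (\<lambda>i xs. xs ! i) [0..<n])) = f (h xs # xs)"
      by (simp add: o_def)
  qed
qed

lemma recursive_on_rec_nat:
  assumes f: "recursive_on n f" and g: "recursive_on (Suc (Suc n)) g" and h: "recursive_on n h"
  shows "recursive_on n (\<lambda>xs. rec_nat (f xs) (\<lambda>k r. g (k # r # xs)) (h xs))"
proof -
  obtain f' where f': "recursive n f'" "\<And>xs. length xs = n \<Longrightarrow> f' xs = f xs"
    using f unfolding recursive_on_def by blast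
  obtain g' where g': "recursive (Suc (Suc n)) g'" "\<And>xs. length xs = Suc (Suc n) \<Longrightarrow> g' xs = g xs"
    using g unfolding recursive_on_def by blast
  have "recursive_on (Suc n) (\<lambda>xs. rec_nat (f' (tl xs)) (\<lambda>k r. g' (k # r # tl xs)) (hd xs))"
    by (intro recursive_onI recursive.prim_rec f' g')
  from recursive_on_shift[OF this h] show ?thesis
    by (rule recursive_on_cong) (simp add: f' g')
qed

lemma recursive_on_Least:
  assumes f: "recursive_on (Suc n) f" and tot: "\<And>xs. length xs = n \<Longrightarrow> \<exists>y. f (y # xs) = 0"
  shows "recursive_on n (\<lambda>xs. LEAST y. f (y # xs) = 0)"
proof -
  obtain f' where f': "recursive (Suc n) f'" "\<And>xs. length xs = Suc n \<Longrightarrow> f' xs = f xs"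
    using f unfolding recursive_on_def by blast
  have "recursive_on n (\<lambda>xs. LEAST y. f' (y # xs) = 0)"
    by (intro recursive_onI recursive.minimise f') (use f'(2) tot in auto)
  then show ?thesis by (rule recursive_on_cong) (simp add: f')
qed

lemma recursive_on_binary:
  assumes F: "recursive_on 2 (\<lambda>xs. F (xs ! 0) (xs ! 1))" and f: "recursive_on n f" and g: "recursive_on n g"
  shows "recursive_on n (\<lambda>xs. F (f xs) (g xs))"
  using recursive_on_comp[of "[f, g]" "\<lambda>xs. F (xs ! 0) (xs ! 1)" n] assms
  by (auto simp: numeral_2_eq_2)

lemma recursive_on_add:
  assumes f: "recursive_on n f" and g: "recursive_on n g"
  shows "recursive_on n (\<lambda>xs. f xs + g xs)"
proof -
  have "rec_nat m (\<lambda>_. Suc) k = m + k" for m k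
    by (induction k) auto
  then show ?thesis
    using recursive_on_rec_nat[OF f _ g, of "\<lambda>xs. Suc (xs ! 1)"]
    by (simp add: recursive_on_Suc recursive_on_proj)
qed

lemma recursive_on_mult:
  assumes f: "recursive_on n f" and g: "recursive_on n g"
  shows "recursive_on n (\<lambda>xs. f xs * g xs)"
proof (rule recursive_on_binary[OF _ f g])
  have *: "rec_nat 0 (\<lambda>_ r. r + m) k = m * k" for m k :: nat
    by (induction k) auto
  show "recursive_on 2 (\<lambda>xs. xs ! 0 * xs ! 1)"
    using recursive_on_rec_nat[of 2 "\<lambda>_. 0" "\<lambda>xs. xs ! 1 + xs ! 2" "\<lambda>xs. xs ! 1"]
    by (simp add: * recursive_on_const recursive_on_add recursive_on_proj numeral_2_eq_2)
qed

lemma recursive_on_power: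
  assumes f: "recursive_on n f" and g: "recursive_on n g"
  shows "recursive_on n (\<lambda>xs. f xs ^ g xs)"
proof (rule recursive_on_binary[OF _ f g])
  have *: "rec_nat 1 (\<lambda>_ r. r * m) k = m ^ k" for m k :: nat
    by (induction k) auto
  show "recursive_on 2 (\<lambda>xs. xs ! 0 ^ xs ! 1)"
    using recursive_on_rec_nat[of 2 "\<lambda>_. 1" "\<lambda>xs. xs ! 1 * xs ! 2" "\<lambda>xs. xs ! 1"]
    by (simp add: *[unfolded One_nat_def] recursive_on_const recursive_on_mult recursive_on_proj numeral_2_eq_2)
qed

lemma recursive_on_diff:
  assumes f: "recursive_on n f" and g: "recursive_on n g"
  shows "recursive_on n (\<lambda>xs. f xs - g xs)"
proof -
  have p: "recursive_on m (\<lambda>xs. h xs - 1)" if h: "recursive_on m h" for m h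
  proof -
    \<comment> \<open>The predecessor is the recursion that returns the counter and discards the
      previous value.\<close>
    have *: "rec_nat 0 (\<lambda>k r. k) m = m - 1" for m by (cases m) auto
    show ?thesis
      using recursive_on_rec_nat[OF recursive_on_const[of m 0] _ h, of "\<lambda>xs. xs ! 0"]
      by (simp add: * recursive_on_proj)
  qed
  have *: "rec_nat m (\<lambda>_ r. r - 1) k = m - k" for m k :: nat
    by (induction k) auto
  show ?thesis
    using recursive_on_rec_nat[OF f _ g, of "\<lambda>xs. xs ! 1 - 1"]
    by (simp add: *[simplified] p[simplified] recursive_on_proj)
qed

lemma recursive_on_triangle:
  assumes f: "recursive_on n f" shows "recursive_on n (\<lambda>xs. triangle (f xs))"
proof -
  have *: "rec_nat 0 (\<lambda>k r. Suc (r + k)) k = triangle k" for k :: nat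
    by (induction k) auto
  show ?thesis
    using recursive_on_rec_nat[OF recursive_on_const[of n 0] _ f, of "\<lambda>xs. Suc (xs ! 1 + xs ! 0)"]
    by (simp add: * recursive_on_proj recursive_on_Suc recursive_on_add)
qed

section \<open>Cantor pairing and computable functions of one coded argument\<close>

definition pfst :: "nat \<Rightarrow> nat" where "pfst z = fst (prod_decode z)"
definition psnd :: "nat \<Rightarrow> nat" where "psnd z = snd (prod_decode z)"
abbreviation pair :: "nat \<Rightarrow> nat \<Rightarrow> nat" where "pair x y \<equiv> prod_encode (x, y)"

lemma pfst_pair [simp]: "pfst (pair x y) = x" and psnd_pair [simp]: "psnd (pair x y) = y"
  by (simp_all add: pfst_def psnd_def)

lemma pair_pfst_psnd [simp]: "pair (pfst z) (psnd z) = z"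
  by (simp add: pfst_def psnd_def)

lemma triangle_mono: "m \<le> n \<Longrightarrow> triangle m \<le> triangle n"
  by (induction rule: dec_induct) auto

text \<open>\<open>pfst z + psnd z\<close> is the index of the diagonal on which Cantor's pairing
  places \<open>z\<close>. Decoding is thereby reduced to one minimisation.\<close>

lemma Least_triangle: "(LEAST s. z < triangle (Suc s)) = pfst z + psnd z"
proof -
  have z: "z = triangle (pfst z + psnd z) + pfst z"
    using pair_pfst_psnd[of z] by (simp add: prod_encode_def)
  show ?thesis
  proof (rule Least_equality)
    show "z < triangle (Suc (pfst z + psnd z))" by (subst z) simp
  next
    fix s assume s: "z < triangle (Suc s)"
    show "pfst z + psnd z \<le> s"
      using triangle_mono[of "Suc s" "pfst z + psnd z"] s z by linarith
  qed
qed

text \<open>Several arguments are packed into one with \<open>pair\<close>, so a single set of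
  closure rules suffices; these are collected in \<open>comput\<close> and applied by
  \<open>intro\<close>.\<close>

definition computable :: "(nat \<Rightarrow> nat) \<Rightarrow> bool" where
  "computable f \<longleftrightarrow> recursive_on 1 (\<lambda>xs. f (xs ! 0))"

definition decid :: "(nat \<Rightarrow> bool) \<Rightarrow> bool" where
  "decid P \<longleftrightarrow> computable (\<lambda>z. if P z then 1 else 0)"

named_theorems comput

lemma computable_id [comput]: "computable (\<lambda>z. z)"
  unfolding computable_def by (rule recursive_on_proj) simp

lemma computable_const [comput]: "computable (\<lambda>z. k)"
  unfolding computable_def by (rule recursive_on_const)

lemma computable_Suc [comput]: "computable f \<Longrightarrow> computable (\<lambda>z. Suc (f z))"
  unfolding computable_def by (rule recursive_on_Suc)

lemma computable_add [comput]: "computable f \<Longrightarrow> computable g \<Longrightarrow> computable (\<lambda>z. f z + g z)"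
  unfolding computable_def by (rule recursive_on_add)

lemma computable_mult [comput]: "computable f \<Longrightarrow> computable g \<Longrightarrow> computable (\<lambda>z. f z * g z)"
  unfolding computable_def by (rule recursive_on_mult)

lemma computable_power [comput]: "computable f \<Longrightarrow> computable g \<Longrightarrow> computable (\<lambda>z. f z ^ g z)"
  unfolding computable_def by (rule recursive_on_power)

lemma computable_diff [comput]: "computable f \<Longrightarrow> computable g \<Longrightarrow> computable (\<lambda>z. f z - g z)"
  unfolding computable_def by (rule recursive_on_diff)

lemma computable_pair [comput]: "computable f \<Longrightarrow> computable g \<Longrightarrow> computable (\<lambda>z. pair (f z) (g z))"
  unfolding computable_def prod_encode_def by (simp add: recursive_on_add recursive_on_triangle)

lemma computable_comp: "computable f \<Longrightarrow> computable g \<Longrightarrow> computable (\<lambda>z. f (g z))"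
  unfolding computable_def using recursive_on_comp1[of "\<lambda>xs. f (xs ! 0)"] by simp

lemma computable_pfst_psnd: "computable pfst" "computable psnd"
proof -
  \<comment> \<open>With truncated subtraction, \<open>Suc z - triangle (Suc y) = 0\<close>
    expresses \<open>z < triangle (Suc y)\<close>, the condition minimised in
    \<open>Least_triangle\<close>.\<close>
  have "recursive_on (Suc 1) (\<lambda>xs. Suc (xs ! 1) - triangle (Suc (xs ! 0)))"
    by (intro recursive_on_diff recursive_on_Suc recursive_on_triangle recursive_on_proj) auto
  moreover have "\<exists>y. Suc z - triangle (Suc y) = 0" for z
    by (rule exI[of _ z]) (induction z, auto)
  ultimately have "recursive_on 1 (\<lambda>xs. LEAST y. Suc (xs ! 0) - triangle (Suc y) = 0)"
    using recursive_on_Least[of 1 "\<lambda>xs. Suc (xs ! 1) - triangle (Suc (xs ! 0))"] by simp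
  then have r: "recursive_on 1 (\<lambda>xs. pfst (xs ! 0) + psnd (xs ! 0))"
    by (simp only: diff_is_0_eq Suc_le_eq Least_triangle)
  have "pfst z = z - triangle (pfst z + psnd z)" for z
    using pair_pfst_psnd[of z] unfolding prod_encode_def by simp
  then have p: "recursive_on 1 (\<lambda>xs. pfst (xs ! 0))"
    using recursive_on_diff[OF recursive_on_proj[of 0 1] recursive_on_triangle[OF r]] by simp
  then show "computable pfst" unfolding computable_def .
  show "computable psnd"
    using recursive_on_diff[OF r p] unfolding computable_def by simp
qed

lemmas computable_pfst [comput] = computable_comp[OF computable_pfst_psnd(1)]
lemmas computable_psnd [comput] = computable_comp[OF computable_pfst_psnd(2)]

lemma decid_comp: "decid P \<Longrightarrow> computable g \<Longrightarrow> decid (\<lambda>z. P (g z))"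
  unfolding decid_def by (rule computable_comp)

lemma computable_comp2:
  assumes "computable (\<lambda>z. F (pfst z) (psnd z))" "computable f" "computable g"
  shows "computable (\<lambda>z. F (f z) (g z))"
  using computable_comp[OF assms(1) computable_pair[OF assms(2,3)]] by simp

lemma computable_comp3:
  assumes "computable (\<lambda>z. F (pfst z) (pfst (psnd z)) (psnd (psnd z)))" "computable f" "computable g" "computable h"
  shows "computable (\<lambda>z. F (f z) (g z) (h z))"
  using computable_comp[OF assms(1) computable_pair[OF assms(2) computable_pair[OF assms(3,4)]]] by simp

lemma decid_cong: "decid P \<Longrightarrow> (\<And>z. P z = Q z) \<Longrightarrow> decid Q"
  by (subgoal_tac "P = Q") auto

lemma computable_If [comput]:
  assumes "decid P" "computable f" "computable g"
  shows "computable (\<lambda>z. if P z then f z else g z)"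
proof -
  have "(\<lambda>z. if P z then f z else g z) =
    (\<lambda>z. (if P z then 1 else 0) * f z + (1 - (if P z then 1 else 0)) * g z)"
    by auto
  then show ?thesis using assms unfolding decid_def by (simp only:) (intro comput)
qed

lemma decid_eq0: "computable f \<Longrightarrow> decid (\<lambda>z. f z = 0)"
proof -
  assume f: "computable f"
  have "(\<lambda>z. if f z = 0 then 1 else 0) = (\<lambda>z. 1 - f z)" by auto
  with f show ?thesis unfolding decid_def by (simp only:) (intro comput)
qed

lemma decid_le [comput]: "computable f \<Longrightarrow> computable g \<Longrightarrow> decid (\<lambda>z. f z \<le> g z)"
  using decid_eq0[of "\<lambda>z. f z - g z"] by (simp add: computable_diff)

lemma decid_conj [comput]:
  assumes "decid P" "decid Q" shows "decid (\<lambda>z. P z \<and> Q z)"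
proof -
  have "(\<lambda>z. if P z \<and> Q z then 1 else 0) = (\<lambda>z. if P z then if Q z then 1 else 0 else (0::nat))"
    by auto
  then show ?thesis
    using assms computable_If[OF assms(1) _ computable_const, of "\<lambda>z. if Q z then 1 else 0" 0]
    unfolding decid_def by simp
qed

lemma decid_not [comput]:
  assumes "decid P" shows "decid (\<lambda>z. \<not> P z)"
proof -
  have "(\<lambda>z. if \<not> P z then 1 else 0) = (\<lambda>z. 1 - (if P z then 1 else (0::nat)))" by auto
  then show ?thesis using computable_diff[OF computable_const[of 1] assms[unfolded decid_def]]
    unfolding decid_def by (simp only:)
qed

lemma decid_disj [comput]: "decid P \<Longrightarrow> decid Q \<Longrightarrow> decid (\<lambda>z. P z \<or> Q z)"
  using decid_not[OF decid_conj[OF decid_not decid_not], of P Q] by simp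

lemma decid_imp [comput]: "decid P \<Longrightarrow> decid Q \<Longrightarrow> decid (\<lambda>z. P z \<longrightarrow> Q z)"
  using decid_disj[OF decid_not, of P Q] by (simp only: imp_conv_disj)

lemma decid_eq [comput]: "computable f \<Longrightarrow> computable g \<Longrightarrow> decid (\<lambda>z. f z = g z)"
  using decid_conj[OF decid_le decid_le, of f g g f] by (simp add: eq_iff)

lemma decid_less [comput]: "computable f \<Longrightarrow> computable g \<Longrightarrow> decid (\<lambda>z. f z < g z)"
  using decid_not[OF decid_le, of g f] by (simp add: not_le)

lemma computable_rec_nat:
  assumes f: "computable f" and g: "computable (\<lambda>z. g (pfst z) (pfst (psnd z)) (psnd (psnd z)))"
    and h: "computable h"
  shows "computable (\<lambda>z. rec_nat (f z) (g z) (h z))"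
proof -
  let ?G = "\<lambda>xs. pair (xs ! 2) (pair (xs ! 0) (xs ! 1))"
  have "recursive_on 3 ?G"
    unfolding prod_encode_def
    by (simp, intro recursive_on_add recursive_on_triangle recursive_on_proj) auto
  from recursive_on_comp1[OF g[unfolded computable_def, simplified] this]
  have "recursive_on (Suc (Suc 1)) (\<lambda>xs. g (xs ! 2) (xs ! 0) (xs ! 1))"
    by (simp add: eval_nat_numeral)
  from recursive_on_rec_nat[OF f[unfolded computable_def] this h[unfolded computable_def]]
  show ?thesis unfolding computable_def by simp
qed

lemma decid_ball_less [comput]:
  assumes f: "computable f" and P: "decid (\<lambda>z. P (pfst z) (psnd z))"
  shows "decid (\<lambda>z. \<forall>y<f z. P z y)"
proof -
  have *: "rec_nat 1 (\<lambda>k r. if P z k then r else 0) n = (if \<forall>y<n. P z y then 1 else 0)" for z and n :: nat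
    by (induction n) (auto simp: less_Suc_eq)
  have "computable (\<lambda>z. rec_nat 1 (\<lambda>k r. if P z k then r else 0) (f z))"
  proof (rule computable_rec_nat)
    have "decid (\<lambda>z. P (pfst z) (pfst (psnd z)))"
      using decid_comp[OF P, of "\<lambda>z. pair (pfst z) (pfst (psnd z))"] by (simp add: comput)
    then show "computable (\<lambda>z. if P (pfst z) (pfst (psnd z)) then psnd (psnd z) else 0)"
      by (intro comput)
  qed (intro comput f)+
  then show ?thesis unfolding decid_def * .
qed

lemma decid_bex_less [comput]:
  assumes "computable f" and "decid (\<lambda>z. P (pfst z) (psnd z))"
  shows "decid (\<lambda>z. \<exists>y<f z. P z y)"
  using decid_not[OF decid_ball_less[OF assms(1) decid_not[OF assms(2)]]] by simp

lemma computable_Least: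
  assumes P: "decid (\<lambda>z. P (pfst z) (psnd z))" and tot: "\<And>z. \<exists>y. P z y"
  shows "computable (\<lambda>z. LEAST y. P z y)"
proof -
  let ?f = "\<lambda>z. if P (pfst z) (psnd z) then 0 else 1::nat"
  have "computable ?f" using P by (intro comput)
  moreover have "recursive_on 2 (\<lambda>xs. pair (xs ! 1) (xs ! 0))"
    unfolding prod_encode_def
    by (simp, intro recursive_on_add recursive_on_triangle recursive_on_proj) auto
  ultimately have "recursive_on 2 (\<lambda>xs. ?f (pair (xs ! 1) (xs ! 0)))"
    using recursive_on_comp1[of "\<lambda>xs. ?f (xs ! 0)" 2 "\<lambda>xs. pair (xs ! 1) (xs ! 0)"]
    by (simp add: computable_def)
  then have "recursive_on 1 (\<lambda>xs. LEAST y. (if P (xs ! 0) y then 0 else 1::nat) = 0)"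
    using recursive_on_Least[of 1 "\<lambda>xs. ?f (pair (xs ! 1) (xs ! 0))"] tot
    by (simp add: numeral_2_eq_2)
  moreover have "((if P z y then 0 else 1::nat) = 0) = P z y" for z y by simp
  ultimately show ?thesis unfolding computable_def by (simp only:)
qed

text \<open>Unbounded search finds the value, so a decidable description of the graph replaces a
  recursion. Division and codes of finite sets are obtained in this way.\<close>

lemma computable_graph:
  assumes P: "decid (\<lambda>z. P (pfst z) (psnd z))" and f: "\<And>z y. P z y \<longleftrightarrow> y = f z"
  shows "computable f"
  using computable_Least[OF P] f by (simp add: Least_equality)

lemma computable_div [comput]:
  assumes "computable f" "computable g" shows "computable (\<lambda>z. f z div g z)"
proof -
  have "computable (\<lambda>z. pfst z div psnd z)"
  proof (rule computable_graph)
    show "decid (\<lambda>z. (\<lambda>z y. (psnd z = 0 \<and> y = 0) \<or> (y * psnd z \<le> pfst z \<and> pfst z < Suc y * psnd z)) (pfst z) (psnd z))"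
      by (intro comput)
    show "((psnd z = 0 \<and> y = 0) \<or> (y * psnd z \<le> pfst z \<and> pfst z < Suc y * psnd z)) = (y = pfst z div psnd z)" for z y
      by (cases "psnd z = 0") (auto intro!: div_nat_eqI[symmetric] simp: algebra_simps dividend_less_times_div)
  qed
  from computable_comp[OF this computable_pair[OF assms]] show ?thesis by simp
qed

section \<open>Finite sets coded by bits\<close>

lemma decid_set_decode [comput]:
  assumes "computable f" "computable g" shows "decid (\<lambda>z. f z \<in> set_decode (g z))"
proof -
  have "odd n \<longleftrightarrow> n \<noteq> 2 * (n div 2)" for n :: nat by presburger
  then have "(\<lambda>z. f z \<in> set_decode (g z)) = (\<lambda>z. g z div 2 ^ f z \<noteq> 2 * (g z div 2 ^ f z div 2))"
    by (simp only: set_decode_def mem_Collect_eq)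
  then show ?thesis
    using decid_not[OF decid_eq[OF computable_div[OF assms(2) computable_power[OF computable_const assms(1)]]
      computable_mult[OF computable_const computable_div[OF computable_div[OF assms(2)
      computable_power[OF computable_const assms(1)]] computable_const]]]] by simp
qed

lemma set_decode_less: "x \<in> set_decode m \<Longrightarrow> x < m"
proof -
  assume "x \<in> set_decode m"
  then have "m div 2 ^ x \<noteq> 0" by (auto simp: set_decode_def intro: Nat.gr0I)
  then have "2 ^ x \<le> m" by (metis div_less not_le)
  then show "x < m" by (metis less_exp order_less_le_trans)
qed

lemma decid_ball_set_decode [comput]:
  assumes f: "computable f" and P: "decid (\<lambda>z. P (pfst z) (psnd z))"
  shows "decid (\<lambda>z. \<forall>y\<in>set_decode (f z). P z y)"
proof -
  have "(\<lambda>z. \<forall>y\<in>set_decode (f z). P z y) = (\<lambda>z. \<forall>y<f z. y \<in> set_decode (f z) \<longrightarrow> P z y)"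
    using set_decode_less by blast
  moreover have "decid \<dots>"
    using computable_comp[OF f computable_pfst[OF computable_id]] by (intro comput P f)
  ultimately show ?thesis by simp
qed

lemma decid_bex_set_decode [comput]:
  assumes f: "computable f" and P: "decid (\<lambda>z. P (pfst z) (psnd z))"
  shows "decid (\<lambda>z. \<exists>y\<in>set_decode (f z). P z y)"
  using decid_not[OF decid_ball_set_decode[OF assms(1) decid_not[OF assms(2)]]] by simp

lemma computable_set_encode:
  assumes f: "computable f" and P: "decid (\<lambda>z. P (pfst z) (psnd z))"
  shows "computable (\<lambda>z. set_encode {y. y < f z \<and> P z y})"
proof (rule computable_graph)
  let ?Q = "\<lambda>z m. (\<forall>y\<in>set_decode m. y < f z \<and> P z y) \<and> (\<forall>y<f z. P z y \<longrightarrow> y \<in> set_decode m)"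
  have *: "decid (\<lambda>z. P (pfst (pfst z)) (psnd z))"
    using decid_comp[OF P, of "\<lambda>z. pair (pfst (pfst z)) (psnd z)"] by (simp add: comput)
  have **: "computable (\<lambda>z. f (pfst z))" "computable (\<lambda>z. f (pfst (pfst z)))"
    by (intro computable_comp[OF f] comput)+
  show "decid (\<lambda>z. ?Q (pfst z) (psnd z))"
    by (intro comput * **)
  show "?Q z m \<longleftrightarrow> m = set_encode {y. y < f z \<and> P z y}" for z m
  proof -
    have "?Q z m \<longleftrightarrow> set_decode m = {y. y < f z \<and> P z y}" by blast
    also have "\<dots> \<longleftrightarrow> m = set_encode {y. y < f z \<and> P z y}"
      using set_encode_inverse[of "{y. y < f z \<and> P z y}"] set_decode_inverse[of m] by fastforce
    finally show ?thesis .
  qed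
qed

text \<open>A finite table is computable whatever its entries. This is how the data of the base
  relations, which depend on \<open>a\<close>, enter the algorithm.\<close>

lemma computable_finite_support:
  assumes "finite {z. f z \<noteq> 0}" shows "computable f"
proof -
  have *: "computable (\<lambda>z. if z < n then f z else 0)" for n
  proof (induction n)
    case 0 show ?case by (simp add: comput)
  next
    case (Suc n)
    have "(\<lambda>z. if z < Suc n then f z else 0) = (\<lambda>z. if z = n then f n else if z < n then f z else 0)"
      by auto
    moreover have "computable \<dots>" by (intro comput Suc)
    ultimately show ?case by simp
  qed
  obtain n where "\<forall>z\<in>{z. f z \<noteq> 0}. z < n"
    using finite_nat_set_iff_bounded assms by metis
  then have "(\<lambda>z. if z < n then f z else 0) = f" by (auto simp: fun_eq_iff)
  then show ?thesis using *[of n] by simp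
qed

text \<open>\<open>J T x y\<close> says that the value \<open>y\<close> at \<open>x\<close> is justified by the entries of the table \<open>T\<close>.
  A value of \<open>F\<close> is found by searching for a finite table all of whose entries are justified.\<close>

lemma computable_by_tables:
  fixes J :: "(nat \<Rightarrow> nat \<Rightarrow> bool) \<Rightarrow> nat \<Rightarrow> nat \<Rightarrow> bool" and \<mu> :: "nat \<Rightarrow> nat"
  assumes dec: "decid (\<lambda>z. J (\<lambda>x y. pair x y \<in> set_decode (pfst z)) (pfst (psnd z)) (psnd (psnd z)))"
    and sound: "\<And>T x y. (\<And>x' y'. T x' y' \<Longrightarrow> \<mu> x' < \<mu> x \<Longrightarrow> y' = F x') \<Longrightarrow> J T x y \<Longrightarrow> y = F x"
    and complete: "\<And>x. \<exists>X. finite X \<and> (\<forall>x'\<in>X. \<mu> x' < \<mu> x) \<and> (\<forall>T. (\<forall>x'\<in>X. T x' (F x')) \<longrightarrow> J T x (F x))"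
  shows "computable F"
proof -
  define good where "good D \<longleftrightarrow> (\<forall>p\<in>set_decode D. J (\<lambda>x y. pair x y \<in> set_decode D) (pfst p) (psnd p))" for D
  have "decid (\<lambda>z. (\<lambda>z. J (\<lambda>x y. pair x y \<in> set_decode (pfst z)) (pfst (psnd z)) (psnd (psnd z))) (pair (pfst z) (psnd z)))"
    by (rule decid_comp[OF dec]) (intro comput)
  then have dec_good: "decid good"
    unfolding good_def by (intro comput) simp
  \<comment> \<open>Induction on \<open>\<mu>\<close>: by \<open>sound\<close>, an entry is correct
    as soon as the table entries of smaller \<open>\<mu>\<close> are.\<close>
  have good_sound: "y = F x" if "good D" "pair x y \<in> set_decode D" for D x y
    using that(2)
  proof (induction "\<mu> x" arbitrary: x y rule: less_induct)
    case less
    show ?case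
    proof (rule sound)
      show "J (\<lambda>x y. pair x y \<in> set_decode D) x y"
        using that(1) less.prems unfolding good_def by fastforce
    qed (use less.hyps in blast)
  qed
  obtain X where X: "\<And>x. finite (X x)" "\<And>x x'. x' \<in> X x \<Longrightarrow> \<mu> x' < \<mu> x"
    "\<And>x T. (\<And>x'. x' \<in> X x \<Longrightarrow> T x' (F x')) \<Longrightarrow> J T x (F x)"
    using complete by metis
  \<comment> \<open>Dependencies are finite in number and decrease \<open>\<mu>\<close>, so every
    argument lies in a finite set closed under them; the graph of \<open>F\<close> over that set is
    a good table.\<close>
  have clo: "\<exists>Y. finite Y \<and> x \<in> Y \<and> (\<forall>y\<in>Y. X y \<subseteq> Y)" for x
  proof (induction "\<mu> x" arbitrary: x rule: less_induct)
    case less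
    then have "\<forall>x'\<in>X x. \<exists>Y. finite Y \<and> x' \<in> Y \<and> (\<forall>y\<in>Y. X y \<subseteq> Y)" using X(2) by blast
    then obtain Y where Y: "\<And>x'. x' \<in> X x \<Longrightarrow> finite (Y x') \<and> x' \<in> Y x' \<and> (\<forall>y\<in>Y x'. X y \<subseteq> Y x')"
      by metis
    show ?case
      by (rule exI[of _ "insert x (\<Union>(Y ` X x))"]) (use X(1) Y in blast)
  qed
  have ex: "\<exists>q. good (pfst q) \<and> pair x (psnd q) \<in> set_decode (pfst q)" for x
  proof -
    obtain Y where Y: "finite Y" "x \<in> Y" "\<And>y. y \<in> Y \<Longrightarrow> X y \<subseteq> Y" using clo[of x] by metis
    define D where "D = set_encode ((\<lambda>y. pair y (F y)) ` Y)"
    have D: "set_decode D = (\<lambda>y. pair y (F y)) ` Y" unfolding D_def using Y(1) by simp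
    have "J (\<lambda>x y. pair x y \<in> set_decode D) y (F y)" if "y \<in> Y" for y
      by (rule X(3)) (use Y(3)[OF that] D in blast)
    then have "good D" unfolding good_def D by auto
    then show ?thesis using Y(2) D by (intro exI[of _ "pair D (F x)"]) auto
  qed
  \<comment> \<open>\<open>q\<close> packs a good table with the value that it assigns to
    \<open>x\<close>; by \<open>good_sound\<close> this value is \<open>F x\<close>, whichever table
    is found.\<close>
  have "computable (\<lambda>x. psnd (LEAST q. good (pfst q) \<and> pair x (psnd q) \<in> set_decode (pfst q)))"
    by (intro comput computable_Least ex decid_comp[OF dec_good])
  moreover have "psnd (LEAST q. good (pfst q) \<and> pair x (psnd q) \<in> set_decode (pfst q)) = F x" for x
    using LeastI_ex[OF ex[of x]] good_sound by blast
  ultimately show ?thesis by simp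
qed

lemma recursive_set_if_computable:
  assumes "decid (\<lambda>x. x \<in> S)" shows "recursive_set S"
proof -
  obtain g where "recursive 1 g" "\<forall>xs. length xs = 1 \<longrightarrow> g xs = (if xs ! 0 \<in> S then 1 else 0)"
    using assms unfolding decid_def computable_def recursive_on_def by blast
  then show ?thesis unfolding recursive_set_def by (intro exI[of _ g]) auto
qed

section \<open>Languages of infinite words recognised by finite semigroups\<close>

definition seg :: "(nat \<Rightarrow> 'l) \<Rightarrow> nat \<Rightarrow> nat \<Rightarrow> 'l list" where
  "seg w i j = map w [i..<j]"

lemma length_seg [simp]: "length (seg w i j) = j - i"
  by (simp add: seg_def)

lemma nth_seg [simp]: "k < j - i \<Longrightarrow> seg w i j ! k = w (i + k)"
  by (simp add: seg_def)

lemma seg_eq_Nil [simp]: "seg w i j = [] \<longleftrightarrow> j \<le> i"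
  by (auto simp: seg_def)

lemma set_seg: "set (seg w i j) = w ` {i..<j}"
  by (simp add: seg_def)

lemma seg_append: "i \<le> j \<Longrightarrow> j \<le> k \<Longrightarrow> seg w i k = seg w i j @ seg w j k"
  unfolding seg_def by (metis map_append upt_add_eq_append le_Suc_ex)

lemma map_seg: "map f (seg w i j) = seg (f \<circ> w) i j"
  by (simp add: seg_def)

lemma hd_seg: "i < j \<Longrightarrow> hd (seg w i j) = w i"
  by (simp add: hd_conv_nth)

lemma last_seg: "i < j \<Longrightarrow> last (seg w i j) = w (j - 1)"
  by (simp add: last_conv_nth)

lemma list_all2_seg:
  "list_all2 P (seg w a b) (seg v a b) \<longleftrightarrow> (\<forall>p. a \<le> p \<and> p < b \<longrightarrow> P (w p) (v p))"
proof -
  have "(\<forall>k<b - a. P (w (a + k)) (v (a + k))) \<longleftrightarrow> (\<forall>p. a \<le> p \<and> p < b \<longrightarrow> P (w p) (v p))"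
    by (metis diff_less_mono le_add1 le_add_diff_inverse less_diff_conv add.commute)
  then show ?thesis by (auto simp: list_all2_conv_all_nth)
qed

text \<open>The cut points of a factorisation of an infinite word into nonempty finite
  blocks.\<close>

definition cuts :: "(nat \<Rightarrow> nat) \<Rightarrow> bool" where
  "cuts h \<longleftrightarrow> strict_mono h \<and> h 0 = 0"

lemma cuts_block:
  assumes "cuts h" obtains k where "h k \<le> p" "p < h (Suc k)"
proof -
  have h: "strict_mono h" "h 0 = 0" using assms by (auto simp: cuts_def)
  have ex: "\<exists>k. p < h (Suc k)"
    using strict_mono_imp_increasing[OF h(1), of "Suc p"] by (intro exI[of _ p]) simp
  define k where "k = (LEAST k. p < h (Suc k))"
  have "p < h (Suc k)" unfolding k_def using LeastI_ex[OF ex] .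
  moreover have "h k \<le> p"
  proof (cases k)
    case (Suc k')
    then show ?thesis using not_less_Least[of k' "\<lambda>k. p < h (Suc k)"] unfolding k_def[symmetric] by simp
  qed (use h in simp)
  ultimately show ?thesis using that by blast
qed

lemma cuts_less: "cuts h \<Longrightarrow> i < j \<Longrightarrow> h i < h j"
  by (simp add: cuts_def strict_mono_less)

lemma cuts_block_unique:
  assumes "cuts h" "h k \<le> p" "p < h (Suc k)" "h k' \<le> p" "p < h (Suc k')" shows "k = k'"
proof -
  have m: "strict_mono h" using assms by (auto simp: cuts_def)
  have "h k < h (Suc k')" "h k' < h (Suc k)" using assms by auto
  then show ?thesis by (simp add: strict_mono_less[OF m])
qed

lemma word_of_blocks:
  assumes h: "cuts h" and V: "\<And>i. length (V i) = h (Suc i) - h i"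
  obtains v where "\<And>i. seg v (h i) (h (Suc i)) = V i"
proof
  define b where "b p = (THE k. h k \<le> p \<and> p < h (Suc k))" for p
  have b: "b p = k" if "h k \<le> p" "p < h (Suc k)" for p k
    unfolding b_def using cuts_block_unique[OF h] that by (intro the_equality) auto
  fix i
  show "seg (\<lambda>p. V (b p) ! (p - h (b p))) (h i) (h (Suc i)) = V i"
    by (rule nth_equalityI) (auto simp: V b[of i])
qed

lemma Ramsey_cuts:
  fixes c :: "nat \<Rightarrow> nat \<Rightarrow> nat"
  assumes "\<And>i j. i < j \<Longrightarrow> c i j \<in> C" "finite C"
  obtains g :: "nat \<Rightarrow> nat" and e where "strict_mono g" "\<And>i j. i < j \<Longrightarrow> c (g i) (g j) = e"
proof -
  have "\<exists>s. \<forall>x\<in>C. x < s"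
    using assms(2) finite_nat_set_iff_bounded by blast
  then obtain s where s: "\<And>x. x \<in> C \<Longrightarrow> x < s" by blast
  \<comment> \<open>\<open>Ramsey2\<close> colours unordered pairs; \<open>Min\<close> and
    \<open>Max\<close> recover the order.\<close>
  define f where "f X = c (Min X) (Max X)" for X
  have f: "f {x, y} = c (min x y) (max x y)" for x y by (simp add: f_def)
  have "\<forall>x\<in>UNIV. \<forall>y\<in>UNIV. x \<noteq> y \<longrightarrow> f {x, y} < s"
    using s assms(1) by (auto simp: f min_def max_def)
  from Ramsey2[OF infinite_UNIV_nat this] obtain Y t
    where Y': "Y \<subseteq> UNIV \<and> infinite Y \<and> t < s \<and> (\<forall>x\<in>Y. \<forall>y\<in>Y. x \<noteq> y \<longrightarrow> f {x, y} = t)" by (elim exE)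
  have Y: "infinite Y" "\<And>x y. x \<in> Y \<Longrightarrow> y \<in> Y \<Longrightarrow> x \<noteq> y \<Longrightarrow> f {x, y} = t" using Y' by simp_all
  show ?thesis
  proof (rule that[of "enumerate Y" t])
    show sm: "strict_mono (enumerate Y)" using Y(1) strict_mono_enumerate by blast
    fix i j :: nat assume "i < j"
    then have lt: "enumerate Y i < enumerate Y j" using sm by (simp add: strict_mono_less)
    with Y(2)[of "enumerate Y i" "enumerate Y j"] Y(1)
    show "c (enumerate Y i) (enumerate Y j) = t" by (simp add: f enumerate_in_set)
  qed
qed

text \<open>The condition on \<open>acc\<close> refers to arbitrary factorisations in which all factors but the first
  have the same type; no idempotency of that type is asked for.\<close>

definition recognises ::
  "'l set \<Rightarrow> ('l list \<Rightarrow> nat) \<Rightarrow> (nat \<Rightarrow> nat \<Rightarrow> nat) \<Rightarrow> (nat \<Rightarrow> nat \<Rightarrow> bool) \<Rightarrow> ((nat \<Rightarrow> 'l) \<Rightarrow> bool) \<Rightarrow> bool"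
where
  "recognises A ty mul acc L \<longleftrightarrow>
    finite (ty ` {u. u \<noteq> [] \<and> set u \<subseteq> A}) \<and>
    (\<forall>u v. u \<noteq> [] \<longrightarrow> v \<noteq> [] \<longrightarrow> set u \<subseteq> A \<longrightarrow> set v \<subseteq> A \<longrightarrow> ty (u @ v) = mul (ty u) (ty v)) \<and>
    (\<forall>w h e. range w \<subseteq> A \<longrightarrow> cuts h \<longrightarrow> (\<forall>i>0. ty (seg w (h i) (h (Suc i))) = e) \<longrightarrow>
      L w \<longleftrightarrow> acc (ty (seg w 0 (h 1))) e)"

definition recognisable :: "'l set \<Rightarrow> ((nat \<Rightarrow> 'l) \<Rightarrow> bool) \<Rightarrow> bool" where
  "recognisable A L \<longleftrightarrow> (\<exists>ty mul acc. recognises A ty mul acc L)"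

lemma recognisesD:
  assumes "recognises A ty mul acc L"
  shows "finite (ty ` {u. u \<noteq> [] \<and> set u \<subseteq> A})"
    and "u \<noteq> [] \<Longrightarrow> v \<noteq> [] \<Longrightarrow> set u \<subseteq> A \<Longrightarrow> set v \<subseteq> A \<Longrightarrow> ty (u @ v) = mul (ty u) (ty v)"
    and "range w \<subseteq> A \<Longrightarrow> cuts h \<Longrightarrow> (\<And>i. i > 0 \<Longrightarrow> ty (seg w (h i) (h (Suc i))) = e) \<Longrightarrow>
      L w \<longleftrightarrow> acc (ty (seg w 0 (h 1))) e"
  using assms unfolding recognises_def by blast+

lemma recognises_cong:
  assumes "recognises A ty mul acc L" "\<And>w. range w \<subseteq> A \<Longrightarrow> L w \<longleftrightarrow> L' w"
  shows "recognises A ty mul acc L'"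
proof -
  have "L' w \<longleftrightarrow> acc (ty (seg w 0 (h 1))) e"
    if "range w \<subseteq> A" "cuts h" "\<forall>i>0. ty (seg w (h i) (h (Suc i))) = e" for w h e
    using recognisesD(3)[OF assms(1) that(1,2)] that(3) assms(2)[OF that(1)] by simp
  then show ?thesis
    using recognisesD(1,2)[OF assms(1)] unfolding recognises_def by (intro conjI allI impI)
qed

lemma recognises_not:
  assumes "recognises A ty mul acc L"
  shows "recognises A ty mul (\<lambda>s e. \<not> acc s e) (\<lambda>w. \<not> L w)"
  unfolding recognises_def
proof (intro conjI allI impI)
  fix w h e assume "range w \<subseteq> A" "cuts h" "\<forall>i>0. ty (seg w (h i) (h (Suc i))) = e"
  then show "(\<not> L w) = (\<not> acc (ty (seg w 0 (h 1))) e)"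
    using recognisesD(3)[OF assms, of w h e] by simp
qed (use recognisesD(1,2)[OF assms] in auto)

lemma recognises_conj:
  assumes 1: "recognises A t1 m1 a1 L1" and 2: "recognises A t2 m2 a2 L2"
  shows "recognises A (\<lambda>u. pair (t1 u) (t2 u)) (\<lambda>x y. pair (m1 (pfst x) (pfst y)) (m2 (psnd x) (psnd y)))
    (\<lambda>x y. a1 (pfst x) (pfst y) \<and> a2 (psnd x) (psnd y)) (\<lambda>w. L1 w \<and> L2 w)"
  unfolding recognises_def
proof (intro conjI allI impI)
  let ?U = "{u. u \<noteq> [] \<and> set u \<subseteq> A}"
  have "(\<lambda>u. pair (t1 u) (t2 u)) ` ?U \<subseteq> prod_encode ` (t1 ` ?U \<times> t2 ` ?U)" by auto
  then show "finite ((\<lambda>u. pair (t1 u) (t2 u)) ` ?U)"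
    by (rule finite_subset) (intro finite_imageI finite_cartesian_product recognisesD(1)[OF 1] recognisesD(1)[OF 2])
next
  fix w h e assume w: "range w \<subseteq> A" "cuts h" and e: "\<forall>i>0. pair (t1 (seg w (h i) (h (Suc i)))) (t2 (seg w (h i) (h (Suc i)))) = e"
  have "t1 (seg w (h i) (h (Suc i))) = pfst e" "t2 (seg w (h i) (h (Suc i))) = psnd e" if "i > 0" for i
    using e that pfst_pair psnd_pair by metis+
  then show "(L1 w \<and> L2 w) = (a1 (pfst (pair (t1 (seg w 0 (h 1))) (t2 (seg w 0 (h 1))))) (pfst e) \<and>
        a2 (psnd (pair (t1 (seg w 0 (h 1))) (t2 (seg w 0 (h 1))))) (psnd e))"
    using recognisesD(3)[OF 1 w, of "pfst e"] recognisesD(3)[OF 2 w, of "psnd e"] by simp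
qed (simp add: recognisesD(2)[OF 1] recognisesD(2)[OF 2])

lemma recognises_map:
  assumes L: "recognises B ty mul acc L" and f: "f ` A \<subseteq> B"
  shows "recognises A (\<lambda>u. ty (map f u)) mul acc (\<lambda>w. L (f \<circ> w))"
  unfolding recognises_def
proof (intro conjI allI impI)
  have "(\<lambda>u. ty (map f u)) ` {u. u \<noteq> [] \<and> set u \<subseteq> A} \<subseteq> ty ` {u. u \<noteq> [] \<and> set u \<subseteq> B}"
    using f by (auto simp: image_subset_iff subset_iff intro!: imageI)
  then show "finite ((\<lambda>u. ty (map f u)) ` {u. u \<noteq> [] \<and> set u \<subseteq> A})"
    by (rule finite_subset) (rule recognisesD(1)[OF L])
next
  fix w h e assume w: "range w \<subseteq> A" "cuts h" and e: "\<forall>i>0. ty (map f (seg w (h i) (h (Suc i)))) = e"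
  have "range (f \<circ> w) \<subseteq> B" using w(1) f by auto
  from recognisesD(3)[OF L this w(2), of e] e
  show "L (f \<circ> w) = acc (ty (map f (seg w 0 (h 1)))) e" by (simp add: map_seg)
next
  fix u v :: "'b list" assume "u \<noteq> []" "v \<noteq> []" "set u \<subseteq> A" "set v \<subseteq> A"
  then show "ty (map f (u @ v)) = mul (ty (map f u)) (ty (map f v))"
    using f by (simp, intro recognisesD(2)[OF L]) auto
qed

section \<open>The power set construction\<close>

definition proj_typ :: "('l \<Rightarrow> 'm set) \<Rightarrow> ('m list \<Rightarrow> nat) \<Rightarrow> 'l list \<Rightarrow> nat" where
  "proj_typ E ty u = set_encode {ty v |v. list_all2 (\<lambda>x y. y \<in> E x) u v}"

definition proj_mul :: "(nat \<Rightarrow> nat \<Rightarrow> nat) \<Rightarrow> nat \<Rightarrow> nat \<Rightarrow> nat" where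
  "proj_mul mul m n = set_encode {mul s t |s t. s \<in> set_decode m \<and> t \<in> set_decode n}"

text \<open>For associative \<open>mul\<close> this is the subsemigroup generated by
  \<open>X\<close>, with products bracketed to the left.\<close>

inductive_set products :: "(nat \<Rightarrow> nat \<Rightarrow> nat) \<Rightarrow> nat set \<Rightarrow> nat set" for mul X where
  base: "x \<in> X \<Longrightarrow> x \<in> products mul X"
| step: "x \<in> products mul X \<Longrightarrow> y \<in> X \<Longrightarrow> mul x y \<in> products mul X"

text \<open>Cutting a lifted word anew makes its first block either the old first block, of type
  \<open>s0\<close>, or that block followed by others of product \<open>x\<close>. All later blocks
  receive one common type \<open>y\<close>, again a product of types from \<open>e\<close>.\<close>

definition proj_acc :: "(nat \<Rightarrow> nat \<Rightarrow> nat) \<Rightarrow> (nat \<Rightarrow> nat \<Rightarrow> bool) \<Rightarrow> nat \<Rightarrow> nat \<Rightarrow> bool" where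
  "proj_acc mul acc s e \<longleftrightarrow> (\<exists>s0\<in>set_decode s. \<exists>y\<in>products mul (set_decode e).
     acc s0 y \<or> (\<exists>x\<in>products mul (set_decode e). acc (mul s0 x) y))"

lemma set_decode_proj_mul:
  "set_decode (proj_mul mul m n) = {mul s t |s t. s \<in> set_decode m \<and> t \<in> set_decode n}"
proof -
  have "{mul s t |s t. s \<in> set_decode m \<and> t \<in> set_decode n} =
    (\<lambda>(s, t). mul s t) ` (set_decode m \<times> set_decode n)" by auto
  then show ?thesis unfolding proj_mul_def by (simp add: set_encode_inverse)
qed

text \<open>\<open>E x\<close> is the set of letters lying over \<open>x\<close>. A lift of a word
  with block types \<open>s, e, e, ...\<close> need not have equal block types itself; Ramsey's
  theorem merges its blocks until all but the first have the same type. Conversely, a product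
  \<open>y\<close> of \<open>m\<close> types from \<open>e\<close> can be realised over any
  \<open>m\<close> consecutive blocks after the first, since they all have the same set of types,
  and the pieces are glued together.\<close>

lemma recognises_proj:
  fixes E :: "'l \<Rightarrow> 'm set"
  assumes L: "recognises B ty mul acc L" and E: "\<And>l. l \<in> A \<Longrightarrow> E l \<subseteq> B"
  shows "recognises A (proj_typ E ty) (proj_mul mul) (proj_acc mul acc)
    (\<lambda>w. \<exists>v. (\<forall>i. v i \<in> E (w i)) \<and> L v)"
proof -
  let ?R = "\<lambda>x y. y \<in> E x"
  let ?C = "ty ` {u. u \<noteq> [] \<and> set u \<subseteq> B}"
  have vB: "v \<noteq> []" "set v \<subseteq> B" if "list_all2 ?R u v" "u \<noteq> []" "set u \<subseteq> A" for u v
    using that E by (fastforce simp: list_all2_conv_all_nth set_conv_nth)+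
  have sub: "{ty v |v. list_all2 ?R u v} \<subseteq> ?C" if "u \<noteq> []" "set u \<subseteq> A" for u
    using vB[OF _ that] by blast
  have dec: "set_decode (proj_typ E ty u) = {ty v |v. list_all2 ?R u v}" if "u \<noteq> []" "set u \<subseteq> A" for u
    unfolding proj_typ_def using finite_subset[OF sub[OF that] recognisesD(1)[OF L]]
    by (rule set_encode_inverse)
  show ?thesis
    unfolding recognises_def
  proof (intro conjI allI impI)
    have "proj_typ E ty ` {u. u \<noteq> [] \<and> set u \<subseteq> A} \<subseteq> set_encode ` Pow ?C"
      using sub unfolding proj_typ_def by blast
    then show "finite (proj_typ E ty ` {u. u \<noteq> [] \<and> set u \<subseteq> A})"
      by (rule finite_subset) (simp add: recognisesD(1)[OF L])
  next
    fix u v :: "'l list" assume uv: "u \<noteq> []" "v \<noteq> []" "set u \<subseteq> A" "set v \<subseteq> A"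
    have "{ty x |x. list_all2 ?R (u @ v) x} =
      {mul s t |s t. s \<in> set_decode (proj_typ E ty u) \<and> t \<in> set_decode (proj_typ E ty v)}" (is "?X = ?Y")
    proof
      show "?X \<subseteq> ?Y"
      proof
        fix z assume "z \<in> ?X"
        then obtain x y where "z = ty (x @ y)" "list_all2 ?R u x" "list_all2 ?R v y"
          by (auto simp: list_all2_append1)
        then show "z \<in> ?Y" using uv vB[of u x] vB[of v y] recognisesD(2)[OF L, of x y]
          by (auto simp: dec)
      qed
      show "?Y \<subseteq> ?X"
      proof
        fix z assume "z \<in> ?Y"
        then obtain x y where xy: "z = mul (ty x) (ty y)" "list_all2 ?R u x" "list_all2 ?R v y"
          using uv by (auto simp: dec)
        then have "z = ty (x @ y)" using uv vB[of u x] vB[of v y] recognisesD(2)[OF L, of x y] by simp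
        then show "z \<in> ?X" using list_all2_appendI[OF xy(2,3)] by blast
      qed
    qed
    then show "proj_typ E ty (u @ v) = proj_mul mul (proj_typ E ty u) (proj_typ E ty v)"
      unfolding proj_mul_def proj_typ_def[of E ty "u @ v"] by simp
  next
    fix w h e
    assume w: "range w \<subseteq> A" and h: "cuts h" and e: "\<forall>i>0. proj_typ E ty (seg w (h i) (h (Suc i))) = e"
    define s where "s = proj_typ E ty (seg w 0 (h 1))"
    have h0: "h 0 = 0" using h by (simp add: cuts_def)
    have hl: "h i < h j" if "i < j" for i j using cuts_less[OF h that] .
    have segA: "set (seg w i j) \<subseteq> A" for i j using w by (auto simp: set_seg)
    have decs: "set_decode s = {ty v |v. list_all2 ?R (seg w 0 (h 1)) v}"
      unfolding s_def using hl[of 0 1] h0 by (intro dec segA) auto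
    have dece: "set_decode e = {ty v |v. list_all2 ?R (seg w (h i) (h (Suc i))) v}" if "i > 0" for i
      using e that hl[of i "Suc i"] dec[of "seg w (h i) (h (Suc i))"] segA by auto
    have "(\<exists>v. (\<forall>i. v i \<in> E (w i)) \<and> L v) \<longleftrightarrow> proj_acc mul acc s e"
    proof
      assume "\<exists>v. (\<forall>i. v i \<in> E (w i)) \<and> L v"
      then obtain v where v: "\<And>i. v i \<in> E (w i)" and "L v" by blast
      have vB': "range v \<subseteq> B" using v E w by blast
      have segB: "set (seg v i j) \<subseteq> B" for i j using vB' by (auto simp: set_seg)
      have mul: "ty (seg v i k) = mul (ty (seg v i j)) (ty (seg v j k))" if "i < j" "j < k" for i j k
        using that by (subst seg_append[of i j k]) (auto intro!: recognisesD(2)[OF L] segB)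
      have all2: "list_all2 ?R (seg w i j) (seg v i j)" for i j
        by (simp add: list_all2_seg v)
      have pr: "ty (seg v (h i) (h j)) \<in> products mul (set_decode e)" if "0 < i" "i < j" for i j
        using that(2)
      proof (induction j)
        case (Suc j)
        have ej: "ty (seg v (h j) (h (Suc j))) \<in> set_decode e"
          using dece[of j] all2 Suc.prems that(1) by auto
        show ?case
        proof (cases "i = j")
          case True then show ?thesis using ej by (auto intro: products.base)
        next
          case False
          then show ?thesis
            using Suc ej hl[of i j] hl[of j "Suc j"] mul[of "h i" "h j" "h (Suc j)"]
            by (auto intro: products.step)
        qed
      qed simp
      \<comment> \<open>Only the cut points from \<open>h 1\<close> on are coloured, because the
        first block has type \<open>s\<close> and not \<open>e\<close>.\<close>
      have "ty (seg v (h (Suc i)) (h (Suc j))) \<in> ?C" if "i < j" for i j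
        using hl[of "Suc i" "Suc j"] that segB by auto
      from Ramsey_cuts[of "\<lambda>i j. ty (seg v (h (Suc i)) (h (Suc j)))", OF this recognisesD(1)[OF L]]
      obtain g :: "nat \<Rightarrow> nat" and y where g: "strict_mono g" "\<And>i j. i < j \<Longrightarrow> ty (seg v (h (Suc (g i))) (h (Suc (g j)))) = y"
        by auto
      define h' where "h' i = (case i of 0 \<Rightarrow> 0 | Suc i \<Rightarrow> h (Suc (g i)))" for i
      have h': "cuts h'" unfolding cuts_def strict_mono_Suc_iff
      proof (intro conjI allI)
        fix n show "h' n < h' (Suc n)"
          using hl[of 0 "Suc (g 0)"] h0 strict_monoD[OF g(1), of "n - 1" n] hl
          by (auto simp: h'_def split: nat.split)
      qed (simp add: h'_def)
      have "ty (seg v (h' i) (h' (Suc i))) = y" if "i > 0" for i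
        using that g(2)[of "i - 1" i] by (auto simp: h'_def split: nat.split)
      from recognisesD(3)[OF L vB' h' this] \<open>L v\<close> have a: "acc (ty (seg v 0 (h (Suc (g 0))))) y"
        by (simp add: h'_def)
      have y: "y \<in> products mul (set_decode e)"
        using pr[of "Suc (g 0)" "Suc (g 1)"] strict_monoD[OF g(1), of 0 1] g(2)[of 0 1] by auto
      have s0: "ty (seg v 0 (h 1)) \<in> set_decode s" using all2 decs by blast
      show "proj_acc mul acc s e"
      \<comment> \<open>\<open>g 0 = 0\<close> means that the first homogeneous cut point is
        \<open>h 1\<close> itself, so that nothing is merged with the first block.\<close>
      proof (cases "g 0 = 0")
        case True
        then show ?thesis using a y s0 unfolding proj_acc_def by auto
      next
        case False
        then have "ty (seg v 0 (h (Suc (g 0)))) = mul (ty (seg v 0 (h 1))) (ty (seg v (h 1) (h (Suc (g 0)))))"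
          using mul[of 0 "h 1" "h (Suc (g 0))"] hl[of 0 1] hl[of 1 "Suc (g 0)"] h0 by auto
        moreover have "ty (seg v (h 1) (h (Suc (g 0)))) \<in> products mul (set_decode e)"
          using pr[of 1 "Suc (g 0)"] False by auto
        ultimately show ?thesis using a y s0 unfolding proj_acc_def by auto
      qed
    next
      have app: "ty (x @ y) = mul (ty x) (ty y) \<and> list_all2 ?R (seg w i k) (x @ y)"
        if "list_all2 ?R (seg w i j) x" "list_all2 ?R (seg w j k) y" "i < j" "j < k" for i j k x y
      proof -
        have "x \<noteq> []" "set x \<subseteq> B" "y \<noteq> []" "set y \<subseteq> B"
          using vB[OF that(1) _ segA] vB[OF that(2) _ segA] that by auto
        then show ?thesis using recognisesD(2)[OF L] that by (auto simp: seg_append[of i j k] intro: list_all2_appendI)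
      qed
      \<comment> \<open>The number \<open>m\<close> of blocks depends on \<open>x\<close> only and
        not on the position \<open>k\<close>, because all blocks after the first have the same type
        \<open>e\<close>.\<close>
      have pr: "\<exists>m>0. \<forall>k>0. \<exists>u. list_all2 ?R (seg w (h k) (h (k + m))) u \<and> ty u = x"
        if "x \<in> products mul (set_decode e)" for x
        using that
      proof induction
        case (base x)
        then show ?case using dece by (intro exI[of _ 1]) fastforce
      next
        case (step x y)
        then obtain m where m: "m > 0" "\<And>k. k > 0 \<Longrightarrow> \<exists>u. list_all2 ?R (seg w (h k) (h (k + m))) u \<and> ty u = x"
          by blast
        have "\<exists>u. list_all2 ?R (seg w (h k) (h (k + Suc m))) u \<and> ty u = mul x y" if k: "k > 0" for k
        proof -
          obtain u where u: "list_all2 ?R (seg w (h k) (h (k + m))) u" "ty u = x" using m(2)[OF k] by blast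
          obtain v where v: "list_all2 ?R (seg w (h (k + m)) (h (Suc (k + m)))) v" "ty v = y"
            using step.hyps(2) dece[of "k + m"] k by auto
          show ?thesis
            using app[OF u(1) v(1)] u(2) v(2) hl[of k "k + m"] hl[of "k + m" "Suc (k + m)"] m(1) by auto
        qed
        then show ?case by blast
      qed
      assume "proj_acc mul acc s e"
      then obtain s0 y s' where s0: "s0 \<in> set_decode s" and y: "y \<in> products mul (set_decode e)" and a: "acc s' y"
        and s': "s' = s0 \<or> (\<exists>x\<in>products mul (set_decode e). s' = mul s0 x)"
        unfolding proj_acc_def by blast
      have "\<exists>n>0. \<exists>u. list_all2 ?R (seg w 0 (h n)) u \<and> ty u = s'"
        using s'
      proof
        assume "s' = s0"
        then show ?thesis using s0 decs by (intro exI[of _ 1]) auto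
      next
        assume "\<exists>x\<in>products mul (set_decode e). s' = mul s0 x"
        then obtain x where x: "x \<in> products mul (set_decode e)" "s' = mul s0 x" by blast
        obtain u where u: "list_all2 ?R (seg w 0 (h 1)) u" "ty u = s0" using s0 decs by auto
        obtain m where m: "m > 0" "\<exists>u. list_all2 ?R (seg w (h 1) (h (1 + m))) u \<and> ty u = x"
          using pr[OF x(1)] zero_less_one by blast
        then obtain v where v: "list_all2 ?R (seg w (h 1) (h (1 + m))) v" "ty v = x" by blast
        show ?thesis using app[OF u(1) v(1)] u(2) v(2) x(2) hl[of 0 1] hl[of 1 "1 + m"] m(1) h0
          by (intro exI[of _ "1 + m"]) auto
      qed
      then obtain n u0 where n: "n > 0" and u0: "list_all2 ?R (seg w 0 (h n)) u0" "ty u0 = s'" by blast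
      obtain m where m: "m > 0" "\<And>k. k > 0 \<Longrightarrow> \<exists>u. list_all2 ?R (seg w (h k) (h (k + m))) u \<and> ty u = y"
        using pr[OF y] by blast
      then obtain U where U: "\<And>k. k > 0 \<Longrightarrow> list_all2 ?R (seg w (h k) (h (k + m))) (U k) \<and> ty (U k) = y" by metis
      \<comment> \<open>The new first block consists of \<open>n\<close> old ones and is lifted to
        \<open>u0\<close>; from there on each run of \<open>m\<close> old blocks is lifted to a word
        of type \<open>y\<close>.\<close>
      define h' where "h' i = (case i of 0 \<Rightarrow> 0 | Suc i \<Rightarrow> h (n + i * m))" for i
      define V where "V i = (case i of 0 \<Rightarrow> u0 | Suc i \<Rightarrow> U (n + i * m))" for i
      have h'S: "h' (Suc (Suc i)) = h (n + i * m + m)" for i by (simp add: h'_def algebra_simps)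
      have h': "cuts h'" unfolding cuts_def strict_mono_Suc_iff
      proof (intro conjI allI)
        fix i show "h' i < h' (Suc i)"
        proof (cases i)
          case 0 then show ?thesis using hl[of 0 n] n h0 by (simp add: h'_def)
        next
          case (Suc k)
          then show ?thesis using hl[of "n + k * m" "n + k * m + m"] m(1) h'S[of k] by (simp add: h'_def)
        qed
      qed (simp add: h'_def)
      have V: "list_all2 ?R (seg w (h' i) (h' (Suc i))) (V i)" for i
      proof (cases i)
        case 0 then show ?thesis using u0 by (simp add: h'_def V_def)
      next
        case (Suc k)
        then show ?thesis using U[of "n + k * m"] n h'S[of k] by (simp add: h'_def V_def)
      qed
      have "length (V i) = h' (Suc i) - h' i" for i
        using list_all2_lengthD[OF V[of i]] by simp
      from word_of_blocks[of h' V, OF h' this] obtain v where v: "\<And>i. seg v (h' i) (h' (Suc i)) = V i" by blast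
      have vE: "v p \<in> E (w p)" for p
      proof -
        obtain k where "h' k \<le> p" "p < h' (Suc k)" using cuts_block[OF h'] by blast
        then show ?thesis using V[of k] unfolding v[symmetric] list_all2_seg by blast
      qed
      have "range v \<subseteq> B" using vE E w by blast
      moreover have "ty (seg v (h' i) (h' (Suc i))) = y" if "i > 0" for i
        using that U n unfolding v by (auto simp: V_def split: nat.split)
      ultimately have "L v \<longleftrightarrow> acc (ty (seg v 0 (h' 1))) y"
        using recognisesD(3)[OF L _ h'] by blast
      moreover have "seg v 0 (h' 1) = u0" using v[of 0] by (simp add: h'_def V_def)
      ultimately show "\<exists>v. (\<forall>i. v i \<in> E (w i)) \<and> L v" using vE u0 a by auto
    qed
    then show "(\<exists>v. (\<forall>i. v i \<in> E (w i)) \<and> L v) = proj_acc mul acc (proj_typ E ty (seg w 0 (h 1))) e"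
      unfolding s_def .
  qed
qed

section \<open>Recognisable languages\<close>

lemma recognisable_cong:
  "recognisable A L \<Longrightarrow> (\<And>w. range w \<subseteq> A \<Longrightarrow> L w \<longleftrightarrow> L' w) \<Longrightarrow> recognisable A L'"
  unfolding recognisable_def by (elim exE) (rule exI, rule exI, rule exI, rule recognises_cong)

lemma recognisable_not: "recognisable A L \<Longrightarrow> recognisable A (\<lambda>w. \<not> L w)"
  unfolding recognisable_def by (blast dest: recognises_not)

lemma recognisable_conj:
  "recognisable A L \<Longrightarrow> recognisable A L' \<Longrightarrow> recognisable A (\<lambda>w. L w \<and> L' w)"
  unfolding recognisable_def by (blast dest: recognises_conj)

lemma recognisable_map:
  "recognisable B L \<Longrightarrow> f ` A \<subseteq> B \<Longrightarrow> recognisable A (\<lambda>w. L (f \<circ> w))"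
  unfolding recognisable_def by (blast dest: recognises_map)

lemma recognisable_proj:
  assumes "recognisable (A \<times> B) L"
  shows "recognisable A (\<lambda>w. \<exists>v. range v \<subseteq> B \<and> L (\<lambda>i. (w i, v i)))"
proof -
  obtain ty mul acc where "recognises (A \<times> B) ty mul acc L"
    using assms unfolding recognisable_def by blast
  from recognises_proj[OF this, of A "\<lambda>x. {x} \<times> B"]
  have "recognisable A (\<lambda>w. \<exists>v. (\<forall>i. v i \<in> {w i} \<times> B) \<and> L v)"
    unfolding recognisable_def by blast
  then show ?thesis
  proof (rule recognisable_cong)
    fix w :: "nat \<Rightarrow> 'a"
    show "(\<exists>v. (\<forall>i. v i \<in> {w i} \<times> B) \<and> L v) \<longleftrightarrow> (\<exists>v. range v \<subseteq> B \<and> L (\<lambda>i. (w i, v i)))"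
    proof
      assume "\<exists>v. (\<forall>i. v i \<in> {w i} \<times> B) \<and> L v"
      then obtain v where v: "\<And>i. v i \<in> {w i} \<times> B" "L v" by blast
      then have "v = (\<lambda>i. (w i, snd (v i)))" by (intro ext) (metis SigmaE singletonD snd_conv)
      then show "\<exists>v. range v \<subseteq> B \<and> L (\<lambda>i. (w i, v i))"
        using v by (intro exI[of _ "snd \<circ> v"]) (auto simp: mem_Times_iff)
    next
      assume "\<exists>v. range v \<subseteq> B \<and> L (\<lambda>i. (w i, v i))"
      then obtain v where "range v \<subseteq> B" "L (\<lambda>i. (w i, v i))" by blast
      then show "\<exists>v. (\<forall>i. v i \<in> {w i} \<times> B) \<and> L v"
        by (intro exI[of _ "\<lambda>i. (w i, v i)"]) auto
    qed
  qed
qed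

text \<open>The type of a factor records its first and last letter, whether all transitions inside
  it are allowed, and whether \<open>G\<close> holds throughout. Concatenation only tests the
  transition at the seam, and \<open>G\<close> holds eventually iff it holds throughout the repeated
  blocks. Countability serves to code these types as numbers.\<close>

lemma recognisable_local:
  fixes A :: "'l :: countable set"
  assumes A: "finite A"
  shows "recognisable A (\<lambda>w. I (w 0) \<and> (\<forall>i. R (w i) (w (Suc i))) \<and> (\<exists>k. \<forall>j\<ge>k. G (w j)))"
proof -
  define ok where "ok u \<longleftrightarrow> successively R u" for u
  define gd where "gd u \<longleftrightarrow> (\<forall>x\<in>set u. G x)" for u
  define T where "T u = (hd u, last u, ok u, gd u)" for u
  define mul where "mul = (\<lambda>(f, l, p, q) (f', l', p', q'). (f :: 'l, l' :: 'l, p \<and> p' \<and> R l f', (q \<and> q' :: bool)))"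
  \<comment> \<open>\<open>R l f'\<close> is the seam after the first block, \<open>R l' f'\<close>
    the seam between two later blocks.\<close>
  define acc where "acc = (\<lambda>(f :: 'l, l :: 'l, p :: bool, q :: bool) (f' :: 'l, l' :: 'l, p' :: bool, q'). I f \<and> p \<and> p' \<and> R l f' \<and> R l' f' \<and> q')"
  have "recognises A (\<lambda>u. to_nat (T u)) (\<lambda>x y. to_nat (mul (from_nat x) (from_nat y)))
    (\<lambda>x y. acc (from_nat x) (from_nat y)) (\<lambda>w. I (w 0) \<and> (\<forall>i. R (w i) (w (Suc i))) \<and> (\<exists>k. \<forall>j\<ge>k. G (w j)))"
    unfolding recognises_def
  proof (intro conjI allI impI)
    have "(\<lambda>u. to_nat (T u)) ` {u. u \<noteq> [] \<and> set u \<subseteq> A} \<subseteq> to_nat ` (A \<times> A \<times> (UNIV :: bool set) \<times> (UNIV :: bool set))"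
      unfolding T_def by (auto intro!: imageI)
    then show "finite ((\<lambda>u. to_nat (T u)) ` {u. u \<noteq> [] \<and> set u \<subseteq> A})"
      by (rule finite_subset) (simp add: A)
  next
    fix u v :: "'l list" assume "u \<noteq> []" "v \<noteq> []"
    then show "to_nat (T (u @ v)) = to_nat (mul (from_nat (to_nat (T u))) (from_nat (to_nat (T v))))"
      by (auto simp: T_def mul_def ok_def gd_def successively_append_iff)
  next
    fix w h e assume h: "cuts h" and e: "\<forall>i>0. to_nat (T (seg w (h i) (h (Suc i)))) = e"
    have h0: "h 0 = 0" using h by (simp add: cuts_def)
    have hl: "h i < h (Suc i)" for i using cuts_less[OF h] by simp
    obtain f l :: 'l and p q :: bool where E: "from_nat e = (f, l, p, q)" by (metis prod_cases4)
    have Te: "T (seg w (h i) (h (Suc i))) = (f, l, p, q)" if "i > 0" for i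
      using e that E by (metis from_nat_to_nat)
    have ok_seg: "ok (seg w i j) \<longleftrightarrow> (\<forall>k. i \<le> k \<and> Suc k < j \<longrightarrow> R (w k) (w (Suc k)))" for i j
    proof -
      have "ok (seg w i j) \<longleftrightarrow> (\<forall>k. Suc k < j - i \<longrightarrow> R (w (i + k)) (w (Suc (i + k))))"
        by (auto simp: ok_def successively_conv_nth)
      also have "\<dots> \<longleftrightarrow> (\<forall>k. i \<le> k \<and> Suc k < j \<longrightarrow> R (w k) (w (Suc k)))"
      proof safe
        fix k assume *: "\<forall>k. Suc k < j - i \<longrightarrow> R (w (i + k)) (w (Suc (i + k)))" "i \<le> k" "Suc k < j"
        then show "R (w k) (w (Suc k))" using *(1)[rule_format, of "k - i"] by auto
      qed auto
      finally show ?thesis .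
    qed
    have fi: "f = w (h i)" "l = w (h (Suc i) - 1)" "p = ok (seg w (h i) (h (Suc i)))"
      "q \<longleftrightarrow> (\<forall>k. h i \<le> k \<and> k < h (Suc i) \<longrightarrow> G (w k))" if "i > 0" for i
      using Te[OF that] hl[of i] by (auto simp: T_def hd_seg last_seg gd_def set_seg)
    have R_iff: "(\<forall>i. R (w i) (w (Suc i))) \<longleftrightarrow>
      ok (seg w 0 (h 1)) \<and> p \<and> R (w (h 1 - 1)) f \<and> R l f" (is "?l \<longleftrightarrow> ?r")
    proof
      assume ?l
      moreover have "Suc (h 1 - 1) = h 1" "Suc (h 2 - 1) = h 2" using hl[of 0] hl[of 1] by (auto simp: numeral_2_eq_2)
      ultimately have "R (w (h 1 - 1)) (w (h 1))" "R (w (h 2 - 1)) (w (h 2))" by metis+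
      then show ?r
        using \<open>?l\<close> fi(1)[of 1] fi(1)[of 2] fi(2)[of 1] fi(3)[of 1] by (simp add: ok_seg numeral_2_eq_2)
    next
      assume r: ?r
      show ?l
      proof
        fix i
        obtain k where k: "h k \<le> i" "i < h (Suc k)" using cuts_block[OF h] by blast
        have okk: "ok (seg w (h k) (h (Suc k)))" using r fi(3)[of k] h0 by (cases "k = 0") auto
        show "R (w i) (w (Suc i))"
        proof (cases "Suc i = h (Suc k)")
          case True
          then have "R (w (h (Suc k) - 1)) (w (h (Suc k)))"
            using r fi(1)[of "Suc k"] fi(2)[of k] by (cases "k = 0") auto
          then show ?thesis by (simp flip: True)
        next
          case False then show ?thesis using okk k by (auto simp: ok_seg)
        qed
      qed
    qed
    have G_iff: "(\<exists>k. \<forall>j\<ge>k. G (w j)) \<longleftrightarrow> q"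
    proof
      assume "\<exists>k. \<forall>j\<ge>k. G (w j)"
      then obtain k where k: "\<forall>j\<ge>k. G (w j)" by blast
      have "Suc k \<le> h (Suc k)" using strict_mono_imp_increasing[of h] h by (auto simp: cuts_def)
      then show q using k fi(4)[of "Suc k"] by auto
    next
      assume q
      have "G (w j)" if "j \<ge> h 1" for j
      proof -
        obtain k where k: "h k \<le> j" "j < h (Suc k)" using cuts_block[OF h] by blast
        have "k \<noteq> 0" using k that by (auto intro: Nat.gr0I)
        then show ?thesis using fi(4)[of k] \<open>q\<close> k by auto
      qed
      then show "\<exists>k. \<forall>j\<ge>k. G (w j)" by blast
    qed
    have "T (seg w 0 (h 1)) = (w 0, w (h 1 - 1), ok (seg w 0 (h 1)), gd (seg w 0 (h 1)))"
      using hl[of 0] h0 by (simp add: T_def hd_seg last_seg)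
    then show "(I (w 0) \<and> (\<forall>i. R (w i) (w (Suc i))) \<and> (\<exists>k. \<forall>j\<ge>k. G (w j))) =
       acc (from_nat (to_nat (T (seg w 0 (h 1))))) (from_nat e)"
      unfolding R_iff G_iff by (auto simp: E acc_def)
  qed
  then show ?thesis unfolding recognisable_def by blast
qed

section \<open>Monadic formulas over infinite words\<close>

text \<open>\<open>CAt r i j k\<close> applies base relation \<open>r\<close> to the tracks
  \<open>i\<close>, \<open>j\<close>, \<open>k\<close>. All base relations are ternary; unary and
  binary ones repeat a track.\<close>

datatype core = CAt nat nat nat nat | CNeg core | CConj core core | CEx nat core

primrec ccode :: "core \<Rightarrow> nat" where
  "ccode (CAt r i j k) = pair 0 (pair r (pair i (pair j k)))"
| "ccode (CNeg \<phi>) = pair 1 (ccode \<phi>)"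
| "ccode (CConj \<phi> \<psi>) = pair 2 (pair (ccode \<phi>) (ccode \<psi>))"
| "ccode (CEx n \<phi>) = pair 3 (pair n (ccode \<phi>))"

abbreviation "left c \<equiv> pfst (psnd c)"
abbreviation "right c \<equiv> psnd (psnd c)"

lemma pfst_le: "pfst c \<le> c" and psnd_le: "psnd c \<le> c"
  by (metis le_prod_encode_1 pair_pfst_psnd, metis le_prod_encode_2 pair_pfst_psnd)

lemma le_triangle: "n \<le> triangle n"
  by (induction n) auto

text \<open>The source of all termination arguments on codes: tag \<open>0\<close> marks atoms or
  variables, where no recursion takes place, and any other tag makes the body strictly smaller than
  the code.\<close>

lemma psnd_less: "pfst c > 0 \<Longrightarrow> psnd c < c"
  using le_triangle[of "pfst c + psnd c"] pair_pfst_psnd[of c] unfolding prod_encode_def by simp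

lemma psnd_less2: "pfst c > 0 \<Longrightarrow> left c < c" "pfst c > 0 \<Longrightarrow> right c < c"
  using psnd_less[of c] pfst_le[of "psnd c"] psnd_le[of "psnd c"] by auto

text \<open>A number with a tag other than 1, 2, 3 is read as an atom. Decoding is thus total, and
  computability can be stated for all numbers without a test for codes.\<close>

function cdec :: "nat \<Rightarrow> core" where
  "cdec c = (if pfst c = 1 then CNeg (cdec (psnd c))
     else if pfst c = 2 then CConj (cdec (left c)) (cdec (right c))
     else if pfst c = 3 then CEx (left c) (cdec (right c))
     else CAt (left c) (pfst (right c)) (pfst (right (psnd c))) (right (right c)))"
  by auto
termination by (relation "Wellfounded.measure id") (auto simp: psnd_less psnd_less2)

declare cdec.simps [simp del]

lemma cdec_ccode [simp]: "cdec (ccode \<phi>) = \<phi>"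
  by (induction \<phi>) (simp_all add: cdec.simps)

lemma decid_If [comput]:
  "decid P \<Longrightarrow> decid Q \<Longrightarrow> decid R \<Longrightarrow> decid (\<lambda>z. if P z then Q z else R z)"
  using decid_conj[OF decid_imp[of P Q] decid_imp[OF decid_not, of P R]] by (auto elim: decid_cong)

text \<open>Everything that the decision procedure knows about the base relations.
  \<open>bounded_amul\<close> also covers arguments that are not types, so that the closure search
  justified by \<open>iter_prod_stable\<close> ends on every input.\<close>

locale atoms =
  fixes b :: nat and aty :: "nat \<Rightarrow> (nat \<times> nat \<times> nat) list \<Rightarrow> nat"
    and amul :: "nat \<Rightarrow> nat \<Rightarrow> nat \<Rightarrow> nat" and aacc :: "nat \<Rightarrow> nat \<Rightarrow> nat \<Rightarrow> bool"
    and rel :: "nat \<Rightarrow> (nat \<Rightarrow> nat \<times> nat \<times> nat) \<Rightarrow> bool"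
  assumes b_pos: "b > 0"
    and atoms_recognised: "recognises ({..<b} \<times> {..<b} \<times> {..<b}) (aty r) (amul r) (aacc r) (rel r)"
    and computable_aty': "computable (\<lambda>z. aty (pfst z) [(left z, pfst (right z), right (psnd z))])"
    and computable_amul': "computable (\<lambda>z. amul (pfst z) (left z) (right z))"
    and decid_aacc': "decid (\<lambda>z. aacc (pfst z) (left z) (right z))"
    and bounded_amul: "\<exists>N. \<forall>r s t. amul r s t < N"
begin

text \<open>\<open>w p n\<close> is the letter of track \<open>n\<close> at position
  \<open>p\<close>. The quantifier is phrased position by position to have the form of the
  projection in \<open>recognises_proj\<close>.\<close>

primrec csat :: "core \<Rightarrow> (nat \<Rightarrow> nat \<Rightarrow> nat) \<Rightarrow> bool" where
  "csat (CAt r i j k) w \<longleftrightarrow> rel r (\<lambda>p. (w p i, w p j, w p k))"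
| "csat (CNeg \<phi>) w \<longleftrightarrow> \<not> csat \<phi> w"
| "csat (CConj \<phi> \<psi>) w \<longleftrightarrow> csat \<phi> w \<and> csat \<psi> w"
| "csat (CEx n \<phi>) w \<longleftrightarrow> (\<exists>v. (\<forall>p. v p \<in> (\<lambda>d. (w p)(n := d)) ` {..<b}) \<and> csat \<phi> v)"

primrec cty :: "core \<Rightarrow> (nat \<Rightarrow> nat) list \<Rightarrow> nat" where
  "cty (CAt r i j k) = (\<lambda>u. aty r (map (\<lambda>l. (l i, l j, l k)) u))"
| "cty (CNeg \<phi>) = cty \<phi>"
| "cty (CConj \<phi> \<psi>) = (\<lambda>u. pair (cty \<phi> u) (cty \<psi> u))"
| "cty (CEx n \<phi>) = proj_typ (\<lambda>l. (\<lambda>d. l(n := d)) ` {..<b}) (cty \<phi>)"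

primrec cmul :: "core \<Rightarrow> nat \<Rightarrow> nat \<Rightarrow> nat" where
  "cmul (CAt r i j k) = amul r"
| "cmul (CNeg \<phi>) = cmul \<phi>"
| "cmul (CConj \<phi> \<psi>) = (\<lambda>x y. pair (cmul \<phi> (pfst x) (pfst y)) (cmul \<psi> (psnd x) (psnd y)))"
| "cmul (CEx n \<phi>) = proj_mul (cmul \<phi>)"

primrec cacc :: "core \<Rightarrow> nat \<Rightarrow> nat \<Rightarrow> bool" where
  "cacc (CAt r i j k) = aacc r"
| "cacc (CNeg \<phi>) = (\<lambda>s e. \<not> cacc \<phi> s e)"
| "cacc (CConj \<phi> \<psi>) = (\<lambda>x y. cacc \<phi> (pfst x) (pfst y) \<and> cacc \<psi> (psnd x) (psnd y))"
| "cacc (CEx n \<phi>) = proj_acc (cmul \<phi>) (cacc \<phi>)"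

abbreviation "valuations \<equiv> {l :: nat \<Rightarrow> nat. \<forall>n. l n < b}"

lemma core_recognised: "recognises valuations (cty \<phi>) (cmul \<phi>) (cacc \<phi>) (csat \<phi>)"
proof (induction \<phi>)
  case (CAt r i j k)
  have "(\<lambda>l. (l i, l j, l k)) ` valuations \<subseteq> {..<b} \<times> {..<b} \<times> {..<b}" by auto
  from recognises_map[OF atoms_recognised this]
  show ?case by (simp add: csat.simps(1)[abs_def] o_def)
next
  case (CNeg \<phi>)
  then show ?case using recognises_not by (simp add: csat.simps(2)[abs_def])
next
  case (CConj \<phi> \<psi>)
  then show ?case using recognises_conj by (simp add: csat.simps(3)[abs_def])
next
  case (CEx n \<phi>)
  have "(\<lambda>d. l(n := d)) ` {..<b} \<subseteq> valuations" if "l \<in> valuations" for l using that by auto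
  then have "recognises valuations (proj_typ (\<lambda>l. (\<lambda>d. l(n := d)) ` {..<b}) (cty \<phi>))
    (proj_mul (cmul \<phi>)) (proj_acc (cmul \<phi>) (cacc \<phi>))
    (\<lambda>w. \<exists>v. (\<forall>i. v i \<in> (\<lambda>d. (w i)(n := d)) ` {..<b}) \<and> csat \<phi> v)"
    by (rule recognises_proj[OF CEx])
  then show ?case by (simp add: csat.simps(4)[abs_def])
qed

text \<open>Cut the constant word into single letters: every block has the type of \<open>l\<close>,
  so this one type decides.\<close>

lemma csat_const:
  assumes "\<And>n. l n < b"
  shows "csat \<phi> (\<lambda>_. l) \<longleftrightarrow> cacc \<phi> (cty \<phi> [l]) (cty \<phi> [l])"
proof -
  have "cuts (\<lambda>i. i)" by (simp add: cuts_def strict_mono_def)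
  moreover have "seg (\<lambda>_. l) i (Suc i) = [l]" for i by (simp add: seg_def)
  ultimately show ?thesis
    using recognisesD(3)[OF core_recognised, of "\<lambda>_. l" "\<lambda>i. i" \<phi> "cty \<phi> [l]"] assms
    by (auto simp: image_subset_iff)
qed

section \<open>Deciding monadic formulas from their codes\<close>

text \<open>A valuation is coded by its finite graph; undefined entries are \<open>0\<close>.\<close>

definition look :: "nat \<Rightarrow> nat \<Rightarrow> nat" where
  "look a i = (LEAST d. pair i d \<in> set_decode a \<or> b \<le> d) mod b"

text \<open>Elements of \<open>set_decode a\<close> are below \<open>a\<close>, so the bound
  excludes nothing; it provides the form required by \<open>computable_set_encode\<close>.\<close>

definition upd :: "nat \<Rightarrow> nat \<Rightarrow> nat \<Rightarrow> nat" where
  "upd a n d = set_encode {p. p < Suc (a + pair n d) \<and> (p = pair n d \<or> (p \<in> set_decode a \<and> pfst p \<noteq> n))}"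

lemma look_0: "look 0 = (\<lambda>_. 0)"
proof -
  have "(LEAST d. b \<le> d) = b" by (intro Least_equality) auto
  then show ?thesis by (auto simp: look_def)
qed

lemma look_less: "look a i < b"
  using b_pos by (simp add: look_def)

lemma look_upd:
  assumes "d < b" shows "look (upd a n d) = (look a)(n := d)"
proof
  fix i
  have dec: "set_decode (upd a n d) = insert (pair n d) {p \<in> set_decode a. pfst p \<noteq> n}"
    unfolding upd_def using set_decode_less[of _ a]
    by (subst set_encode_inverse) (auto intro: less_SucI trans_less_add1)
  show "look (upd a n d) i = ((look a)(n := d)) i"
  proof (cases "i = n")
    case True
    have "(LEAST d'. pair n d' \<in> set_decode (upd a n d) \<or> b \<le> d') = d"
      unfolding dec by (rule Least_equality) (use assms in auto)
    then show ?thesis using assms True by (simp add: look_def)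
  next
    case False then show ?thesis by (simp add: look_def dec)
  qed
qed

lemma computable_look [comput]:
  assumes "computable f" "computable g" shows "computable (\<lambda>z. look (f z) (g z))"
proof -
  have L: "computable (\<lambda>z. LEAST d. pair (g z) d \<in> set_decode (f z) \<or> b \<le> d)"
    by (rule computable_Least) (intro comput computable_comp[OF assms(1)] computable_comp[OF assms(2)], auto)
  have m: "m mod b = m - b * (m div b)" for m by (simp add: minus_mult_div_eq_mod)
  show ?thesis unfolding look_def m by (intro comput L)
qed

lemma computable_upd [comput]:
  assumes "computable f" "computable g" "computable h" shows "computable (\<lambda>z. upd (f z) (g z) (h z))"
  unfolding upd_def
  by (rule computable_set_encode)
    (intro comput computable_comp[OF assms(1)] computable_comp[OF assms(2)] computable_comp[OF assms(3)] assms)+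

lemma computable_aty [comput]:
  assumes "computable f" "computable g" "computable h" "computable k"
  shows "computable (\<lambda>z. aty (f z) [(g z, h z, k z)])"
  using computable_comp[OF computable_aty', of "\<lambda>z. pair (f z) (pair (g z) (pair (h z) (k z)))"] assms
  by (simp add: comput)

lemmas computable_amul [comput] = computable_comp3[where F = amul, OF computable_amul']

lemma decid_aacc [comput]:
  assumes "computable f" "computable g" "computable h" shows "decid (\<lambda>z. aacc (f z) (g z) (h z))"
  using computable_comp3[where F = "\<lambda>r s e. if aacc r s e then 1 else 0"] decid_aacc' assms
  unfolding decid_def by blast

lemma set_encode_eq_iff: "finite X \<Longrightarrow> y = set_encode X \<longleftrightarrow> set_decode y = X"
  by (metis set_decode_inverse set_encode_inverse)

lemma finite_set_products: "finite {f s t |s t. s \<in> set_decode m \<and> t \<in> set_decode n}"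
  by (rule finite_subset[of _ "(\<lambda>(s, t). f s t) ` (set_decode m \<times> set_decode n)"]) auto

text \<open>By \<open>csat_const\<close>, types are needed for one-letter words only. A quantifier
  changes the valuation and collects the values at \<open>b\<close> updated valuations, which is not
  the shape of \<open>rec_nat\<close>; hence the tables.\<close>

lemma computable_letter: "computable (\<lambda>z. cty (cdec (pfst z)) [look (psnd z)])"
proof (rule computable_by_tables[where \<mu> = pfst])
  let ?F = "\<lambda>z. cty (cdec (pfst z)) [look (psnd z)]"
  \<comment> \<open>The clauses follow \<open>cty\<close>. At a quantifier, \<open>y\<close> has to
    code exactly the set of table values at the updated valuations, one inclusion per
    conjunct.\<close>
  define J where "J T x y \<longleftrightarrow> (if pfst (pfst x) = 1 then T (pair (psnd (pfst x)) (psnd x)) y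
     else if pfst (pfst x) = 2 then T (pair (left (pfst x)) (psnd x)) (pfst y) \<and> T (pair (right (pfst x)) (psnd x)) (psnd y)
     else if pfst (pfst x) = 3 then
       (\<forall>d<b. \<exists>u\<in>set_decode y. T (pair (right (pfst x)) (upd (psnd x) (left (pfst x)) d)) u) \<and> (\<forall>u\<in>set_decode y. \<exists>d<b. T (pair (right (pfst x)) (upd (psnd x) (left (pfst x)) d)) u)
     else y = aty (left (pfst x)) [(look (psnd x) (pfst (right (pfst x))),
       look (psnd x) (pfst (right (psnd (pfst x)))), look (psnd x) (right (right (pfst x))))])"
    for T x y
  show "decid (\<lambda>z. J (\<lambda>x y. pair x y \<in> set_decode (pfst z)) (left z) (right z))"
    unfolding J_def by (intro comput)
  have ex: "?F x = set_encode ((\<lambda>d. cty (cdec (right (pfst x))) [look (upd (psnd x) (left (pfst x)) d)]) ` {..<b})"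
    if "pfst (pfst x) = 3" for x
    using that by (auto simp: cdec.simps[of "pfst x"] proj_typ_def list_all2_Cons1 look_upd intro!: arg_cong[of _ _ set_encode])
  show "y = ?F x" if T: "\<And>x' y'. T x' y' \<Longrightarrow> pfst x' < pfst x \<Longrightarrow> y' = ?F x'" and J: "J T x y" for T x y
  proof -
    consider "pfst (pfst x) = 1" | "pfst (pfst x) = 2" | "pfst (pfst x) = 3" | "pfst (pfst x) \<notin> {1, 2, 3}" by auto
    then show ?thesis
    proof cases
      case 1
      with J T[of "pair (psnd (pfst x)) (psnd x)" y] psnd_less[of "pfst x"] show ?thesis by (simp add: J_def cdec.simps[of "pfst x"])
    next
      case 2
      have T': "y' = ?F (pair (left (pfst x)) z)" if "T (pair (left (pfst x)) z) y'" for z y'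
        using T[OF that] psnd_less2[of "pfst x"] 2 by simp
      have T'': "y' = ?F (pair (right (pfst x)) z)" if "T (pair (right (pfst x)) z) y'" for z y'
        using T[OF that] psnd_less2[of "pfst x"] 2 by simp
      have "pair (pfst y) (psnd y) = ?F x"
        using 2 J by (auto simp: J_def cdec.simps[of "pfst x"] simp del: pair_pfst_psnd dest!: T' T'')
      then show ?thesis by simp
    next
      case 3
      have T': "y' = ?F (pair (right (pfst x)) z)" if "T (pair (right (pfst x)) z) y'" for z y'
        using T[OF that] psnd_less2[of "pfst x"] 3 by simp
      show ?thesis
        unfolding ex[OF 3] using 3 J T' by (subst set_encode_eq_iff) (auto simp: J_def image_iff, fastforce+)
    next
      case 4
      with J show ?thesis by (simp add: J_def cdec.simps[of "pfst x"])
    qed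
  qed
  show "\<exists>X. finite X \<and> (\<forall>x'\<in>X. pfst x' < pfst x) \<and> (\<forall>T. (\<forall>x'\<in>X. T x' (?F x')) \<longrightarrow> J T x (?F x))" for x
  proof -
    consider "pfst (pfst x) = 1" | "pfst (pfst x) = 2" | "pfst (pfst x) = 3" | "pfst (pfst x) \<notin> {1, 2, 3}" by auto
    then show ?thesis
    proof cases
      case 1
      then show ?thesis using psnd_less[of "pfst x"]
        by (intro exI[of _ "{pair (psnd (pfst x)) (psnd x)}"]) (auto simp: J_def cdec.simps[of "pfst x"])
    next
      case 2
      then show ?thesis using psnd_less2[of "pfst x"]
        by (intro exI[of _ "{pair (left (pfst x)) (psnd x), pair (right (pfst x)) (psnd x)}"])
          (auto simp: J_def cdec.simps[of "pfst x"])
    next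
      case 3
      show ?thesis using psnd_less2[of "pfst x"] 3 unfolding ex[OF 3]
        by (intro exI[of _ "(\<lambda>d. pair (right (pfst x)) (upd (psnd x) (left (pfst x)) d)) ` {..<b}"])
          (auto simp: J_def set_encode_inverse)
    next
      case 4
      then show ?thesis by (intro exI[of _ "{}"]) (simp add: J_def cdec.simps[of "pfst x"])
    qed
  qed
qed

lemma computable_cmul': "computable (\<lambda>z. cmul (cdec (pfst z)) (left z) (right z))"
proof (rule computable_by_tables[where \<mu> = pfst])
  let ?F = "\<lambda>z. cmul (cdec (pfst z)) (left z) (right z)"
  define J where "J T x y \<longleftrightarrow> (if pfst (pfst x) = 1 then T (pair (psnd (pfst x)) (psnd x)) y
     else if pfst (pfst x) = 2 then
       T (pair (left (pfst x)) (pair (pfst (left x)) (pfst (right x)))) (pfst y) \<and>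
       T (pair (right (pfst x)) (pair (psnd (left x)) (right (psnd x)))) (psnd y)
     else if pfst (pfst x) = 3 then
       (\<forall>s\<in>set_decode (left x). \<forall>t\<in>set_decode (right x). \<exists>u\<in>set_decode y.
          T (pair (right (pfst x)) (pair s t)) u) \<and> (\<forall>u\<in>set_decode y. \<exists>s\<in>set_decode (left x). \<exists>t\<in>set_decode (right x).
          T (pair (right (pfst x)) (pair s t)) u)
     else y = amul (left (pfst x)) (left x) (right x))"
    for T x y
  show "decid (\<lambda>z. J (\<lambda>x y. pair x y \<in> set_decode (pfst z)) (left z) (right z))"
    unfolding J_def by (intro comput)
  have ex: "?F x = set_encode {cmul (cdec (right (pfst x))) s t |s t. s \<in> set_decode (left x) \<and> t \<in> set_decode (right x)}"
    if "pfst (pfst x) = 3" for x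
    using that by (simp add: cdec.simps[of "pfst x"] proj_mul_def)
  show "y = ?F x" if T: "\<And>x' y'. T x' y' \<Longrightarrow> pfst x' < pfst x \<Longrightarrow> y' = ?F x'" and J: "J T x y" for T x y
  proof -
    consider "pfst (pfst x) = 1" | "pfst (pfst x) = 2" | "pfst (pfst x) = 3" | "pfst (pfst x) \<notin> {1, 2, 3}" by auto
    then show ?thesis
    proof cases
      case 1
      with J T[of "pair (psnd (pfst x)) (psnd x)" y] psnd_less[of "pfst x"] show ?thesis by (simp add: J_def cdec.simps[of "pfst x"])
    next
      case 2
      have T': "y' = ?F (pair (left (pfst x)) z)" if "T (pair (left (pfst x)) z) y'" for z y'
        using T[OF that] psnd_less2[of "pfst x"] 2 by simp
      have T'': "y' = ?F (pair (right (pfst x)) z)" if "T (pair (right (pfst x)) z) y'" for z y'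
        using T[OF that] psnd_less2[of "pfst x"] 2 by simp
      have "pair (pfst y) (psnd y) = ?F x"
        using 2 J by (auto simp: J_def cdec.simps[of "pfst x"] simp del: pair_pfst_psnd dest!: T' T'')
      then show ?thesis by simp
    next
      case 3
      have T': "y' = cmul (cdec (right (pfst x))) s t" if "T (pair (right (pfst x)) (pair s t)) y'" for s t y'
        using T[OF that] psnd_less2[of "pfst x"] 3 by simp
      show ?thesis
        unfolding ex[OF 3] set_encode_eq_iff[OF finite_set_products]
        using 3 J T' by (simp add: J_def) blast
    next
      case 4
      with J show ?thesis by (simp add: J_def cdec.simps[of "pfst x"])
    qed
  qed
  show "\<exists>X. finite X \<and> (\<forall>x'\<in>X. pfst x' < pfst x) \<and> (\<forall>T. (\<forall>x'\<in>X. T x' (?F x')) \<longrightarrow> J T x (?F x))" for x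
  proof -
    consider "pfst (pfst x) = 1" | "pfst (pfst x) = 2" | "pfst (pfst x) = 3" | "pfst (pfst x) \<notin> {1, 2, 3}" by auto
    then show ?thesis
    proof cases
      case 1
      then show ?thesis using psnd_less[of "pfst x"]
        by (intro exI[of _ "{pair (psnd (pfst x)) (psnd x)}"]) (auto simp: J_def cdec.simps[of "pfst x"])
    next
      case 2
      then show ?thesis using psnd_less2[of "pfst x"]
        by (intro exI[of _ "{pair (left (pfst x)) (pair (pfst (left x)) (pfst (right x))),
           pair (right (pfst x)) (pair (psnd (left x)) (right (psnd x)))}"])
          (auto simp: J_def cdec.simps[of "pfst x"])
    next
      case 3
      show ?thesis using psnd_less2[of "pfst x"] 3 unfolding ex[OF 3]
        by (intro exI[of _ "(\<lambda>(s, t). pair (right (pfst x)) (pair s t)) ` (set_decode (left x) \<times> set_decode (right x))"])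
          (auto simp: J_def set_encode_inverse[OF finite_set_products])
    next
      case 4
      then show ?thesis by (intro exI[of _ "{}"]) (simp add: J_def cdec.simps[of "pfst x"])
    qed
  qed
qed

lemmas computable_cmul [comput] = computable_comp3[where F = "\<lambda>c. cmul (cdec c)", OF computable_cmul']

lemma bounded_cmul: "\<exists>N. \<forall>s t. cmul \<phi> s t < N"
proof (induction \<phi>)
  case (CAt r i j k) then show ?case using bounded_amul by auto
next
  case (CConj \<phi> \<psi>)
  then obtain N M where NM: "\<And>s t. cmul \<phi> s t < N" "\<And>s t. cmul \<psi> s t < M" by blast
  have "finite (prod_encode ` ({..<N} \<times> {..<M}))" by simp
  then obtain K where "\<forall>x\<in>prod_encode ` ({..<N} \<times> {..<M}). x < K" unfolding finite_nat_set_iff_bounded by blast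
  then show ?case using NM by (intro exI[of _ K]) auto
next
  case (CEx n \<phi>)
  then obtain N where N: "\<And>s t. cmul \<phi> s t < N" by blast
  have "finite (set_encode ` Pow {..<N})" by simp
  then obtain K where "\<forall>x\<in>set_encode ` Pow {..<N}. x < K" unfolding finite_nat_set_iff_bounded by blast
  moreover have "proj_mul (cmul \<phi>) s t \<in> set_encode ` Pow {..<N}" for s t
    unfolding proj_mul_def using N by auto
  ultimately show ?case unfolding cmul.simps by blast
qed simp

text \<open>Computes \<open>products\<close> by iteration: stage \<open>n\<close> codes the products
  of at most \<open>n + 1\<close> elements of \<open>set_decode e\<close>.\<close>

definition iter_prod :: "core \<Rightarrow> nat \<Rightarrow> nat \<Rightarrow> nat" where
  "iter_prod \<phi> e n = rec_nat e (\<lambda>_ m. set_encode (set_decode m \<union> set_decode (proj_mul (cmul \<phi>) m e))) n"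

lemma iter_prod_0 [simp]: "iter_prod \<phi> e 0 = e"
  by (simp add: iter_prod_def)

lemma set_decode_iter_prod_Suc:
  "set_decode (iter_prod \<phi> e (Suc n)) = set_decode (iter_prod \<phi> e n) \<union>
    {cmul \<phi> s t |s t. s \<in> set_decode (iter_prod \<phi> e n) \<and> t \<in> set_decode e}"
  by (simp add: iter_prod_def set_decode_proj_mul[symmetric] set_encode_inverse)

lemma iter_prod_products: "set_decode (iter_prod \<phi> e n) \<subseteq> products (cmul \<phi>) (set_decode e)"
proof (induction n)
  case 0 show ?case by (auto intro: products.base)
next
  case (Suc n) then show ?case unfolding set_decode_iter_prod_Suc by (auto intro: products.step)
qed

text \<open>The stages increase inside the finite set \<open>set_decode e \<union> {..<N}\<close>;
  if no two neighbours agreed, their cardinalities would be unbounded.\<close>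

lemma iter_prod_stable: "\<exists>n. iter_prod \<phi> e (Suc n) = iter_prod \<phi> e n"
proof (rule ccontr)
  assume ne: "\<nexists>n. iter_prod \<phi> e (Suc n) = iter_prod \<phi> e n"
  obtain N where N: "\<And>s t. cmul \<phi> s t < N" using bounded_cmul by blast
  have sub: "set_decode (iter_prod \<phi> e n) \<subseteq> set_decode e \<union> {..<N}" for n
    by (induction n) (auto simp: set_decode_iter_prod_Suc N)
  have "card (set_decode (iter_prod \<phi> e n)) < card (set_decode (iter_prod \<phi> e (Suc n)))" for n
    by (intro psubset_card_mono psubsetI finite_set_decode)
      (use ne in \<open>auto simp: set_decode_iter_prod_Suc dest: arg_cong[of _ _ set_encode]\<close>,
       metis ne set_decode_inverse set_decode_iter_prod_Suc)
  then have "strict_mono (\<lambda>n. card (set_decode (iter_prod \<phi> e n)))" by (simp add: strict_mono_Suc_iff)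
  from strict_mono_imp_increasing[OF this, of "Suc (card (set_decode e \<union> {..<N}))"]
  show False using card_mono[OF _ sub] by (metis Suc_n_not_le_n finite_UnI finite_lessThan finite_set_decode le_trans)
qed

definition closure_code :: "core \<Rightarrow> nat \<Rightarrow> nat" where
  "closure_code \<phi> e = iter_prod \<phi> e (LEAST n. iter_prod \<phi> e (Suc n) = iter_prod \<phi> e n)"

lemma set_decode_closure_code: "set_decode (closure_code \<phi> e) = products (cmul \<phi>) (set_decode e)"
proof
  show "set_decode (closure_code \<phi> e) \<subseteq> products (cmul \<phi>) (set_decode e)"
    unfolding closure_code_def by (rule iter_prod_products)
  define n where "n = (LEAST n. iter_prod \<phi> e (Suc n) = iter_prod \<phi> e n)"
  have n: "iter_prod \<phi> e (Suc n) = iter_prod \<phi> e n"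
    unfolding n_def by (rule LeastI_ex[OF iter_prod_stable])
  have e: "set_decode e \<subseteq> set_decode (iter_prod \<phi> e m)" for m
    by (induction m) (auto simp: set_decode_iter_prod_Suc)
  have "x \<in> set_decode (iter_prod \<phi> e n)" if "x \<in> products (cmul \<phi>) (set_decode e)" for x
    using that
  proof induction
    case (step x y)
    then show ?case using set_decode_iter_prod_Suc[of \<phi> e n] unfolding n by blast
  qed (use e in auto)
  then show "products (cmul \<phi>) (set_decode e) \<subseteq> set_decode (closure_code \<phi> e)"
    unfolding closure_code_def n_def by blast
qed

lemma computable_iter_prod:
  "computable (\<lambda>z. iter_prod (cdec (pfst z)) (left z) (right z))"
proof -
  have un: "set_encode (set_decode x \<union> set_decode y) =
    set_encode {p. p < x + y \<and> (p \<in> set_decode x \<or> p \<in> set_decode y)}" for x y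
    by (rule arg_cong[of _ _ set_encode]) (auto dest: set_decode_less intro: trans_less_add1 trans_less_add2)
  \<comment> \<open>\<open>pair 3 (pair 0 c)\<close> codes \<open>CEx 0 (cdec c)\<close>, whose
    multiplication is this very \<open>proj_mul\<close>; its computability is therefore that of
    \<open>cmul\<close>.\<close>
  have pm: "proj_mul (cmul (cdec c)) x y = cmul (cdec (pair 3 (pair 0 c))) x y" for c x y
    by (simp add: cdec.simps[of "pair 3 (pair 0 c)"])
  show ?thesis
    unfolding iter_prod_def un pm
    by (intro computable_rec_nat computable_set_encode comput)
qed

lemma computable_closure_code': "computable (\<lambda>z. closure_code (cdec (pfst z)) (psnd z))"
proof -
  note i = computable_comp3[where F = "\<lambda>c. iter_prod (cdec c)", OF computable_iter_prod]
  show ?thesis unfolding closure_code_def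
    by (intro i comput computable_Least iter_prod_stable)
qed

lemmas computable_closure_code [comput] =
  computable_comp2[where F = "\<lambda>c. closure_code (cdec c)", OF computable_closure_code']

lemma decid_cacc: "decid (\<lambda>z. cacc (cdec (pfst z)) (left z) (right z))"
  unfolding decid_def
proof (rule computable_by_tables[where \<mu> = pfst])
  let ?F = "\<lambda>z. if cacc (cdec (pfst z)) (left z) (right z) then 1 else 0 :: nat"
  let ?c = "\<lambda>x. cacc (cdec (right (pfst x)))" and ?m = "\<lambda>x. cmul (cdec (right (pfst x)))"
    and ?S = "\<lambda>x. set_decode (left x)" and ?p = "\<lambda>x s t. pair (right (pfst x)) (pair s t)"
    and ?C = "\<lambda>x. set_decode (closure_code (cdec (right (pfst x))) (right x))"
  \<comment> \<open>\<open>y\<close> is a truth value 0 or 1. At a quantifier, 1 is justified by a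
    single entry 1, whereas 0 needs entries 0 for all choices. \<open>?C x\<close> is the set
    \<open>products\<close> occurring in \<open>proj_acc\<close>.\<close>
  define J where "J T x y \<longleftrightarrow> (if pfst (pfst x) = 1 then y \<le> 1 \<and> T (pair (psnd (pfst x)) (psnd x)) (1 - y)
     else if pfst (pfst x) = 2 then (\<exists>u<2. \<exists>v<2. y = u * v \<and>
       T (pair (left (pfst x)) (pair (pfst (left x)) (pfst (right x)))) u \<and>
       T (pair (right (pfst x)) (pair (psnd (left x)) (right (psnd x)))) v)
     else if pfst (pfst x) = 3 then
       (y = 1 \<and> (\<exists>s\<in>?S x. \<exists>t\<in>?C x. T (?p x s t) 1 \<or> (\<exists>u\<in>?C x. T (?p x (?m x s u) t) 1))) \<or>
       (y = 0 \<and> (\<forall>s\<in>?S x. \<forall>t\<in>?C x. T (?p x s t) 0 \<and> (\<forall>u\<in>?C x. T (?p x (?m x s u) t) 0)))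
     else y = (if aacc (left (pfst x)) (left x) (right x) then 1 else 0))"
    for T and x y :: nat
  show "decid (\<lambda>z. J (\<lambda>x y. pair x y \<in> set_decode (pfst z)) (left z) (right z))"
    unfolding J_def by (intro comput)
  have ex: "?F x = (if \<exists>s\<in>?S x. \<exists>t\<in>?C x. ?c x s t \<or> (\<exists>u\<in>?C x. ?c x (?m x s u) t) then 1 else 0)"
    if "pfst (pfst x) = 3" for x
    using that by (simp add: cdec.simps[of "pfst x"] proj_acc_def set_decode_closure_code)
  show "y = ?F x" if T: "\<And>x' y'. T x' y' \<Longrightarrow> pfst x' < pfst x \<Longrightarrow> y' = ?F x'" and J: "J T x y" for T x y
  proof -
    consider "pfst (pfst x) = 1" | "pfst (pfst x) = 2" | "pfst (pfst x) = 3" | "pfst (pfst x) \<notin> {1, 2, 3}" by auto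
    then show ?thesis
    proof cases
      case 1
      with J T[of "pair (psnd (pfst x)) (psnd x)" "1 - y"] psnd_less[of "pfst x"] show ?thesis
        by (auto simp: J_def cdec.simps[of "pfst x"] split: if_splits)
    next
      case 2
      have T': "y' = ?F (pair (left (pfst x)) z)" if "T (pair (left (pfst x)) z) y'" for z y'
        using T[OF that] psnd_less2[of "pfst x"] 2 by simp
      have T'': "y' = ?F (pair (right (pfst x)) z)" if "T (pair (right (pfst x)) z) y'" for z y'
        using T[OF that] psnd_less2[of "pfst x"] 2 by simp
      show ?thesis using 2 J by (auto simp: J_def cdec.simps[of "pfst x"] dest!: T' T'')
    next
      case 3
      have T': "y' = (if ?c x s t then 1 else 0)" if "T (?p x s t) y'" for s t y'
        using T[OF that] psnd_less2[of "pfst x"] 3 by simp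
      have T1: "?c x s t" if "T (?p x s t) 1" for s t
        using T'[OF that] by (simp split: if_splits)
      have T0: "\<not> ?c x s t" if "T (?p x s t) 0" for s t
        using T'[OF that] by (simp split: if_splits)
      from J 3 consider
        "y = 1" "\<exists>s\<in>?S x. \<exists>t\<in>?C x. T (?p x s t) 1 \<or> (\<exists>u\<in>?C x. T (?p x (?m x s u) t) 1)"
      | "y = 0" "\<forall>s\<in>?S x. \<forall>t\<in>?C x. T (?p x s t) 0 \<and> (\<forall>u\<in>?C x. T (?p x (?m x s u) t) 0)"
        unfolding J_def by (auto split: if_splits)
      then show ?thesis
      proof cases
        case 1
        then show ?thesis unfolding ex[OF 3] using T1 by (subst if_P) blast+
      next
        case 2
        then show ?thesis unfolding ex[OF 3] using T0 by (subst if_not_P) blast+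
      qed
    next
      case 4
      with J show ?thesis by (simp add: J_def cdec.simps[of "pfst x"])
    qed
  qed
  show "\<exists>X. finite X \<and> (\<forall>x'\<in>X. pfst x' < pfst x) \<and> (\<forall>T. (\<forall>x'\<in>X. T x' (?F x')) \<longrightarrow> J T x (?F x))" for x
  proof -
    consider "pfst (pfst x) = 1" | "pfst (pfst x) = 2" | "pfst (pfst x) = 3" | "pfst (pfst x) \<notin> {1, 2, 3}" by auto
    then show ?thesis
    proof cases
      case 1
      then show ?thesis using psnd_less[of "pfst x"]
        by (intro exI[of _ "{pair (psnd (pfst x)) (psnd x)}"]) (auto simp: J_def cdec.simps[of "pfst x"])
    next
      case 2
      have J2: "J T x y \<longleftrightarrow> (\<exists>u<2. \<exists>v<2. y = u * v \<and>
          T (pair (left (pfst x)) (pair (pfst (left x)) (pfst (right x)))) u \<and>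
          T (pair (right (pfst x)) (pair (psnd (left x)) (right (psnd x)))) v)"
        if "pfst (pfst x) = 2" for T x y
        using that by (simp add: J_def)
      show ?thesis
      proof (intro exI[of _ "{pair (left (pfst x)) (pair (pfst (left x)) (pfst (right x))),
           pair (right (pfst x)) (pair (psnd (left x)) (right (psnd x)))}"] conjI allI impI)
        fix T assume T: "\<forall>x'\<in>{pair (left (pfst x)) (pair (pfst (left x)) (pfst (right x))),
           pair (right (pfst x)) (pair (psnd (left x)) (right (psnd x)))}. T x' (?F x')"
        define f where "f = cacc (cdec (left (pfst x))) (pfst (left x)) (pfst (right x))"
        define g where "g = ?c x (psnd (left x)) (right (psnd x))"
        have "?F x = (if f then 1 else 0) * (if g then 1 else 0)"
          using 2 by (simp add: cdec.simps[of "pfst x"] f_def g_def)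
        moreover have "T (pair (left (pfst x)) (pair (pfst (left x)) (pfst (right x)))) (if f then 1 else 0)"
          "T (pair (right (pfst x)) (pair (psnd (left x)) (right (psnd x)))) (if g then 1 else 0)"
          using T by (simp_all add: f_def g_def)
        ultimately show "J T x (?F x)"
          unfolding J2[OF 2]
          by (intro exI[of _ "if f then 1 else 0"] exI[of _ "if g then 1 else 0"] conjI) simp_all
      qed (use psnd_less2[of "pfst x"] 2 in auto)
    next
      case 3
      show ?thesis
      proof (intro exI[of _ "(\<lambda>(s, t). ?p x s t) `
            ((?S x \<union> (\<lambda>(s, u). ?m x s u) ` (?S x \<times> ?C x)) \<times> ?C x)"] conjI allI impI)
        fix T assume T: "\<forall>x'\<in>(\<lambda>(s, t). ?p x s t) `
            ((?S x \<union> (\<lambda>(s, u). ?m x s u) ` (?S x \<times> ?C x)) \<times> ?C x). T x' (?F x')"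
        have T1: "T (?p x s t) (if ?c x s t then 1 else 0)"
          if "s \<in> ?S x" "t \<in> ?C x" for s t
          using T that by auto
        have T2: "T (?p x (?m x s u) t)
            (if ?c x (?m x s u) t then 1 else 0)"
          if "s \<in> ?S x" "t \<in> ?C x" "u \<in> ?C x" for s t u
          using bspec[OF T, of "?p x (?m x s u) t"] that by force
        show "J T x (?F x)"
        proof (cases "\<exists>s\<in>?S x. \<exists>t\<in>?C x. ?c x s t \<or> (\<exists>u\<in>?C x. ?c x (?m x s u) t)")
          case True
          then have "\<exists>s\<in>?S x. \<exists>t\<in>?C x. T (?p x s t) 1 \<or> (\<exists>u\<in>?C x. T (?p x (?m x s u) t) 1)"
            using T1 T2 by (smt (verit))
          then show ?thesis using True 3 unfolding ex[OF 3] by (subst if_P[OF True]) (simp add: J_def)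
        next
          case False
          then have "\<forall>s\<in>?S x. \<forall>t\<in>?C x. T (?p x s t) 0 \<and> (\<forall>u\<in>?C x. T (?p x (?m x s u) t) 0)"
            using T1 T2 by (smt (verit))
          then show ?thesis using False 3 unfolding ex[OF 3] by (subst if_not_P[OF False]) (simp add: J_def)
        qed
      qed (use psnd_less2[of "pfst x"] 3 in auto)
    next
      case 4
      then show ?thesis by (intro exI[of _ "{}"]) (simp add: J_def cdec.simps[of "pfst x"])
    qed
  qed
qed

lemma decid_csat_zero:
  assumes "computable f" shows "decid (\<lambda>z. csat (cdec (f z)) (\<lambda>_ _. 0))"
proof -
  have l: "computable (\<lambda>z. cty (cdec (f z)) [look 0])"
    using computable_comp[OF computable_letter, of "\<lambda>z. pair (f z) 0"] assms by (simp add: comput)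
  have "decid (\<lambda>z. cacc (cdec (f z)) (cty (cdec (f z)) [look 0]) (cty (cdec (f z)) [look 0]))"
    using decid_comp[OF decid_cacc, of "\<lambda>z. pair (f z) (pair (cty (cdec (f z)) [look 0]) (cty (cdec (f z)) [look 0]))"]
      assms l by (simp add: comput)
  then show ?thesis
    using csat_const[of "look 0", OF look_less] by (simp add: look_0)
qed

end

section \<open>From first-order formulas to monadic formulas\<close>

text \<open>An element of the structure is represented by a valid word; the atom number 5 expresses
  validity, and the numbers 0 to 4 stand for addition, equality, order and the two predicates.\<close>

definition QEx :: "nat \<Rightarrow> core \<Rightarrow> core" where
  "QEx n \<phi> = CEx n (CConj (CAt 5 n n n) \<phi>)"

text \<open>\<open>graph_tm t k\<close> says that variable \<open>k\<close> has the value of \<open>t\<close>, provided that all variables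
  of \<open>t\<close> are below \<open>k\<close>; the variables above \<open>k\<close> are free for auxiliary use.\<close>

primrec graph_tm :: "tm \<Rightarrow> nat \<Rightarrow> core" where
  "graph_tm (Var n) k = CAt 1 n k k"
| "graph_tm (Plus s t) k = QEx (Suc k) (CConj (graph_tm s (Suc k))
     (QEx (Suc (Suc k)) (CConj (graph_tm t (Suc (Suc k))) (CAt 0 (Suc k) (Suc (Suc k)) k))))"

text \<open>\<open>k\<close> is the first variable free for auxiliary use; any number above the code
  of the formula will do, by \<open>var_le_code\<close>.\<close>

primrec translate :: "fm \<Rightarrow> nat \<Rightarrow> core" where
  "translate (Equal s t) k = QEx k (CConj (graph_tm s k) (graph_tm t k))"
| "translate (Less s t) k = QEx k (QEx (Suc k)
     (CConj (graph_tm s k) (CConj (graph_tm t (Suc k)) (CAt 2 k (Suc k) (Suc k)))))"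
| "translate (PredP t) k = QEx k (CConj (graph_tm t k) (CAt 3 k k k))"
| "translate (PredQ t) k = QEx k (CConj (graph_tm t k) (CAt 4 k k k))"
| "translate (Neg \<phi>) k = CNeg (translate \<phi> k)"
| "translate (Conj \<phi> \<psi>) k = CConj (translate \<phi> k) (translate \<psi> k)"
| "translate (Exists n \<phi>) k = QEx n (translate \<phi> k)"

section \<open>The translation as a function on codes\<close>

definition at_code :: "nat \<Rightarrow> nat \<Rightarrow> nat \<Rightarrow> nat \<Rightarrow> nat" where
  "at_code r i j k = pair 0 (pair r (pair i (pair j k)))"

definition conj_code :: "nat \<Rightarrow> nat \<Rightarrow> nat" where
  "conj_code u v = pair 2 (pair u v)"

definition qex_code :: "nat \<Rightarrow> nat \<Rightarrow> nat" where
  "qex_code n u = pair 3 (pair n (conj_code (at_code 5 n n n) u))"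

definition plus_code :: "nat \<Rightarrow> nat \<Rightarrow> nat \<Rightarrow> nat" where
  "plus_code k u v = qex_code (Suc k) (conj_code u (qex_code (Suc (Suc k))
     (conj_code v (at_code 0 (Suc k) (Suc (Suc k)) k))))"

lemmas code_defs = at_code_def conj_code_def qex_code_def plus_code_def

lemma le_pairI: "x \<le> m \<Longrightarrow> x \<le> pair m n" "x \<le> n \<Longrightarrow> x \<le> pair m n"
  by (meson le_prod_encode_1 le_prod_encode_2 le_trans)+

text \<open>A constructor dominates its arguments, so that the search in \<open>table2\<close> may
  be bounded by the value \<open>y\<close>.\<close>

lemma le_codes:
  "u \<le> conj_code u v" "v \<le> conj_code u v" "u \<le> qex_code n u" "u \<le> plus_code k u v" "v \<le> plus_code k u v"
proof -
  show 1: "u \<le> conj_code u v" "v \<le> conj_code u v" for u v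
    unfolding conj_code_def by (simp_all add: le_pairI)
  show 2: "u \<le> qex_code n u" for u n
    unfolding qex_code_def using 1(2)[of u] by (simp add: le_pairI)
  show "u \<le> plus_code k u v"
    unfolding plus_code_def by (rule le_trans[OF 1(1) 2])
  show "v \<le> plus_code k u v"
    unfolding plus_code_def by (rule le_trans[OF le_trans[OF le_trans[OF 1(1) 2] 1(2)] 2])
qed

text \<open>Partial results as numbers: \<open>0\<close> is failure and \<open>Suc u\<close> is the
  result \<open>u\<close>.\<close>

definition lift2 :: "(nat \<Rightarrow> nat \<Rightarrow> nat) \<Rightarrow> nat \<Rightarrow> nat \<Rightarrow> nat" where
  "lift2 f u v = (if u = 0 \<or> v = 0 then 0 else Suc (f (u - 1) (v - 1)))"

abbreviation lift1 :: "(nat \<Rightarrow> nat) \<Rightarrow> nat \<Rightarrow> nat" where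
  "lift1 f u \<equiv> lift2 (\<lambda>_. f) u u"

text \<open>The graph of \<open>lift2 f\<close> with the arguments read off from a table; the
  quantifiers are bounded to keep it decidable.\<close>

definition table2 :: "(nat \<Rightarrow> nat \<Rightarrow> nat) \<Rightarrow> (nat \<Rightarrow> nat \<Rightarrow> bool) \<Rightarrow> nat \<Rightarrow> nat \<Rightarrow> nat \<Rightarrow> bool" where
  "table2 f T a b y \<longleftrightarrow> (y = 0 \<and> (T a 0 \<or> T b 0)) \<or>
     (\<exists>u<y. \<exists>v<y. T a (Suc u) \<and> T b (Suc v) \<and> y = Suc (f u v))"

lemma lift2_simps [simp]: "lift2 f (Suc u) (Suc v) = Suc (f u v)" "lift2 f 0 v = 0" "lift2 f u 0 = 0"
  by (simp_all add: lift2_def)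

lemma lift2_pos [simp]: "0 < lift2 f u v \<longleftrightarrow> 0 < u \<and> 0 < v"
  by (simp add: lift2_def)

lemma table2_sound:
  assumes "table2 f T a b y" "\<And>y'. T a y' \<Longrightarrow> y' = u" "\<And>y'. T b y' \<Longrightarrow> y' = v"
  shows "y = lift2 f u v"
  using assms(1) unfolding table2_def
  by (elim disjE conjE exE) (auto dest!: assms(2,3) simp: lift2_def)

lemma table2_complete:
  assumes "T a u" "T b v" "\<And>u v. u \<le> f u v" "\<And>u v. v \<le> f u v"
  shows "table2 f T a b (lift2 f u v)"
proof (cases "u = 0 \<or> v = 0")
  case True
  then show ?thesis using assms(1,2) unfolding table2_def by auto
next
  case False
  then obtain u' v' where "u = Suc u'" "v = Suc v'" by (metis not0_implies_Suc)
  with assms have "lift2 f u v = Suc (f u' v')" "T a (Suc u')" "T b (Suc v')" by auto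
  then show ?thesis
    unfolding table2_def by (intro disjI2 exI[of _ u'] conjI exI[of _ v']) (auto simp: less_Suc_eq_le assms(3,4))
qed

text \<open>The value \<open>0\<close> signals that \<open>c\<close> is not a code, or that there is a variable outside \<open>V\<close>.\<close>

function code_of_tm :: "nat \<Rightarrow> nat \<Rightarrow> nat \<Rightarrow> nat" where
  "code_of_tm c V k =
     (if pfst c = 0 then (if psnd c \<in> set_decode V then Suc (at_code 1 (psnd c) k k) else 0)
      else if pfst c = 1 then
        lift2 (plus_code k) (code_of_tm (left c) V (Suc k)) (code_of_tm (right c) V (Suc (Suc k)))
      else 0)"
  by auto
termination by (relation "Wellfounded.measure fst") (auto simp: psnd_less2)

declare code_of_tm.simps [simp del]

lemma code_of_tm_code:
  "code_of_tm (code_tm t) V k = (if vars_tm t \<subseteq> set_decode V then Suc (ccode (graph_tm t k)) else 0)"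
  by (induction t arbitrary: k) (simp_all add: code_of_tm.simps[of "pair x y" for x y] QEx_def code_defs)

text \<open>Numbers that are not codes are rejected. Together with \<open>code_of_tm_code\<close>
  this makes the translation itself the test for being a code.\<close>

lemma code_of_tm_nonzero: "code_of_tm c V k \<noteq> 0 \<Longrightarrow> \<exists>t. c = code_tm t"
proof (induction c V k rule: code_of_tm.induct)
  case (1 c V k)
  show ?case
  proof (cases "pfst c = 0")
    case True
    then have "c = code_tm (Var (psnd c))" by (metis code_tm.simps(1) pair_pfst_psnd)
    then show ?thesis by blast
  next
    case False
    with "1.prems" have "pfst c = 1" by (auto simp: code_of_tm.simps[of c] split: if_splits)
    moreover from this "1.prems" have "code_of_tm (left c) V (Suc k) \<noteq> 0" "code_of_tm (right c) V (Suc (Suc k)) \<noteq> 0"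
      by (auto simp: code_of_tm.simps[of c])
    ultimately obtain s t where "pfst c = 1" "left c = code_tm s" "right c = code_tm t"
      using "1.IH" False by blast
    then have "c = code_tm (Plus s t)" by (metis code_tm.simps(2) pair_pfst_psnd)
    then show ?thesis by blast
  qed
qed

lemma computable_code_of_tm': "computable (\<lambda>z. code_of_tm (pfst z) (left z) (right z))"
proof (rule computable_by_tables[where \<mu> = pfst])
  let ?F = "\<lambda>z. code_of_tm (pfst z) (left z) (right z)"
  define a where "a x = pair (left (pfst x)) (pair (left x) (Suc (right x)))" for x
  define b where "b x = pair (right (pfst x)) (pair (left x) (Suc (Suc (right x))))" for x
  define J where "J T x y \<longleftrightarrow>
     (if pfst (pfst x) = 0 then y = (if psnd (pfst x) \<in> set_decode (left x) then Suc (at_code 1 (psnd (pfst x)) (right x) (right x)) else 0)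
      else if pfst (pfst x) = 1 then table2 (plus_code (right x)) T (a x) (b x) y
      else y = 0)" for T and x y :: nat
  show "decid (\<lambda>z. J (\<lambda>x y. pair x y \<in> set_decode (pfst z)) (left z) (right z))"
    unfolding J_def table2_def a_def b_def code_defs by (intro comput)
  have F: "?F x = lift2 (plus_code (right x)) (?F (a x)) (?F (b x))" if "pfst (pfst x) = 1" for x
    using that by (simp add: code_of_tm.simps[of "pfst x"] a_def b_def)
  have less: "pfst (a x) < pfst x" "pfst (b x) < pfst x" if "pfst (pfst x) = 1" for x
    using that psnd_less2[of "pfst x"] by (simp_all add: a_def b_def)
  show "y = ?F x" if T: "\<And>x' y'. T x' y' \<Longrightarrow> pfst x' < pfst x \<Longrightarrow> y' = ?F x'" and J: "J T x y" for T x y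
  proof (cases "pfst (pfst x) = 1")
    case True
    then have "table2 (plus_code (right x)) T (a x) (b x) y" using J by (simp add: J_def)
    then show ?thesis unfolding F[OF True] using T[OF _ less(1)[OF True]] T[OF _ less(2)[OF True]] by (rule table2_sound)
  qed (use J in \<open>auto simp: J_def code_of_tm.simps[of "pfst x"]\<close>)
  show "\<exists>X. finite X \<and> (\<forall>x'\<in>X. pfst x' < pfst x) \<and> (\<forall>T. (\<forall>x'\<in>X. T x' (?F x')) \<longrightarrow> J T x (?F x))" for x
  proof (cases "pfst (pfst x) = 1")
    case True
    have "J T x (?F x)" if "\<forall>x'\<in>{a x, b x}. T x' (?F x')" for T
    proof -
      have "table2 (plus_code (right x)) T (a x) (b x) (?F x)"
        unfolding F[OF True] using that by (intro table2_complete) (auto simp: le_codes)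
      then show ?thesis using True by (simp add: J_def)
    qed
    then show ?thesis using less[OF True] by (intro exI[of _ "{a x, b x}"]) blast
  qed (auto simp: J_def code_of_tm.simps[of "pfst x"] intro!: exI[of _ "{}"])
qed

lemmas computable_code_of_tm [comput] = computable_comp3[where F = code_of_tm, OF computable_code_of_tm']

definition ins :: "nat \<Rightarrow> nat \<Rightarrow> nat" where
  "ins n V = set_encode {p. p < Suc (V + n) \<and> (p = n \<or> p \<in> set_decode V)}"

lemma set_decode_ins [simp]: "set_decode (ins n V) = insert n (set_decode V)"
  unfolding ins_def by (subst set_encode_inverse) (auto dest: set_decode_less)

lemma computable_ins [comput]:
  assumes "computable f" "computable g" shows "computable (\<lambda>z. ins (f z) (g z))"
  unfolding ins_def
  by (rule computable_set_encode) (intro comput computable_comp[OF assms(1)] computable_comp[OF assms(2)] assms)+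

definition code_of_atom :: "nat \<Rightarrow> nat \<Rightarrow> nat \<Rightarrow> nat" where
  "code_of_atom c V k =
     (if pfst c = 0 then
        lift2 (\<lambda>u v. qex_code k (conj_code u v)) (code_of_tm (left c) V k) (code_of_tm (right c) V k)
      else if pfst c = 1 then
        lift2 (\<lambda>u v. qex_code k (qex_code (Suc k) (conj_code u (conj_code v (at_code 2 k (Suc k) (Suc k))))))
          (code_of_tm (left c) V k) (code_of_tm (right c) V (Suc k))
      else if pfst c = 2 then
        lift1 (\<lambda>u. qex_code k (conj_code u (at_code 3 k k k))) (code_of_tm (psnd c) V k)
      else if pfst c = 3 then
        lift1 (\<lambda>u. qex_code k (conj_code u (at_code 4 k k k))) (code_of_tm (psnd c) V k)
      else 0)"

text \<open>Translation, test for codes and test for free variables in one pass. A quantifier adds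
  its variable to \<open>V\<close>; started with \<open>V = 0\<close>, the empty set, only sentences
  succeed.\<close>

function code_of_fm :: "nat \<Rightarrow> nat \<Rightarrow> nat \<Rightarrow> nat" where
  "code_of_fm c V k =
     (if pfst c = 4 then lift1 (pair 1) (code_of_fm (psnd c) V k)
      else if pfst c = 5 then lift2 conj_code (code_of_fm (left c) V k) (code_of_fm (right c) V k)
      else if pfst c = 6 then lift1 (qex_code (left c)) (code_of_fm (right c) (ins (left c) V) k)
      else code_of_atom c V k)"
  by auto
termination by (relation "Wellfounded.measure fst") (auto simp: psnd_less psnd_less2)

declare code_of_fm.simps [simp del]

lemma code_of_fm_code:
  "code_of_fm (code_fm \<phi>) V k = (if free_vars \<phi> \<subseteq> set_decode V then Suc (ccode (translate \<phi> k)) else 0)"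
proof (induction \<phi> arbitrary: V)
  case (Exists n \<phi>)
  have "free_vars \<phi> - {n} \<subseteq> set_decode V \<longleftrightarrow> free_vars \<phi> \<subseteq> insert n (set_decode V)" by auto
  with Exists show ?case
    by (simp add: code_of_fm.simps[of "pair x y" for x y] QEx_def code_defs)
qed (simp_all add: code_of_fm.simps[of "pair x y" for x y] code_of_atom_def code_of_tm_code QEx_def code_defs)

lemma code_of_atom_nonzero: "code_of_atom c V k \<noteq> 0 \<Longrightarrow> \<exists>\<phi>. c = code_fm \<phi>"
proof -
  assume nz: "code_of_atom c V k \<noteq> 0"
  then consider (bin) "pfst c = 0 \<or> pfst c = 1" | (un) "pfst c = 2 \<or> pfst c = 3"
    unfolding code_of_atom_def by presburger
  then show ?thesis
  proof cases
    case bin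
    with nz obtain k' where "code_of_tm (left c) V k \<noteq> 0" "code_of_tm (right c) V k' \<noteq> 0"
      unfolding code_of_atom_def by auto
    then obtain s t where "left c = code_tm s" "right c = code_tm t" using code_of_tm_nonzero by metis
    with bin have "c = code_fm (Equal s t) \<or> c = code_fm (Less s t)"
      by (metis code_fm.simps(1,2) pair_pfst_psnd)
    then show ?thesis by blast
  next
    case un
    with nz have "code_of_tm (psnd c) V k \<noteq> 0"
      unfolding code_of_atom_def by auto
    then obtain t where "psnd c = code_tm t" using code_of_tm_nonzero by metis
    with un have "c = code_fm (PredP t) \<or> c = code_fm (PredQ t)"
      by (metis code_fm.simps(3,4) pair_pfst_psnd)
    then show ?thesis by blast
  qed
qed

lemma code_of_fm_nonzero: "code_of_fm c V k \<noteq> 0 \<Longrightarrow> \<exists>\<phi>. c = code_fm \<phi>"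
proof (induction c V k rule: code_of_fm.induct)
  case (1 c V k)
  consider "pfst c = 4" | "pfst c = 5" | "pfst c = 6" | "pfst c \<notin> {4, 5, 6}" by blast
  then show ?case
  proof cases
    case c: 1
    with "1.prems" have "code_of_fm (psnd c) V k \<noteq> 0" by (auto simp: code_of_fm.simps[of c])
    then obtain \<phi> where "psnd c = code_fm \<phi>" using "1.IH" c by blast
    with c have "c = code_fm (Neg \<phi>)" by (metis code_fm.simps(5) pair_pfst_psnd)
    then show ?thesis by blast
  next
    case c: 2
    with "1.prems" have "code_of_fm (left c) V k \<noteq> 0" "code_of_fm (right c) V k \<noteq> 0" "pfst c \<noteq> 4"
      by (auto simp: code_of_fm.simps[of c])
    then obtain \<phi> \<psi> where "left c = code_fm \<phi>" "right c = code_fm \<psi>" using "1.IH" c by blast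
    with c have "c = code_fm (Conj \<phi> \<psi>)" by (metis code_fm.simps(6) pair_pfst_psnd)
    then show ?thesis by blast
  next
    case c: 3
    with "1.prems" have "code_of_fm (right c) (ins (left c) V) k \<noteq> 0" "pfst c \<noteq> 4" "pfst c \<noteq> 5"
      by (auto simp: code_of_fm.simps[of c])
    then obtain \<phi> where "right c = code_fm \<phi>" using "1.IH" c by blast
    with c have "c = code_fm (Exists (left c) \<phi>)" by (metis code_fm.simps(7) pair_pfst_psnd)
    then show ?thesis by blast
  next
    case 4
    with "1.prems" show ?thesis using code_of_atom_nonzero by (simp add: code_of_fm.simps[of c])
  qed
qed

lemma computable_code_of_atom [comput]:
  assumes "computable f" "computable g" "computable h" shows "computable (\<lambda>z. code_of_atom (f z) (g z) (h z))"
  unfolding code_of_atom_def lift2_def code_defs using assms by (intro comput)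

lemma computable_code_of_fm': "computable (\<lambda>z. code_of_fm (pfst z) (left z) (right z))"
proof (rule computable_by_tables[where \<mu> = pfst])
  let ?F = "\<lambda>z. code_of_fm (pfst z) (left z) (right z)"
  define a where "a x = pair (psnd (pfst x)) (psnd x)" for x
  define b where "b x = pair (left (pfst x)) (psnd x)" for x
  define c where "c x = pair (right (pfst x)) (psnd x)" for x
  define d where "d x = pair (right (pfst x)) (pair (ins (left (pfst x)) (left x)) (right x))" for x
  define J where "J T x y \<longleftrightarrow>
     (if pfst (pfst x) = 4 then table2 (\<lambda>_. pair 1) T (a x) (a x) y
      else if pfst (pfst x) = 5 then table2 conj_code T (b x) (c x) y
      else if pfst (pfst x) = 6 then table2 (\<lambda>_. qex_code (left (pfst x))) T (d x) (d x) y
      else y = code_of_atom (pfst x) (left x) (right x))" for T and x y :: nat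
  show "decid (\<lambda>z. J (\<lambda>x y. pair x y \<in> set_decode (pfst z)) (left z) (right z))"
    unfolding J_def table2_def a_def b_def c_def d_def code_defs by (intro comput)
  have F: "?F x = (if pfst (pfst x) = 4 then lift1 (pair 1) (?F (a x))
      else if pfst (pfst x) = 5 then lift2 conj_code (?F (b x)) (?F (c x))
      else if pfst (pfst x) = 6 then lift1 (qex_code (left (pfst x))) (?F (d x))
      else code_of_atom (pfst x) (left x) (right x))" for x
    by (simp add: code_of_fm.simps[of "pfst x"] a_def b_def c_def d_def)
  have less: "pfst (a x) < pfst x" "pfst (b x) < pfst x" "pfst (c x) < pfst x" "pfst (d x) < pfst x"
    if "pfst (pfst x) \<in> {4, 5, 6}" for x
    using that psnd_less2[of "pfst x"] psnd_less[of "pfst x"] by (auto simp: a_def b_def c_def d_def)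
  show "y = ?F x" if T: "\<And>x' y'. T x' y' \<Longrightarrow> pfst x' < pfst x \<Longrightarrow> y' = ?F x'" and J: "J T x y" for T x y
  proof (cases "pfst (pfst x) \<in> {4, 5, 6}")
    case True
    have T': "y' = ?F (a x)" if "T (a x) y'" for y' using T[OF that less(1)[OF True]] .
    have T2: "y' = ?F (b x)" if "T (b x) y'" for y' using T[OF that less(2)[OF True]] .
    have T3: "y' = ?F (c x)" if "T (c x) y'" for y' using T[OF that less(3)[OF True]] .
    have T4: "y' = ?F (d x)" if "T (d x) y'" for y' using T[OF that less(4)[OF True]] .
    show ?thesis
      using J True unfolding J_def F[of x]
      by (auto dest: table2_sound[OF _ T' T'] table2_sound[OF _ T2 T3] table2_sound[OF _ T4 T4])
  next
    case False then show ?thesis using J unfolding J_def F[of x] by auto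
  qed
  show "\<exists>X. finite X \<and> (\<forall>x'\<in>X. pfst x' < pfst x) \<and> (\<forall>T. (\<forall>x'\<in>X. T x' (?F x')) \<longrightarrow> J T x (?F x))" for x
  proof (cases "pfst (pfst x) \<in> {4, 5, 6}")
    case True
    have "J T x (?F x)" if "\<forall>x'\<in>{a x, b x, c x, d x}. T x' (?F x')" for T
    proof -
      have T: "T (a x) (?F (a x))" "T (b x) (?F (b x))" "T (c x) (?F (c x))" "T (d x) (?F (d x))"
        using that by blast+
      \<comment> \<open>\<open>table2_complete\<close> does not apply, because
        \<open>\<lambda>_. f\<close> need not dominate its first argument. Here the two arguments
        coincide.\<close>
      have *: "u \<noteq> 0 \<Longrightarrow> table2 (\<lambda>_. f) T e e (lift1 f u)" if "T e u" "\<And>u. u \<le> f u" for e u f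
        using that by (cases u) (auto simp: table2_def less_Suc_eq_le)
      have **: "table2 (\<lambda>_. f) T e e (lift1 f u)" if "T e u" "\<And>u. u \<le> f u" for e u f
        using *[OF that] that(1) by (cases "u = 0") (auto simp: table2_def)
      show ?thesis
        using True **[OF T(1), of "pair 1"] **[OF T(4), of "qex_code (left (pfst x))"]
          table2_complete[where T = T and a = "b x" and b = "c x" and f = conj_code, OF T(2,3)]
        unfolding J_def F[of x] by (auto simp: le_codes le_prod_encode_2)
    qed
    then show ?thesis using less[OF True] by (intro exI[of _ "{a x, b x, c x, d x}"]) blast
  next
    case False
    then show ?thesis unfolding J_def F[of x] by (intro exI[of _ "{}"]) auto
  qed
qed

lemmas computable_code_of_fm [comput] = computable_comp3[where F = code_of_fm, OF computable_code_of_fm']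

section \<open>Structures presented by words\<close>

abbreviation (input) word :: "nat \<Rightarrow> (nat \<Rightarrow> nat) \<Rightarrow> bool" where
  "word b x \<equiv> range x \<subseteq> {..<b}"

text \<open>\<open>val\<close> need not be injective, and equality is itself a base relation. The
  relations have to be right on valid words only, which is why \<open>QEx\<close> relativises
  quantifiers by relation 5.\<close>

locale relations =
  fixes b :: nat and rel :: "nat \<Rightarrow> (nat \<Rightarrow> nat \<times> nat \<times> nat) \<Rightarrow> bool"
    and M :: "'a struct" and val :: "(nat \<Rightarrow> nat) \<Rightarrow> 'a" and valid :: "(nat \<Rightarrow> nat) \<Rightarrow> bool"
  assumes val_surj: "\<exists>x. word b x \<and> valid x \<and> val x = a"
    and rel_valid: "word b x \<Longrightarrow> rel 5 (\<lambda>p. (x p, x p, x p)) \<longleftrightarrow> valid x"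
    and rel_plus: "word b x \<Longrightarrow> word b y \<Longrightarrow> word b z \<Longrightarrow> valid x \<Longrightarrow> valid y \<Longrightarrow> valid z \<Longrightarrow>
      rel 0 (\<lambda>p. (x p, y p, z p)) \<longleftrightarrow> plus_of M (val x) (val y) = val z"
    and rel_eq: "word b x \<Longrightarrow> word b y \<Longrightarrow> valid x \<Longrightarrow> valid y \<Longrightarrow>
      rel 1 (\<lambda>p. (x p, y p, y p)) \<longleftrightarrow> val x = val y"
    and rel_lt: "word b x \<Longrightarrow> word b y \<Longrightarrow> valid x \<Longrightarrow> valid y \<Longrightarrow>
      rel 2 (\<lambda>p. (x p, y p, y p)) \<longleftrightarrow> lt_of M (val x) (val y)"
    and rel_P: "word b x \<Longrightarrow> valid x \<Longrightarrow> rel 3 (\<lambda>p. (x p, x p, x p)) \<longleftrightarrow> val x \<in> P_of M"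
    and rel_Q: "word b x \<Longrightarrow> valid x \<Longrightarrow> rel 4 (\<lambda>p. (x p, x p, x p)) \<longleftrightarrow> val x \<in> Q_of M"

locale presentation = atoms b aty amul aacc rel + relations b rel M val valid
  for b aty amul aacc rel and M :: "'a struct" and val valid
begin

definition track :: "(nat \<Rightarrow> nat \<Rightarrow> nat) \<Rightarrow> nat \<Rightarrow> nat \<Rightarrow> nat" where
  "track w n = (\<lambda>p. w p n)"

definition set_track :: "(nat \<Rightarrow> nat \<Rightarrow> nat) \<Rightarrow> nat \<Rightarrow> (nat \<Rightarrow> nat) \<Rightarrow> nat \<Rightarrow> nat \<Rightarrow> nat" where
  "set_track w n x = (\<lambda>p. (w p)(n := x p))"

definition over :: "(nat \<Rightarrow> nat \<Rightarrow> nat) \<Rightarrow> bool" where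
  "over w \<longleftrightarrow> (\<forall>p n. w p n < b)"

lemma track_set_track [simp]: "track (set_track w n x) m = (if m = n then x else track w m)"
  by (auto simp: track_def set_track_def)

lemma over_set_track [simp]: "over w \<Longrightarrow> word b x \<Longrightarrow> over (set_track w n x)"
  by (auto simp: over_def set_track_def image_subset_iff)

lemma over_track [simp]: "over w \<Longrightarrow> range (track w n) \<subseteq> {..<b}"
  by (auto simp: over_def track_def)

lemma csat_At: "csat (CAt r i j k) w \<longleftrightarrow> rel r (\<lambda>p. (track w i p, track w j p, track w k p))"
  by (simp add: track_def)

lemma csat_QEx:
  "csat (QEx n \<phi>) w \<longleftrightarrow> (\<exists>x. word b x \<and> valid x \<and> csat \<phi> (set_track w n x))"
proof -
  have "csat (QEx n \<phi>) w \<longleftrightarrow> (\<exists>x. word b x \<and> csat (CConj (CAt 5 n n n) \<phi>) (set_track w n x))"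
  proof
    assume "csat (QEx n \<phi>) w"
    then obtain v where v: "\<And>p. v p \<in> (\<lambda>d. (w p)(n := d)) ` {..<b}" "csat (CConj (CAt 5 n n n) \<phi>) v"
      unfolding QEx_def csat.simps(4) by blast
    have eq: "v p = (w p)(n := v p n)" and "v p n < b" for p using v(1)[of p] by auto
    then have "range (\<lambda>p. v p n) \<subseteq> {..<b}" by auto
    moreover have "v = set_track w n (\<lambda>p. v p n)"
      unfolding set_track_def by (rule ext) (rule eq)
    ultimately show "\<exists>x. word b x \<and> csat (CConj (CAt 5 n n n) \<phi>) (set_track w n x)" using v(2) by metis
  next
    assume "\<exists>x. word b x \<and> csat (CConj (CAt 5 n n n) \<phi>) (set_track w n x)"
    then obtain x where x: "word b x" "csat (CConj (CAt 5 n n n) \<phi>) (set_track w n x)" by blast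
    have "\<forall>p. set_track w n x p \<in> (\<lambda>d. (w p)(n := d)) ` {..<b}"
      using x(1) unfolding set_track_def by blast
    then show "csat (QEx n \<phi>) w" unfolding QEx_def csat.simps(4) using x(2) by blast
  qed
  also have "\<dots> \<longleftrightarrow> (\<exists>x. word b x \<and> valid x \<and> csat \<phi> (set_track w n x))"
  proof -
    have "csat (CAt 5 n n n) (set_track w n x) \<longleftrightarrow> valid x" if "word b x" for x
      using rel_valid[OF that] by (simp add: set_track_def)
    then show ?thesis unfolding csat.simps(3) by blast
  qed
  finally show ?thesis .
qed

lemma graph_tm_correct:
  assumes "over w" "\<And>v. v \<in> vars_tm t \<Longrightarrow> v < k \<and> valid (track w v) \<and> val (track w v) = e v" "valid (track w k)"
  shows "csat (graph_tm t k) w \<longleftrightarrow> val (track w k) = eval_tm M e t"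
  using assms
proof (induction t arbitrary: w k)
  case (Var n)
  then show ?case unfolding graph_tm.simps csat_At by (subst rel_eq) auto
next
  case (Plus s t)
  have ne: "v < k" "v \<noteq> k" "v \<noteq> Suc k" "v \<noteq> Suc (Suc k)" "valid (track w v)" "val (track w v) = e v"
    if "v \<in> vars_tm s \<or> v \<in> vars_tm t" for v
    using Plus.prems(2)[of v] that by auto
  have s: "csat (graph_tm s (Suc k)) (set_track w (Suc k) x) \<longleftrightarrow> val x = eval_tm M e s"
    if "word b x" "valid x" for x
    using that Plus.prems(1,3) by (subst Plus.IH(1)) (auto simp: less_Suc_eq ne)
  have t: "csat (graph_tm t (Suc (Suc k))) (set_track (set_track w (Suc k) x) (Suc (Suc k)) y) \<longleftrightarrow> val y = eval_tm M e t"
    if "word b x" "word b y" "valid y" for x y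
    using that Plus.prems(1,3) by (subst Plus.IH(2)) (auto simp: less_Suc_eq ne)
  have r: "csat (CAt 0 (Suc k) (Suc (Suc k)) k) (set_track (set_track w (Suc k) x) (Suc (Suc k)) y)
      \<longleftrightarrow> plus_of M (val x) (val y) = val (track w k)"
    if "word b x" "valid x" "word b y" "valid y" for x y
    using that Plus.prems unfolding csat_At by (subst rel_plus[symmetric]) simp_all
  have "csat (graph_tm (Plus s t) k) w \<longleftrightarrow> (\<exists>x. word b x \<and> valid x \<and> val x = eval_tm M e s \<and>
     (\<exists>y. word b y \<and> valid y \<and> val y = eval_tm M e t \<and> plus_of M (val x) (val y) = val (track w k)))"
    unfolding graph_tm.simps csat_QEx csat.simps(3) using s t r by (simp cong: conj_cong)
  also have "\<dots> \<longleftrightarrow> val (track w k) = eval_tm M e (Plus s t)"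
  proof -
    \<comment> \<open>Every element has a valid word, so words for the values of the subterms
      exist.\<close>
    obtain x where "word b x" "valid x" "val x = eval_tm M e s" using val_surj by blast
    moreover obtain y where "word b y" "valid y" "val y = eval_tm M e t" using val_surj by blast
    ultimately show ?thesis
      by (intro iffI) (auto, intro exI[of _ x] conjI exI[of _ y], simp_all)
  qed
  finally show ?case .
qed

text \<open>This makes \<open>Suc x\<close> a fresh variable for the formula with code
  \<open>x\<close>.\<close>

lemma var_le_code: "v \<in> vars_tm t \<Longrightarrow> v \<le> code_tm t"
proof (induction t)
  case (Var n) then show ?case by (simp add: le_prod_encode_2)
next
  case (Plus s t)
  have "code_tm s \<le> code_tm (Plus s t)" "code_tm t \<le> code_tm (Plus s t)"
    using le_prod_encode_1 le_prod_encode_2 le_trans unfolding code_tm.simps by metis+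
  then show ?case using Plus by fastforce
qed

lemma translate_correct:
  assumes "over w" "\<And>v. v \<in> free_vars \<phi> \<Longrightarrow> valid (track w v) \<and> val (track w v) = e v" "code_fm \<phi> < k"
  shows "csat (translate \<phi> k) w \<longleftrightarrow> sat M e \<phi>"
  using assms
proof (induction \<phi> arbitrary: w e)
  case (Equal s t)
  have "code_tm s < k" "code_tm t < k"
    using Equal(3) le_prod_encode_1 le_prod_encode_2 unfolding code_fm.simps by (meson le_less_trans)+
  then have v: "v < k" if "v \<in> vars_tm s \<union> vars_tm t" for v using var_le_code[of v] that by force
  have "csat (graph_tm u k) (set_track w k x) \<longleftrightarrow> val x = eval_tm M e u"
    if "word b x" "valid x" "u = s \<or> u = t" for x u
    using that v Equal.prems by (subst graph_tm_correct[where e = e]) auto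
  then show ?case
    unfolding translate.simps csat_QEx csat.simps(3) using val_surj[of "eval_tm M e s"] by (auto cong: conj_cong)
next
  case (Less s t)
  have "code_tm s < k" "code_tm t < k"
    using Less(3) le_prod_encode_1 le_prod_encode_2 unfolding code_fm.simps by (meson le_less_trans)+
  then have v: "v < k" if "v \<in> vars_tm s \<union> vars_tm t" for v using var_le_code[of v] that by force
  have 1: "csat (graph_tm s k) (set_track (set_track w k x) (Suc k) y) \<longleftrightarrow> val x = eval_tm M e s"
    if "word b x" "valid x" "word b y" "valid y" for x y
    using that v Less.prems by (subst graph_tm_correct[where e = e]) fastforce+
  have 2: "csat (graph_tm t (Suc k)) (set_track (set_track w k x) (Suc k) y) \<longleftrightarrow> val y = eval_tm M e t"
    if "word b x" "valid x" "word b y" "valid y" for x y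
    using that v Less.prems by (subst graph_tm_correct[where e = e]) fastforce+
  have 3: "csat (CAt 2 k (Suc k) (Suc k)) (set_track (set_track w k x) (Suc k) y) \<longleftrightarrow> lt_of M (val x) (val y)"
    if "word b x" "valid x" "word b y" "valid y" for x y
    using that unfolding csat_At by (subst rel_lt[symmetric]) simp_all
  show ?case
    unfolding translate.simps csat_QEx csat.simps(3) using 1 2 3 val_surj[of "eval_tm M e s"] val_surj[of "eval_tm M e t"]
    by (auto cong: conj_cong)
next
  case (PredP t)
  have "code_tm t < k" using PredP(3) le_prod_encode_2 unfolding code_fm.simps by (meson le_less_trans)
  then have v: "v < k" if "v \<in> vars_tm t" for v using var_le_code[of v] that by force
  have "csat (graph_tm t k) (set_track w k x) \<longleftrightarrow> val x = eval_tm M e t"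
    if "word b x" "valid x" for x
    using that v PredP.prems by (subst graph_tm_correct[where e = e]) auto
  moreover have "csat (CAt 3 k k k) (set_track w k x) \<longleftrightarrow> val x \<in> P_of M" if "word b x" "valid x" for x
    using that unfolding csat_At by (subst rel_P[symmetric]) simp_all
  ultimately show ?case
    unfolding translate.simps csat_QEx csat.simps(3) using val_surj[of "eval_tm M e t"] by (auto cong: conj_cong)
next
  case (PredQ t)
  have "code_tm t < k" using PredQ(3) le_prod_encode_2 unfolding code_fm.simps by (meson le_less_trans)
  then have v: "v < k" if "v \<in> vars_tm t" for v using var_le_code[of v] that by force
  have "csat (graph_tm t k) (set_track w k x) \<longleftrightarrow> val x = eval_tm M e t"
    if "word b x" "valid x" for x
    using that v PredQ.prems by (subst graph_tm_correct[where e = e]) auto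
  moreover have "csat (CAt 4 k k k) (set_track w k x) \<longleftrightarrow> val x \<in> Q_of M" if "word b x" "valid x" for x
    using that unfolding csat_At by (subst rel_Q[symmetric]) simp_all
  ultimately show ?case
    unfolding translate.simps csat_QEx csat.simps(3) using val_surj[of "eval_tm M e t"] by (auto cong: conj_cong)
next
  case (Neg \<phi>)
  have "code_fm \<phi> < k" using Neg.prems(3) le_prod_encode_2 unfolding code_fm.simps by (meson le_less_trans)
  with Neg show ?case by simp
next
  case (Conj \<phi> \<psi>)
  have "code_fm \<phi> < k" "code_fm \<psi> < k"
    using Conj.prems(3) le_prod_encode_1 le_prod_encode_2 unfolding code_fm.simps by (meson le_less_trans)+
  with Conj show ?case by simp
next
  case (Exists n \<phi>)
  have k: "code_fm \<phi> < k"
    using Exists.prems(3) le_prod_encode_1 le_prod_encode_2 unfolding code_fm.simps by (meson le_less_trans)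
  have "csat (translate \<phi> k) (set_track w n x) \<longleftrightarrow> sat M (e(n := val x)) \<phi>"
    if "word b x" "valid x" for x
    using that Exists.prems k by (intro Exists.IH) auto
  then have "csat (translate (Exists n \<phi>) k) w \<longleftrightarrow> (\<exists>x. word b x \<and> valid x \<and> sat M (e(n := val x)) \<phi>)"
    unfolding translate.simps csat_QEx by (simp cong: conj_cong)
  also have "\<dots> \<longleftrightarrow> sat M e (Exists n \<phi>)" using val_surj by (metis sat.simps(7))
  finally show ?case .
qed

lemma decidable_Th: "decidable (Th M)"
proof -
  let ?c = "\<lambda>x. code_of_fm x 0 (Suc x)"
  have "x \<in> code_fm ` Th M \<longleftrightarrow> ?c x \<noteq> 0 \<and> csat (cdec (?c x - 1)) (\<lambda>_ _. 0)" for x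
  proof (cases "\<exists>\<phi>. x = code_fm \<phi>")
    case True
    then obtain \<phi> where x: "x = code_fm \<phi>" by blast
    then have c: "?c x = (if sentence \<phi> then Suc (ccode (translate \<phi> (Suc x))) else 0)"
      by (simp add: code_of_fm_code sentence_def)
    \<comment> \<open>Without free variables any word will do; the constant \<open>0\<close> is over
      the alphabet because \<open>b > 0\<close>.\<close>
    have "csat (translate \<phi> (Suc x)) (\<lambda>_ _. 0) \<longleftrightarrow> sat M e \<phi>" if "sentence \<phi>" for e
      using that b_pos x by (intro translate_correct) (auto simp: over_def sentence_def)
    then show ?thesis unfolding c by (auto simp: x Th_def code_fm_inject)
  next
    case False
    then show ?thesis using code_of_fm_nonzero by blast
  qed
  moreover have "decid (\<lambda>x. ?c x \<noteq> 0 \<and> csat (cdec (?c x - 1)) (\<lambda>_ _. 0))"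
    by (intro comput decid_csat_zero)
  ultimately show ?thesis
    unfolding decidable_def by (intro recursive_set_if_computable) simp
qed

end

text \<open>The recognisers are only known to exist, so they are cut down to finite tables: types of
  nonempty words over the finite alphabet lie below some \<open>N\<close>, and outside this range
  everything is set to \<open>0\<close> or \<open>False\<close>. Finite support then gives
  computability.\<close>

theorem (in relations) decidable_if_recognisable:
  assumes b: "b > 0" and R: "\<And>r. r < 6 \<Longrightarrow> recognisable ({..<b} \<times> {..<b} \<times> {..<b}) (rel r)"
  shows "decidable (Th M)"
proof -
  define A where "A = {..<b} \<times> {..<b} \<times> {..<b}"
  have "\<forall>r. \<exists>ty mul acc. r < 6 \<longrightarrow> recognises A ty mul acc (rel r)"
    using R unfolding recognisable_def A_def by blast
  then obtain ty mul acc where rec: "\<And>r. r < 6 \<Longrightarrow> recognises A (ty r) (mul r) (acc r) (rel r)" by metis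
  have "finite (\<Union>r\<in>{..<6}. ty r ` {u. u \<noteq> [] \<and> set u \<subseteq> A})"
    using recognisesD(1)[OF rec] by auto
  then obtain N where N: "\<forall>x\<in>(\<Union>r\<in>{..<6}. ty r ` {u. u \<noteq> [] \<and> set u \<subseteq> A}). x < N"
    unfolding finite_nat_set_iff_bounded by blast
  define ty' where "ty' r u = (if r < 6 \<and> set u \<subseteq> A then ty r u else 0)" for r :: nat and u
  define mul' where "mul' r s t = (if r < 6 \<and> s < N \<and> t < N then mul r s t else 0)" for r s t :: nat
  define acc' where "acc' r s t \<longleftrightarrow> r < 6 \<and> s < N \<and> t < N \<and> acc r s t" for r s t :: nat
  \<comment> \<open>The locale \<open>atoms\<close> speaks of all numbers \<open>r\<close>; from 6
    on the relation is made empty.\<close>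
  define rel' where "rel' r w \<longleftrightarrow> r < 6 \<and> rel r w" for r :: nat and w
  have bd: "ty r u < N" if "r < 6" "u \<noteq> []" "set u \<subseteq> A" for r u using N that by blast
  have "recognises A (ty' r) (mul' r) (acc' r) (rel' r)" for r
  proof (cases "r < 6")
    case False
    then show ?thesis
      by (auto simp: recognises_def ty'_def mul'_def acc'_def rel'_def intro: finite_subset[of _ "{0}"])
  next
    case True
    have seg: "seg w i j \<noteq> []" "set (seg w i j) \<subseteq> A" if "range w \<subseteq> A" "i < j" for w i j
      using that by (auto simp: set_seg)
    show ?thesis
      unfolding recognises_def
    proof (intro conjI allI impI)
      show "finite (ty' r ` {u. u \<noteq> [] \<and> set u \<subseteq> A})"
      proof -
        have "ty' r ` {u. u \<noteq> [] \<and> set u \<subseteq> A} = ty r ` {u. u \<noteq> [] \<and> set u \<subseteq> A}"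
          by (rule image_cong) (auto simp: ty'_def True)
        then show ?thesis using recognisesD(1)[OF rec[OF True]] by simp
      qed
      fix w h e assume w: "range w \<subseteq> A" and h: "cuts h" and e: "\<forall>i>0. ty' r (seg w (h i) (h (Suc i))) = e"
      have h0: "h 0 = 0" using h by (simp add: cuts_def)
      have e': "ty r (seg w (h i) (h (Suc i))) = e" if "i > 0" for i
        using e[rule_format, OF that] seg[OF w cuts_less[OF h, of i "Suc i"]] True by (simp add: ty'_def)
      have "e < N" using e'[of 1] bd[OF True seg[OF w cuts_less[OF h, of 1 2]]] by (simp add: numeral_2_eq_2)
      moreover have "set (seg w 0 (h 1)) \<subseteq> A" "ty r (seg w 0 (h 1)) < N"
        using bd[OF True seg[OF w cuts_less[OF h, of 0 1]]] seg[OF w cuts_less[OF h, of 0 1]] h0 by auto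
      ultimately show "rel' r w = acc' r (ty' r (seg w 0 (h 1))) e"
        using recognisesD(3)[OF rec[OF True] w h e'] True by (simp add: rel'_def acc'_def ty'_def)
    qed (use True bd recognisesD(2)[OF rec[OF True]] in \<open>auto simp: ty'_def mul'_def\<close>)
  qed
  moreover have "computable (\<lambda>z. ty' (pfst z) [(left z, pfst (right z), right (psnd z))])"
  proof (rule computable_finite_support)
    have "z \<in> (\<lambda>(r, x, y, w). pair r (pair x (pair y w))) ` ({..<6} \<times> A)"
      if "ty' (pfst z) [(left z, pfst (right z), right (psnd z))] \<noteq> 0" for z
      using that by (intro rev_image_eqI[of "(pfst z, left z, pfst (right z), right (psnd z))"])
        (auto simp: ty'_def split: if_splits)
    then have "{z. ty' (pfst z) [(left z, pfst (right z), right (psnd z))] \<noteq> 0} \<subseteq>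
        (\<lambda>(r, x, y, w). pair r (pair x (pair y w))) ` ({..<6} \<times> A)" by blast
    then show "finite {z. ty' (pfst z) [(left z, pfst (right z), right (psnd z))] \<noteq> 0}"
      by (rule finite_subset) (simp add: A_def)
  qed
  moreover have fin: "finite {z. pfst z < 6 \<and> left z < N \<and> right z < N}"
  proof (rule finite_subset)
    show "{z. pfst z < 6 \<and> left z < N \<and> right z < N} \<subseteq> (\<lambda>(r, s, t). pair r (pair s t)) ` ({..<6} \<times> {..<N} \<times> {..<N})"
    proof
      fix z assume "z \<in> {z. pfst z < 6 \<and> left z < N \<and> right z < N}"
      then show "z \<in> (\<lambda>(r, s, t). pair r (pair s t)) ` ({..<6} \<times> {..<N} \<times> {..<N})"
        by (intro rev_image_eqI[of "(pfst z, left z, right z)"]) auto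
    qed
  qed simp
  moreover have "computable (\<lambda>z. mul' (pfst z) (left z) (right z))"
    by (rule computable_finite_support, rule finite_subset[OF _ fin]) (auto simp: mul'_def split: if_splits)
  moreover have "decid (\<lambda>z. acc' (pfst z) (left z) (right z))"
    unfolding decid_def
    by (rule computable_finite_support, rule finite_subset[OF _ fin]) (auto simp: acc'_def split: if_splits)
  moreover have "\<exists>K. \<forall>r s t. mul' r s t < K"
  proof -
    have "finite (insert 0 ((\<lambda>(r, s, t). mul r s t) ` ({..<6} \<times> {..<N} \<times> {..<N})))" by simp
    then obtain K where "\<forall>x\<in>insert 0 ((\<lambda>(r, s, t). mul r s t) ` ({..<6} \<times> {..<N} \<times> {..<N})). x < K"
      unfolding finite_nat_set_iff_bounded by blast
    then show ?thesis by (intro exI[of _ K]) (auto simp: mul'_def)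
  qed
  ultimately interpret atoms b ty' mul' acc' rel'
    using b unfolding A_def by unfold_locales
  interpret presentation b ty' mul' acc' rel' M val valid
    by unfold_locales (simp_all add: rel'_def val_surj rel_valid rel_plus rel_eq[unfolded One_nat_def] rel_lt rel_P rel_Q)
  show ?thesis by (rule decidable_Th)
qed

section \<open>Expansions in a quadratic unit\<close>

text \<open>A pair \<open>(u, v)\<close> stands for \<open>u + v \<beta>\<close>. The conjugate of \<open>\<beta>\<close> is \<open>1 / \<beta>\<close>.\<close>

locale quadratic_unit =
  fixes t :: int and \<beta> :: real
  assumes t: "t \<ge> 3" and \<beta>1: "\<beta> > 1" and \<beta>: "\<beta>\<^sup>2 = t * \<beta> - 1"
begin

lemma \<beta>_inverse: "1 / \<beta> = t - \<beta>"
  using \<beta> \<beta>1 by (simp add: field_simps power2_eq_square)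

lemma \<beta>_gt_2: "\<beta> > 2"
proof -
  have "1 / \<beta> < 1" using \<beta>1 by simp
  then show ?thesis using \<beta>_inverse t by linarith
qed

lemma \<beta>_less: "\<beta> < t"
  using \<beta>_inverse \<beta>1 by (metis diff_gt_0_iff_gt divide_pos_pos less_trans zero_less_one)

text \<open>\<open>ev\<close> and \<open>cj\<close> are the two real embeddings of \<int>[\<beta>],
  and \<open>shift\<close> is multiplication by \<open>\<beta>\<close> in coordinates. It expands
  \<open>ev\<close> and contracts \<open>cj\<close> by the factor \<open>\<beta>\<close>; every
  bound on carries rests on this contrast.\<close>

definition ev :: "int \<times> int \<Rightarrow> real" where "ev z = real_of_int (fst z) + real_of_int (snd z) * \<beta>"
definition cj :: "int \<times> int \<Rightarrow> real" where "cj z = real_of_int (fst z) + real_of_int (snd z) / \<beta>"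
definition shift :: "int \<times> int \<Rightarrow> int \<times> int" where "shift z = (- snd z, fst z + t * snd z)"

lemma ev_add [simp]: "ev (x + y) = ev x + ev y" and cj_add [simp]: "cj (x + y) = cj x + cj y"
  by (simp_all add: ev_def cj_def algebra_simps add_divide_distrib)

lemma ev_0 [simp]: "ev 0 = 0" and cj_0 [simp]: "cj 0 = 0" and shift_0 [simp]: "shift 0 = 0"
  by (simp_all add: ev_def cj_def shift_def zero_prod_def)

lemma ev_shift [simp]: "ev (shift z) = \<beta> * ev z"
  using arg_cong[OF \<beta>, of "(*) (real_of_int (snd z))"]
  by (simp add: ev_def shift_def algebra_simps power2_eq_square)

lemma cj_shift [simp]: "cj (shift z) = cj z / \<beta>"
proof -
  have "t / \<beta> - 1 / \<beta>\<^sup>2 = (1 / \<beta>) * (t - 1 / \<beta>)"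
    by (simp add: algebra_simps power2_eq_square)
  also have "t - 1 / \<beta> = \<beta>" using \<beta>_inverse by simp
  also have "(1 / \<beta>) * \<beta> = 1" using \<beta>1 by simp
  finally have "t / \<beta> - 1 / \<beta>\<^sup>2 = 1" .
  then have "real_of_int (snd z) * (t / \<beta> - 1 / \<beta>\<^sup>2) = real_of_int (snd z)" by simp
  then show ?thesis
    by (simp add: cj_def shift_def add_divide_distrib power2_eq_square algebra_simps)
qed

section \<open>Carries\<close>

definition bounded_pairs :: "real \<Rightarrow> (int \<times> int) set" where
  "bounded_pairs B = {z. \<bar>ev z\<bar> \<le> B \<and> \<bar>cj z\<bar> \<le> B}"

text \<open>\<open>ev z - cj z\<close> is the second coordinate times
  \<open>\<beta> - 1 / \<beta>\<close>, so bounds on both embeddings bound both coordinates. A bound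
  on \<open>ev\<close> alone would not suffice.\<close>

lemma finite_bounded_pairs: "finite (bounded_pairs B)"
proof -
  have d: "\<beta> - 1 / \<beta> > 1" using \<beta>_gt_2 \<beta>_inverse by (smt (verit) divide_less_eq_1_pos)
  \<comment> \<open>\<open>N\<close> dominates both \<open>2 * B\<close>, the bound for the second
    coordinate, and \<open>B + 2 * B * \<beta>\<close>, the bound for the first.\<close>
  obtain N :: nat where N: "2 * \<bar>B\<bar> * (1 + \<beta>) \<le> N" using real_arch_simple by blast
  have "\<bar>fst z\<bar> \<le> int N \<and> \<bar>snd z\<bar> \<le> int N" if "z \<in> bounded_pairs B" for z
  proof -
    have z: "\<bar>ev z\<bar> \<le> B" "\<bar>cj z\<bar> \<le> B" using that by (auto simp: bounded_pairs_def)
    have "real_of_int (snd z) * (\<beta> - 1 / \<beta>) = ev z - cj z" by (simp add: ev_def cj_def algebra_simps)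
    then have "\<bar>real_of_int (snd z)\<bar> * (\<beta> - 1 / \<beta>) = \<bar>ev z - cj z\<bar>"
      using d by (simp add: abs_mult flip: \<open>real_of_int (snd z) * (\<beta> - 1 / \<beta>) = ev z - cj z\<close>)
    moreover have "\<bar>real_of_int (snd z)\<bar> * 1 \<le> \<bar>real_of_int (snd z)\<bar> * (\<beta> - 1 / \<beta>)"
      using d by (intro mult_left_mono) auto
    ultimately have s: "\<bar>real_of_int (snd z)\<bar> \<le> 2 * B" using z by linarith
    have "real_of_int (fst z) = ev z - real_of_int (snd z) * \<beta>" by (simp add: ev_def)
    then have "\<bar>real_of_int (fst z)\<bar> \<le> \<bar>ev z\<bar> + \<bar>real_of_int (snd z) * \<beta>\<bar>" by linarith
    moreover have "\<bar>real_of_int (snd z) * \<beta>\<bar> \<le> 2 * B * \<beta>"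
      using s \<beta>1 by (simp add: abs_mult mult_right_mono)
    ultimately have f: "\<bar>real_of_int (fst z)\<bar> \<le> B + 2 * B * \<beta>" using z by linarith
    have B: "B \<ge> 0" using z by linarith
    then have "B * \<beta> \<ge> 0" using \<beta>1 by simp
    then have "B + 2 * B * \<beta> \<le> N" "2 * B \<le> N" using N B by (auto simp: algebra_simps)
    then show ?thesis using s f by linarith
  qed
  then have "bounded_pairs B \<subseteq> {- int N..int N} \<times> {- int N..int N}" by (fastforce simp: abs_le_iff)
  then show ?thesis by (rule finite_subset) simp
qed

text \<open>The two-sided expansion with coefficients \<open>g i\<close> at
  \<open>\<beta> ^ i\<close> and \<open>f i\<close> at \<open>1 / \<beta> ^ i\<close> has value 0.
  Index \<open>0\<close> belongs to both sides, and only the side of \<open>g\<close> has to be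
  finite.\<close>

definition zero_sum :: "(nat \<Rightarrow> int \<times> int) \<Rightarrow> (nat \<Rightarrow> int \<times> int) \<Rightarrow> bool" where
  "zero_sum g f \<longleftrightarrow> (\<exists>k. \<forall>i\<ge>k. g i = 0) \<and>
    (\<exists>s. (\<lambda>i. ev (g i) * \<beta> ^ i) sums s \<and> (\<lambda>i. ev (f i) / \<beta> ^ i) sums (- s))"

text \<open>The carries \<open>c\<close> and \<open>r\<close> are the partial evaluations of the expansion from its two ends.
  They are algebraic integers bounded together with their conjugates, so finitely many occur.\<close>

lemma zero_sum_iff_carries:
  assumes K: "\<And>i. \<bar>ev (g i)\<bar> \<le> K" "\<And>i. \<bar>cj (g i)\<bar> \<le> K" "\<And>i. \<bar>ev (f i)\<bar> \<le> K" "\<And>i. \<bar>cj (f i)\<bar> \<le> K"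
    and B: "B = K * \<beta> / (\<beta> - 1) + K"
  shows "zero_sum g f \<longleftrightarrow> (\<exists>c r. (\<forall>i. c i \<in> bounded_pairs B \<and> r i \<in> bounded_pairs B) \<and> (\<exists>k. \<forall>i\<ge>k. c i = 0) \<and>
    (\<forall>i. c i = g i + shift (c (Suc i))) \<and> r 0 = c 0 + f 0 \<and> (\<forall>i. r (Suc i) = shift (r i) + f (Suc i)))"
    (is "_ \<longleftrightarrow> ?R")
proof -
  have K0: "K \<ge> 0" using K(1)[of 0] by linarith
  \<comment> \<open>The solution of \<open>S / \<beta> + K = S\<close>: the bound \<open>S\<close>
    survives a division by \<open>\<beta>\<close> followed by the addition of a term of size at most
    \<open>K\<close>.\<close>
  define S where "S = K * \<beta> / (\<beta> - 1)"
  have S: "S / \<beta> + K = S" using \<beta>1 by (simp add: S_def field_simps)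
  have S0: "S \<ge> 0" using K0 \<beta>1 by (simp add: S_def)
  have B': "B = S + K" by (simp add: B S_def)
  have "K * 1 \<le> K * \<beta>" using K0 \<beta>1 by (intro mult_left_mono) auto
  then have K_le: "K / \<beta> \<le> K" using \<beta>1 by (simp add: divide_le_eq)
  have step: "(S + K) / \<beta> \<le> S"
  proof -
    show ?thesis using S K_le by (simp add: add_divide_distrib)
  qed
  have ev_c: "(\<Sum>i<n. ev (g i) * \<beta> ^ i) = ev (c 0) - \<beta> ^ n * ev (c n)"
    if "\<forall>i. c i = g i + shift (c (Suc i))" for c n
  proof (induction n)
    case (Suc n)
    have "ev (c n) = ev (g n) + \<beta> * ev (c (Suc n))" using that ev_add ev_shift by metis
    then show ?case using Suc by (simp add: algebra_simps)
  qed simp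
  have ev_r: "(\<Sum>i<Suc n. ev (f i) / \<beta> ^ i) = ev (r n) / \<beta> ^ n - ev (c 0)"
    if "r 0 = c 0 + f 0" "\<forall>i. r (Suc i) = shift (r i) + f (Suc i)" for c r :: "nat \<Rightarrow> int \<times> int" and n
  proof (induction n)
    case 0 then show ?case using that by simp
  next
    case (Suc n)
    have "ev (r (Suc n)) = \<beta> * ev (r n) + ev (f (Suc n))" using that ev_add ev_shift by metis
    then have "ev (f (Suc n)) / \<beta> ^ Suc n = ev (r (Suc n)) / \<beta> ^ Suc n - ev (r n) / \<beta> ^ n"
      using \<beta>1 by (simp add: add_divide_distrib)
    then show ?case unfolding sum.lessThan_Suc[of _ "Suc n"] Suc by simp
  qed
  have sums_c: "(\<lambda>i. ev (g i) * \<beta> ^ i) sums ev (c 0)"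
    if "\<forall>i. c i = g i + shift (c (Suc i))" "\<forall>i\<ge>k. c i = 0" for c k
  proof -
    have "(\<Sum>i<n. ev (g i) * \<beta> ^ i) = ev (c 0)" if "n \<ge> k" for n
    proof -
      have "c n = 0" using \<open>\<forall>i\<ge>k. c i = 0\<close> that by blast
      then show ?thesis using ev_c[OF \<open>\<forall>i. c i = g i + shift (c (Suc i))\<close>, of n] by (simp only: ev_0 mult_zero_right diff_zero)
    qed
    then show ?thesis unfolding sums_def
      by (intro tendsto_eventually eventually_sequentiallyI[of k]) auto
  qed
  show ?thesis
  proof
    assume ?R
    then obtain c r k where F: "\<And>i. r i \<in> bounded_pairs B" and k: "\<forall>i\<ge>k. c i = 0"
      and c: "\<forall>i. c i = g i + shift (c (Suc i))" and r: "r 0 = c 0 + f 0" "\<forall>i. r (Suc i) = shift (r i) + f (Suc i)"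
      by blast
    have "g i = 0" if "i \<ge> k" for i
      using c[rule_format, of i] k that by simp
    moreover have "(\<lambda>i. ev (f i) / \<beta> ^ i) sums (- ev (c 0))"
    proof -
      have "(\<lambda>n. B / \<beta> ^ n) \<longlonglongrightarrow> 0"
        using \<beta>1 by (intro LIMSEQ_divide_realpow_zero)
      moreover have "norm (ev (r n) / \<beta> ^ n) \<le> B / \<beta> ^ n" for n
        using F[of n] \<beta>1 by (simp add: bounded_pairs_def divide_right_mono)
      ultimately have "(\<lambda>n. ev (r n) / \<beta> ^ n) \<longlonglongrightarrow> 0"
        by (intro Lim_null_comparison[OF always_eventually \<open>(\<lambda>n. B / \<beta> ^ n) \<longlonglongrightarrow> 0\<close>] allI)
      from tendsto_diff[OF this tendsto_const[of "ev (c 0)"]]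
      have "(\<lambda>n. \<Sum>i<Suc n. ev (f i) / \<beta> ^ i) \<longlonglongrightarrow> - ev (c 0)"
        using ev_r[where c = c and r = r, OF r] by simp
      then show ?thesis unfolding sums_def by (rule LIMSEQ_imp_Suc)
    qed
    ultimately show "zero_sum g f" unfolding zero_sum_def using sums_c[OF c k] by blast
  next
    assume "zero_sum g f"
    then obtain k s where k: "\<forall>i\<ge>k. g i = 0" and s: "(\<lambda>i. ev (g i) * \<beta> ^ i) sums s" "(\<lambda>i. ev (f i) / \<beta> ^ i) sums (- s)"
      unfolding zero_sum_def by blast
    \<comment> \<open>\<open>c\<close> is determined downwards from the tail, where it vanishes
      together with \<open>g\<close>.\<close>
    have "\<exists>c. (\<forall>i. c i = g i + shift (c (Suc i))) \<and> (\<forall>i\<ge>k. c i = 0)"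
      using k
    proof (induction k arbitrary: g)
      case 0
      then show ?case by (intro exI[of _ "\<lambda>_. 0"]) simp
    next
      case (Suc k)
      obtain c where c: "\<forall>i. c i = g (Suc i) + shift (c (Suc i))" "\<forall>i\<ge>k. c i = 0"
      proof -
        have "\<forall>i\<ge>k. g (Suc i) = 0" using Suc.prems by simp
        then show ?thesis using that Suc.IH[of "\<lambda>i. g (Suc i)"] by blast
      qed
      show ?case
      proof (intro exI[of _ "\<lambda>i. case i of 0 \<Rightarrow> g 0 + shift (c 0) | Suc i \<Rightarrow> c i"] conjI allI impI)
        fix i
        show "(case i of 0 \<Rightarrow> g 0 + shift (c 0) | Suc i \<Rightarrow> c i) =
          g i + shift (case Suc i of 0 \<Rightarrow> g 0 + shift (c 0) | Suc i \<Rightarrow> c i)"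
          using c(1)[rule_format, of "i - 1"] by (cases i) simp_all
      next
        fix i assume "Suc k \<le> i"
        then show "(case i of 0 \<Rightarrow> g 0 + shift (c 0) | Suc i \<Rightarrow> c i) = 0"
          using c(2)[rule_format, of "i - 1"] by (cases i) simp_all
      qed
    qed
    then obtain c where c: "\<forall>i. c i = g i + shift (c (Suc i))" and c0: "\<forall>i\<ge>k. c i = 0" by blast
    define r where "r n = rec_nat (c 0 + f 0) (\<lambda>n z. shift z + f (Suc n)) n" for n
    have r: "r 0 = c 0 + f 0" "\<forall>i. r (Suc i) = shift (r i) + f (Suc i)" by (simp_all add: r_def)
    have s_c: "s = ev (c 0)" using sums_unique2[OF s(1) sums_c[OF c c0]] .
    \<comment> \<open>Downwards the recursion for \<open>c\<close> contracts \<open>cj\<close>. It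
      expands \<open>ev\<close>, whose bound is obtained in the opposite direction in
      \<open>ev_c_bd\<close>.\<close>
    have cj_c: "\<bar>cj (c i)\<bar> \<le> S" for i
    proof (cases "i \<ge> k")
      case True then show ?thesis using c0 S0 by simp
    next
      case False
      then have "i \<le> k" by simp
      then show ?thesis
      proof (induction rule: inc_induct)
        case base then show ?case using c0 S0 by simp
      next
        case (step n)
        have "cj (c n) = cj (g n) + cj (c (Suc n)) / \<beta>" using c cj_add cj_shift by metis
        moreover have "\<bar>cj (c (Suc n)) / \<beta>\<bar> \<le> S / \<beta>" using step.IH \<beta>1 by (simp add: divide_right_mono)
        ultimately show ?case using K(2)[of n] S by linarith
      qed
    qed
    have cj_r: "\<bar>cj (r n)\<bar> \<le> B" for n
    proof (induction n)
      case 0 then show ?case using cj_c[of 0] K(4)[of 0] unfolding r(1) cj_add B' by linarith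
    next
      case (Suc n)
      then have "\<bar>cj (r n) / \<beta>\<bar> \<le> B / \<beta>" using \<beta>1 by (simp add: divide_right_mono)
      then show ?case using K(4)[of "Suc n"] step[folded B'] B' unfolding r(2)[rule_format] cj_add cj_shift by linarith
    qed
    have lim: "(\<lambda>n. ev (r n) / \<beta> ^ n) \<longlonglongrightarrow> 0"
    proof -
      have "(\<lambda>n. \<Sum>i<Suc n. ev (f i) / \<beta> ^ i) \<longlonglongrightarrow> - s"
        using s(2) unfolding sums_def by (rule LIMSEQ_Suc)
      from tendsto_add[OF this tendsto_const[of "ev (c 0)"]]
      show ?thesis unfolding ev_r[where c = c and r = r, OF r] s_c by simp
    qed
    \<comment> \<open>The recursion for \<open>r\<close> expands \<open>ev\<close>: beyond the fixed
      point \<open>K / (\<beta> - 1)\<close> the excess \<open>D\<close> grows at least like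
      \<open>\<beta> ^ m\<close>, which contradicts \<open>lim\<close>.\<close>
    have ev_r_bd: "\<bar>ev (r n)\<bar> \<le> S" for n
    proof (rule ccontr)
      assume "\<not> \<bar>ev (r n)\<bar> \<le> S"
      define D where "D = \<bar>ev (r n)\<bar> - K / (\<beta> - 1)"
      have "K / (\<beta> - 1) \<le> S" using K_le \<open>K * 1 \<le> K * \<beta>\<close> \<beta>1 unfolding S_def by (intro divide_right_mono) auto
      then have D: "D > 0" using \<open>\<not> \<bar>ev (r n)\<bar> \<le> S\<close> by (simp add: D_def)
      have grow: "\<bar>ev (r (n + m))\<bar> \<ge> K / (\<beta> - 1) + \<beta> ^ m * D" for m
      proof (induction m)
        case 0 then show ?case by (simp add: D_def)
      next
        case (Suc m)
        have "\<beta> * \<bar>ev (r (n + m))\<bar> \<ge> \<beta> * (K / (\<beta> - 1) + \<beta> ^ m * D)"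
          using Suc \<beta>1 by (intro mult_left_mono) auto
        moreover have "\<bar>ev (r (n + Suc m))\<bar> \<ge> \<beta> * \<bar>ev (r (n + m))\<bar> - K"
          using K(3)[of "Suc (n + m)"] \<beta>1 r(2)[rule_format, of "n + m"] by (simp add: abs_mult)
        moreover have "\<beta> * (K / (\<beta> - 1)) - K = K / (\<beta> - 1)" using \<beta>1 by (simp add: field_simps)
        ultimately show ?case by (simp add: algebra_simps)
      qed
      have "D / \<beta> ^ n \<le> \<bar>ev (r (n + m)) / \<beta> ^ (n + m)\<bar>" for m
      proof -
        have "K / (\<beta> - 1) \<ge> 0" using K0 \<beta>1 by simp
        then have "\<beta> ^ m * D \<le> \<bar>ev (r (n + m))\<bar>" using grow[of m] by linarith
        then have "\<beta> ^ m * D / \<beta> ^ (n + m) \<le> \<bar>ev (r (n + m))\<bar> / \<beta> ^ (n + m)"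
          using \<beta>1 by (intro divide_right_mono) auto
        then show ?thesis using \<beta>1 by (simp add: power_add)
      qed
      moreover have "(\<lambda>m. \<bar>ev (r (n + m)) / \<beta> ^ (n + m)\<bar>) \<longlonglongrightarrow> 0"
        using LIMSEQ_ignore_initial_segment[OF tendsto_rabs_zero[OF lim], of n] by (simp add: add.commute)
      ultimately have "D / \<beta> ^ n \<le> 0" by (intro LIMSEQ_le_const) auto
      moreover have "D / \<beta> ^ n > 0" using D \<beta>1 by simp
      ultimately show False by linarith
    qed
    \<comment> \<open>Upwards the recursion for \<open>c\<close> contracts \<open>ev\<close>. The
      start \<open>ev (c 0) = ev (r 0) - ev (f 0)\<close> is bounded by \<open>ev_r_bd\<close>, and
      it is here that the vanishing of the total value is used.\<close>
    have ev_c_bd: "\<bar>ev (c n)\<bar> \<le> B" for n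
    proof (induction n)
      case 0
      have "ev (c 0) = ev (r 0) - ev (f 0)" using r(1) by simp
      then show ?case using ev_r_bd[of 0] K(3)[of 0] B' by linarith
    next
      case (Suc n)
      have "ev (c n) = ev (g n) + \<beta> * ev (c (Suc n))" using c ev_add ev_shift by metis
      then have "ev (c (Suc n)) = (ev (c n) - ev (g n)) / \<beta>" using \<beta>1 by (simp add: field_simps)
      then have "\<bar>ev (c (Suc n))\<bar> \<le> (\<bar>ev (c n)\<bar> + \<bar>ev (g n)\<bar>) / \<beta>"
        using \<beta>1 by (simp add: divide_right_mono)
      also have "\<dots> \<le> (S + K + K) / \<beta>" using Suc K(1)[of n] B' \<beta>1 by (intro divide_right_mono) auto
      also have "\<dots> \<le> S + K"
      proof -
        show ?thesis using step K_le by (simp add: add_divide_distrib)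
      qed
      finally show ?case using B' by simp
    qed
    have "S \<le> B" using B' K0 by simp
    then have "c i \<in> bounded_pairs B \<and> r i \<in> bounded_pairs B" for i
      using ev_c_bd[of i] cj_c[of i] ev_r_bd[of i] cj_r[of i] by (auto simp: bounded_pairs_def)
    then show ?R using c c0 r by blast
  qed
qed

text \<open>The carries are guessed on an additional track with a finite alphabet; the conditions of
  \<open>zero_sum_iff_carries\<close> then concern neighbouring letters, the first letter and the
  tail only.\<close>

lemma recognisable_zero_sum:
  assumes A: "finite A"
  shows "recognisable A (\<lambda>w. zero_sum (\<lambda>i. g (w i)) (\<lambda>i. f (w i)))"
proof -
  \<comment> \<open>Letters are replaced by their pairs of coefficients. These are finitely many
    tuples of integers, so there is a common bound \<open>K\<close>, and the alphabet is countable
    as \<open>recognisable_local\<close> requires.\<close>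
  define \<Gamma> where "\<Gamma> = (\<lambda>l. (g l, f l)) ` A"
  have fin: "finite \<Gamma>" using A by (simp add: \<Gamma>_def)
  have "finite ((\<lambda>(x, y). \<bar>ev x\<bar> + \<bar>cj x\<bar> + \<bar>ev y\<bar> + \<bar>cj y\<bar>) ` \<Gamma>)" using fin by simp
  then obtain K where K: "\<forall>z\<in>(\<lambda>(x, y). \<bar>ev x\<bar> + \<bar>cj x\<bar> + \<bar>ev y\<bar> + \<bar>cj y\<bar>) ` \<Gamma>. z \<le> K"
    using bdd_above_finite unfolding bdd_above_def by blast
  define B where "B = K * \<beta> / (\<beta> - 1) + K"
  have loc: "recognisable (\<Gamma> \<times> (bounded_pairs B \<times> bounded_pairs B))
    (\<lambda>w. (\<lambda>l. snd (snd l) = fst (snd l) + snd (fst l)) (w 0) \<and>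
     (\<forall>i. (\<lambda>l l'. fst (snd l) = fst (fst l) + shift (fst (snd l')) \<and> snd (snd l') = shift (snd (snd l)) + snd (fst l')) (w i) (w (Suc i))) \<and>
     (\<exists>k. \<forall>j\<ge>k. (\<lambda>l. fst (snd l) = 0) (w j)))"
    by (intro recognisable_local finite_cartesian_product fin finite_bounded_pairs)
  have logic: "\<forall>i. D i \<Longrightarrow> ((\<forall>i. D i) \<and> E \<and> (\<forall>i. X i) \<and> Z \<and> (\<forall>i. Y i)) = (Z \<and> (\<forall>i. X i \<and> Y i) \<and> E)"
    for D X Y :: "nat \<Rightarrow> bool" and E Z
    by blast
  have "recognisable \<Gamma> (\<lambda>w. zero_sum (fst \<circ> w) (snd \<circ> w))"
  proof (rule recognisable_cong[OF recognisable_proj[OF loc]])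
    fix w :: "nat \<Rightarrow> (int \<times> int) \<times> int \<times> int" assume w: "range w \<subseteq> \<Gamma>"
    have "\<bar>ev (fst (w i))\<bar> + \<bar>cj (fst (w i))\<bar> + \<bar>ev (snd (w i))\<bar> + \<bar>cj (snd (w i))\<bar> \<le> K" for i
    proof -
      have "w i \<in> \<Gamma>" using w by blast
      from bspec[OF K imageI[OF this]] show ?thesis by (simp add: case_prod_unfold)
    qed
    then have bd: "\<bar>ev ((fst \<circ> w) i)\<bar> \<le> K" "\<bar>cj ((fst \<circ> w) i)\<bar> \<le> K"
      "\<bar>ev ((snd \<circ> w) i)\<bar> \<le> K" "\<bar>cj ((snd \<circ> w) i)\<bar> \<le> K" for i
      by (smt (verit) abs_ge_zero comp_apply)+
    let ?P = "\<lambda>c r. (\<forall>i. c i \<in> bounded_pairs B \<and> r i \<in> bounded_pairs B) \<and> (\<exists>k. \<forall>i\<ge>k. c i = 0) \<and>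
      (\<forall>i. c i = (fst \<circ> w) i + shift (c (Suc i))) \<and> r 0 = c 0 + (snd \<circ> w) 0 \<and> (\<forall>i. r (Suc i) = shift (r i) + (snd \<circ> w) (Suc i))"
    have "(\<exists>v. range v \<subseteq> bounded_pairs B \<times> bounded_pairs B \<and> ?P (fst \<circ> v) (snd \<circ> v)) \<longleftrightarrow> (\<exists>c r. ?P c r)"
    proof
      assume "\<exists>c r. ?P c r"
      then obtain c r where P: "?P c r" by blast
      have "\<forall>i. c i \<in> bounded_pairs B \<and> r i \<in> bounded_pairs B" using P by (rule conjunct1)
      then have rng: "range (\<lambda>i. (c i, r i)) \<subseteq> bounded_pairs B \<times> bounded_pairs B" by blast
      have fs: "fst \<circ> (\<lambda>i. (c i, r i)) = c" "snd \<circ> (\<lambda>i. (c i, r i)) = r"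
        by (simp_all add: comp_def)
      show "\<exists>v. range v \<subseteq> bounded_pairs B \<times> bounded_pairs B \<and> ?P (fst \<circ> v) (snd \<circ> v)"
        by (rule exI[of _ "\<lambda>i. (c i, r i)"], rule conjI, rule rng, unfold fs, rule P)
    qed blast
    also have "\<dots> \<longleftrightarrow> zero_sum (fst \<circ> w) (snd \<circ> w)"
      using zero_sum_iff_carries[of "fst \<circ> w" K "snd \<circ> w" B, OF bd B_def] by simp
    finally have iff: "(\<exists>v. range v \<subseteq> bounded_pairs B \<times> bounded_pairs B \<and> ?P (fst \<circ> v) (snd \<circ> v)) \<longleftrightarrow>
      zero_sum (fst \<circ> w) (snd \<circ> w)" .
    have eqv: "?P (fst \<circ> v) (snd \<circ> v) \<longleftrightarrow> (\<lambda>l. snd (snd l) = fst (snd l) + snd (fst l)) (w 0, v 0) \<and>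
       (\<forall>i. (\<lambda>l l'. fst (snd l) = fst (fst l) + shift (fst (snd l')) \<and> snd (snd l') = shift (snd (snd l)) + snd (fst l')) (w i, v i) (w (Suc i), v (Suc i))) \<and>
       (\<exists>k. \<forall>j\<ge>k. (\<lambda>l. fst (snd l) = 0) (w j, v j))"
      if "range v \<subseteq> bounded_pairs B \<times> bounded_pairs B" for v
    proof -
      have "\<forall>i. fst (v i) \<in> bounded_pairs B \<and> snd (v i) \<in> bounded_pairs B"
        using that by (metis mem_Times_iff rangeI subsetD)
      then show ?thesis unfolding fst_conv snd_conv comp_apply by (rule logic)
    qed
    show "(\<exists>v. range v \<subseteq> bounded_pairs B \<times> bounded_pairs B \<and>
       (\<lambda>l. snd (snd l) = fst (snd l) + snd (fst l)) (w 0, v 0) \<and>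
       (\<forall>i. (\<lambda>l l'. fst (snd l) = fst (fst l) + shift (fst (snd l')) \<and> snd (snd l') = shift (snd (snd l)) + snd (fst l')) (w i, v i) (w (Suc i), v (Suc i))) \<and>
       (\<exists>k. \<forall>j\<ge>k. (\<lambda>l. fst (snd l) = 0) (w j, v j))) \<longleftrightarrow> zero_sum (fst \<circ> w) (snd \<circ> w)"
      unfolding iff[symmetric] by (rule ex_cong1, rule conj_cong[OF refl], rule eqv[symmetric])
  qed
  from recognisable_map[OF this, of "\<lambda>l. (g l, f l)" A] show ?thesis
    by (simp add: \<Gamma>_def o_def)
qed

lemma zero_sum_iff:
  assumes "\<forall>i\<ge>k. g i = 0" "(\<lambda>i. ev (g i) * \<beta> ^ i) sums x" "(\<lambda>i. ev (f i) / \<beta> ^ i) sums y"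
  shows "zero_sum g f \<longleftrightarrow> x + y = 0"
proof
  assume "zero_sum g f"
  then obtain s where "(\<lambda>i. ev (g i) * \<beta> ^ i) sums s" "(\<lambda>i. ev (f i) / \<beta> ^ i) sums (- s)"
    unfolding zero_sum_def by blast
  then show "x + y = 0" using sums_unique2[OF assms(2)] sums_unique2[OF assms(3)] by fastforce
next
  assume "x + y = 0"
  then have "y = - x" by simp
  then show "zero_sum g f" unfolding zero_sum_def using assms by blast
qed

section \<open>Greedy expansions\<close>

lemma digits_integer_part:
  "0 \<le> x \<Longrightarrow> x < \<beta> ^ n \<Longrightarrow> \<exists>d :: nat \<Rightarrow> int. (\<forall>i. 0 \<le> d i \<and> d i \<le> t) \<and> (\<forall>i\<ge>n. d i = 0) \<and>
    0 \<le> x - (\<Sum>i<n. d i * \<beta> ^ i) \<and> x - (\<Sum>i<n. d i * \<beta> ^ i) < 1"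
proof (induction n arbitrary: x)
  case 0 then show ?case using t by (intro exI[of _ "\<lambda>_. 0"]) auto
next
  case (Suc n)
  \<comment> \<open>The greedy digit; it is at most \<open>t\<close> because
    \<open>x / \<beta> ^ n < \<beta>\<close> and \<open>\<beta> < t\<close>.\<close>
  define k where "k = \<lfloor>x / \<beta> ^ n\<rfloor>"
  have pos: "\<beta> ^ n > 0" using \<beta>1 by simp
  have k: "k \<le> x / \<beta> ^ n" "x / \<beta> ^ n < k + 1" by (auto simp: k_def)
  have "x / \<beta> ^ n < \<beta>" using Suc.prems pos by (simp add: divide_less_eq)
  then have kt: "k \<le> t" using k \<beta>_less by linarith
  have k0: "k \<ge> 0" using Suc.prems pos by (simp add: k_def)
  have "k * \<beta> ^ n \<le> x" using k(1) pos by (simp add: le_divide_eq)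
  moreover have "x < (k + 1) * \<beta> ^ n" using k(2) pos by (simp add: divide_less_eq)
  ultimately obtain d where d: "\<forall>i. 0 \<le> d i \<and> d i \<le> t" "\<forall>i\<ge>n. d i = (0::int)"
    "0 \<le> x - k * \<beta> ^ n - (\<Sum>i<n. d i * \<beta> ^ i)" "x - k * \<beta> ^ n - (\<Sum>i<n. d i * \<beta> ^ i) < 1"
    using Suc.IH[of "x - k * \<beta> ^ n"] by (auto simp: algebra_simps)
  have "(\<Sum>i<n. (d(n := k)) i * \<beta> ^ i) = (\<Sum>i<n. d i * \<beta> ^ i)" by (intro sum.cong) auto
  then show ?case using d k0 kt by (intro exI[of _ "d(n := k)"]) (auto simp: algebra_simps)
qed

text \<open>Iterate the map taking \<open>y\<close> to \<open>frac (\<beta> * y)\<close> and record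
  the integer parts; after \<open>n\<close> steps the error is
  \<open>r n / \<beta> ^ n\<close>.\<close>

lemma digits_fractional_part:
  assumes "0 \<le> x" "x < 1"
  shows "\<exists>d :: nat \<Rightarrow> int. (\<forall>i. 0 \<le> d i \<and> d i \<le> t) \<and> (\<lambda>i. d i / \<beta> ^ i) sums x"
proof -
  define r where "r n = rec_nat x (\<lambda>_ y. frac (\<beta> * y)) n" for n
  have r: "r 0 = x" "\<And>n. r (Suc n) = frac (\<beta> * r n)" by (simp_all add: r_def)
  have r01: "0 \<le> r n \<and> r n < 1" for n
    using assms by (cases n) (auto simp: r frac_lt_1)
  \<comment> \<open>As \<open>x < 1\<close>, the digit of index \<open>0\<close> is
    \<open>0\<close>, and the digit split off from \<open>\<beta> * r i\<close> belongs to index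
    \<open>Suc i\<close>.\<close>
  define d where "d i = (case i of 0 \<Rightarrow> 0 | Suc i \<Rightarrow> \<lfloor>\<beta> * r i\<rfloor>)" for i
  have "0 \<le> d i \<and> d i \<le> t" for i
  proof (cases i)
    case (Suc j)
    have "\<beta> * r j \<le> \<beta> * 1" using r01[of j] \<beta>1 by (intro mult_left_mono) auto
    then have "\<lfloor>\<beta> * r j\<rfloor> \<le> t" using \<beta>_less by linarith
    then show ?thesis using Suc r01[of j] \<beta>1 by (simp add: d_def)
  qed (use t in \<open>simp add: d_def\<close>)
  moreover have "(\<lambda>i. d i / \<beta> ^ i) sums x"
  proof -
    have sum: "(\<Sum>i<Suc n. d i / \<beta> ^ i) = x - r n / \<beta> ^ n" for n
    proof (induction n)
      case (Suc n)
      have "real_of_int (d (Suc n)) = \<beta> * r n - r (Suc n)" by (simp add: d_def r frac_def)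
      then have "d (Suc n) / \<beta> ^ Suc n = r n / \<beta> ^ n - r (Suc n) / \<beta> ^ Suc n"
        using \<beta>1 by (simp add: diff_divide_distrib)
      then show ?case unfolding sum.lessThan_Suc[of _ "Suc n"] Suc by simp
    qed (simp add: d_def r)
    have "norm (r n / \<beta> ^ n) \<le> 1 / \<beta> ^ n" for n
      using r01[of n] \<beta>1 by (simp add: divide_right_mono)
    moreover have lim: "(\<lambda>n. 1 / \<beta> ^ n) \<longlonglongrightarrow> 0" using \<beta>1 by (intro LIMSEQ_divide_realpow_zero)
    ultimately have "(\<lambda>n. r n / \<beta> ^ n) \<longlonglongrightarrow> 0"
      by (intro Lim_null_comparison[OF always_eventually lim] allI)
    from tendsto_diff[OF tendsto_const[of x] this]
    have "(\<lambda>n. \<Sum>i<Suc n. d i / \<beta> ^ i) \<longlonglongrightarrow> x" unfolding sum by simp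
    then show ?thesis unfolding sums_def by (rule LIMSEQ_imp_Suc)
  qed
  ultimately show ?thesis by blast
qed

lemma digits_nonneg:
  assumes "x \<ge> 0"
  shows "\<exists>(d :: nat \<Rightarrow> int) (e :: nat \<Rightarrow> int) n s. (\<forall>i. 0 \<le> d i \<and> d i \<le> t) \<and> (\<forall>i. 0 \<le> e i \<and> e i \<le> t) \<and>
    (\<forall>i\<ge>n. d i = 0) \<and> (\<lambda>i. d i * \<beta> ^ i) sums s \<and> (\<lambda>i. e i / \<beta> ^ i) sums (x - s)"
proof -
  obtain n where n: "x < \<beta> ^ n" using real_arch_pow[OF \<beta>1] by blast
  obtain d :: "nat \<Rightarrow> int" where d: "\<forall>i. 0 \<le> d i \<and> d i \<le> t" "\<forall>i\<ge>n. d i = 0"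
    "0 \<le> x - (\<Sum>i<n. d i * \<beta> ^ i)" "x - (\<Sum>i<n. d i * \<beta> ^ i) < 1"
    using digits_integer_part[OF assms n] by blast
  obtain e :: "nat \<Rightarrow> int" where e: "\<forall>i. 0 \<le> e i \<and> e i \<le> t" "(\<lambda>i. e i / \<beta> ^ i) sums (x - (\<Sum>i<n. d i * \<beta> ^ i))"
    using digits_fractional_part[OF d(3,4)] by blast
  have "(\<lambda>i. d i * \<beta> ^ i) sums (\<Sum>i<n. d i * \<beta> ^ i)"
    using d(2) by (intro sums_finite) auto
  then show ?thesis using d e by blast
qed

text \<open>The traces \<open>T n\<close> of \<open>\<beta> ^ n\<close> satisfy
  \<open>T (n + 2) = t * T (n + 1) - T n\<close> with \<open>T 0 = 2\<close> and
  \<open>T 1 = t\<close>.\<close>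

lemma trace_int: "\<beta> ^ n + 1 / \<beta> ^ n \<in> \<int>"
proof (induction n rule: less_induct)
  case (less n)
  consider "n = 0" | "n = 1" | m where "n = Suc (Suc m)" by (metis One_nat_def not0_implies_Suc)
  then show ?case
  proof cases
    case 3
    define \<gamma> where "\<gamma> = 1 / \<beta>"
    have inv: "1 / \<beta> ^ k = \<gamma> ^ k" for k by (simp add: \<gamma>_def power_one_over)
    have "\<gamma> * \<gamma> = (t - \<beta>) * \<gamma>" by (simp add: \<gamma>_def \<beta>_inverse)
    also have "\<dots> = t * \<gamma> - 1" using \<beta>1 by (simp add: \<gamma>_def algebra_simps)
    finally have "\<gamma> ^ n = (t * \<gamma> - 1) * \<gamma> ^ m" by (simp add: 3 mult.assoc[symmetric])
    moreover have "\<beta> ^ n = (t * \<beta> - 1) * \<beta> ^ m"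
      using \<beta> by (simp add: 3 power2_eq_square mult.assoc[symmetric])
    ultimately have "\<beta> ^ n + 1 / \<beta> ^ n = t * (\<beta> ^ Suc m + 1 / \<beta> ^ Suc m) - (\<beta> ^ m + 1 / \<beta> ^ m)"
      unfolding inv by (simp add: algebra_simps)
    moreover have "\<beta> ^ Suc m + 1 / \<beta> ^ Suc m \<in> \<int>" "\<beta> ^ m + 1 / \<beta> ^ m \<in> \<int>"
      using less.IH[of "Suc m"] less.IH[of m] 3 by simp_all
    ultimately show ?thesis by (metis Ints_diff Ints_mult Ints_of_int)
  qed (auto simp: \<beta>_inverse)
qed

text \<open>Subtracting a symmetric expansion changes an integer by an integer, so the greedy digits of its
  size leave a bounded integer, which is added to the digit of index \<open>0\<close>.\<close>

lemma digits_int: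
  fixes z :: int
  shows "\<exists>(d :: nat \<Rightarrow> int) (y :: int) n. (\<forall>i. \<bar>d i\<bar> \<le> t) \<and> \<bar>y\<bar> \<le> 2 * t \<and> (\<forall>i\<ge>n. d i = 0) \<and>
    z = y + (\<Sum>i<n. d i * (\<beta> ^ i + 1 / \<beta> ^ i))"
proof -
  have pos: "\<exists>(d :: nat \<Rightarrow> int) (y :: int) n. (\<forall>i. \<bar>d i\<bar> \<le> t) \<and> \<bar>y\<bar> \<le> 2 * t \<and> (\<forall>i\<ge>n. d i = 0) \<and>
    z = y + (\<Sum>i<n. d i * (\<beta> ^ i + 1 / \<beta> ^ i))" if z: "z \<ge> 0" for z :: int
  proof -
    obtain n where n: "z < \<beta> ^ n" using real_arch_pow[OF \<beta>1] by blast
    obtain d :: "nat \<Rightarrow> int" where d: "\<forall>i. 0 \<le> d i \<and> d i \<le> t" "\<forall>i\<ge>n. d i = 0"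
      "0 \<le> z - (\<Sum>i<n. d i * \<beta> ^ i)" "z - (\<Sum>i<n. d i * \<beta> ^ i) < 1"
      using digits_integer_part[OF _ n] z by auto
    have "(\<Sum>i<n. d i * (\<beta> ^ i + 1 / \<beta> ^ i)) \<in> \<int>" by (intro Ints_sum Ints_mult trace_int) auto
    then have "z - (\<Sum>i<n. d i * (\<beta> ^ i + 1 / \<beta> ^ i)) \<in> \<int>" by simp
    then obtain y where y: "z - (\<Sum>i<n. d i * (\<beta> ^ i + 1 / \<beta> ^ i)) = of_int y" by (rule Ints_cases)
    \<comment> \<open>\<open>y\<close> is the greedy remainder, in \<open>[0, 1)\<close>, minus the
      sum of the mirrored digits. The latter lies in \<open>[0, 2 * t]\<close>, by comparison with a
      geometric series of ratio \<open>1 / \<beta> < 1 / 2\<close>; this gives the bound on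
      \<open>y\<close>.\<close>
    have sp: "(\<Sum>i<n. d i * (\<beta> ^ i + 1 / \<beta> ^ i)) = (\<Sum>i<n. d i * \<beta> ^ i) + (\<Sum>i<n. d i * (1 / \<beta>) ^ i)"
      by (simp add: algebra_simps sum.distrib power_one_over)
    have "(\<Sum>i<n. d i * (1 / \<beta>) ^ i) \<le> (\<Sum>i<n. t * (1 / \<beta>) ^ i)"
      using d(1) \<beta>1 by (intro sum_mono mult_right_mono) auto
    also have "\<dots> \<le> t * 2"
    proof -
      have "(\<Sum>i<n. (1 / \<beta>) ^ i) \<le> (\<Sum>i. (1 / \<beta>) ^ i)"
        using \<beta>1 by (intro sum_le_suminf summable_geometric) auto
      also have "\<dots> = 1 / (1 - 1 / \<beta>)" using \<beta>1 by (intro suminf_geometric) auto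
      also have "\<dots> \<le> 2" using \<beta>_gt_2 by (simp add: field_simps)
      finally show ?thesis using t by (simp add: sum_distrib_left[symmetric])
    qed
    finally have "(\<Sum>i<n. d i * (1 / \<beta>) ^ i) \<le> t * 2" .
    moreover have "(\<Sum>i<n. d i * (1 / \<beta>) ^ i) \<ge> 0" using d(1) \<beta>1 by (intro sum_nonneg) auto
    ultimately have "real_of_int y < 1" "real_of_int y \<ge> - (t * 2)" using y d(3,4) unfolding sp by linarith+
    then have "\<bar>y\<bar> \<le> 2 * t" using t by linarith
    moreover have "\<bar>d i\<bar> \<le> t" for i using d(1)[rule_format, of i] by simp
    moreover have "z = y + (\<Sum>i<n. d i * (\<beta> ^ i + 1 / \<beta> ^ i))" using y by simp
    ultimately show ?thesis using d(2) by blast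
  qed
  show ?thesis
  proof (cases "z \<ge> 0")
    case True then show ?thesis by (rule pos)
  next
    case False
    then obtain d :: "nat \<Rightarrow> int" and y n where d: "\<forall>i. \<bar>d i\<bar> \<le> t" "\<bar>y\<bar> \<le> 2 * t" "\<forall>i\<ge>n. d i = 0"
      "real_of_int (- z) = y + (\<Sum>i<n. d i * (\<beta> ^ i + 1 / \<beta> ^ i))"
      using pos[of "- z"] by auto
    have "real_of_int z = real_of_int (- y) + (\<Sum>i<n. real_of_int (- d i) * (\<beta> ^ i + 1 / \<beta> ^ i))"
      using d(4) by (simp add: sum_negf)
    then show ?thesis using d(1-3)
      by (intro exI[of _ "\<lambda>i. - d i"] exI[of _ "- y"] exI[of _ n]) auto
  qed
qed

end

context quadratic_unit
begin

subsection \<open>Words of digit pairs\<close>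

text \<open>A letter packs two digits between \<open>-3 * t\<close> and \<open>3 * t\<close> in base
  \<open>6 * t + 1\<close>. The bound is \<open>t + 2 * t\<close>, the largest size of
  \<open>d 0 + y\<close> in \<open>digits_int\<close>.\<close>

definition dbase :: nat where "dbase = nat (6 * t + 1)"
definition dp :: "nat \<Rightarrow> int" where "dp l = int (l mod dbase) - 3 * t"
definition dn :: "nat \<Rightarrow> int" where "dn l = int (l div dbase) - 3 * t"
definition letters :: nat where "letters = dbase * dbase"

lemma letters_pos: "letters > 0"
  using t by (simp add: letters_def dbase_def)

lemma dn_bound: "l < letters \<Longrightarrow> \<bar>dn l\<bar> \<le> 3 * t"
proof -
  assume "l < letters"
  then have "l div dbase < dbase" by (simp add: letters_def less_mult_imp_div_less)
  then have "int (l div dbase) < 6 * t + 1" using t by (simp add: dbase_def)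
  then show ?thesis unfolding dn_def by linarith
qed

lemma letter_ex:
  assumes "\<bar>x\<bar> \<le> 3 * t" "\<bar>y\<bar> \<le> 3 * t" shows "\<exists>l<letters. dp l = x \<and> dn l = y"
proof -
  define u where "u = nat (x + 3 * t)"
  define v where "v = nat (y + 3 * t)"
  have u: "u < dbase" "v < dbase" "int u = x + 3 * t" "int v = y + 3 * t"
    using assms t by (auto simp: u_def v_def dbase_def nat_less_iff)
  have "v * dbase + u < v * dbase + dbase" using u by simp
  also have "\<dots> = Suc v * dbase" by simp
  also have "\<dots> \<le> dbase * dbase" using u by (intro mult_right_mono) auto
  finally have "v * dbase + u < letters" by (simp add: letters_def)
  moreover have "dp (v * dbase + u) = x" "dn (v * dbase + u) = y"
    using u by (simp_all add: dp_def dn_def)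
  ultimately show ?thesis by blast
qed

lemma word_ex:
  assumes "\<And>i. \<bar>d i\<bar> \<le> 3 * t" "\<And>i. \<bar>e i\<bar> \<le> 3 * t"
  obtains w :: "nat \<Rightarrow> nat" where "word letters w" "\<And>i. dp (w i) = d i" "\<And>i. dn (w i) = e i"
proof -
  have "\<forall>i. \<exists>l<letters. dp l = d i \<and> dn l = e i" using letter_ex assms by blast
  then obtain w where "\<And>i. w i < letters \<and> dp (w i) = d i \<and> dn (w i) = e i" by metis
  then show ?thesis using that[of w] by auto
qed

definition valid :: "(nat \<Rightarrow> nat) \<Rightarrow> bool" where
  "valid w \<longleftrightarrow> (\<exists>k. \<forall>i\<ge>k. dp (w i) = 0)"

text \<open>Both digits of index \<open>0\<close> count, each with weight 1. The value is meaningful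
  for valid words only.\<close>

definition val :: "(nat \<Rightarrow> nat) \<Rightarrow> real" where
  "val w = (\<Sum>i. dp (w i) * \<beta> ^ i) + (\<Sum>i. dn (w i) / \<beta> ^ i)"

lemma val_eqI:
  "(\<lambda>i. dp (w i) * \<beta> ^ i) sums x \<Longrightarrow> (\<lambda>i. dn (w i) / \<beta> ^ i) sums y \<Longrightarrow> val w = x + y"
  by (simp add: val_def sums_iff)

lemma val_sums:
  assumes "word letters w" "valid w"
  obtains k s where "\<forall>i\<ge>k. dp (w i) = 0" "(\<lambda>i. dp (w i) * \<beta> ^ i) sums s" "(\<lambda>i. dn (w i) / \<beta> ^ i) sums (val w - s)"
proof -
  obtain k where k: "\<forall>i\<ge>k. dp (w i) = 0" using assms(2) by (auto simp: valid_def)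
  have 1: "(\<lambda>i. dp (w i) * \<beta> ^ i) sums (\<Sum>i<k. dp (w i) * \<beta> ^ i)"
    using k by (intro sums_finite) auto
  have "summable (\<lambda>i. dn (w i) / \<beta> ^ i)"
  proof (rule summable_comparison_test')
    show "summable (\<lambda>i. real_of_int (3 * t) * (1 / \<beta>) ^ i)"
      using \<beta>1 by (intro summable_mult summable_geometric) auto
    fix i
    have "w i < letters" using assms(1) by auto
    from dn_bound[OF this] have "\<bar>real_of_int (dn (w i))\<bar> \<le> real_of_int (3 * t)" by linarith
    then show "norm (dn (w i) / \<beta> ^ i) \<le> real_of_int (3 * t) * (1 / \<beta>) ^ i"
      using \<beta>1 by (simp add: power_one_over abs_mult divide_right_mono)
  qed
  then have 2: "(\<lambda>i. dn (w i) / \<beta> ^ i) sums (\<Sum>i. dn (w i) / \<beta> ^ i)" by (rule summable_sums)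
  from val_eqI[OF 1 2] have "(\<Sum>i. dn (w i) / \<beta> ^ i) = val w - (\<Sum>i<k. dp (w i) * \<beta> ^ i)" by simp
  with 1 2 k show ?thesis using that by metis
qed

section \<open>Linear relations\<close>

definition scale :: "int \<Rightarrow> int \<times> int \<Rightarrow> int \<times> int" where
  "scale k z = (k * fst z, k * snd z)"

lemma ev_scale: "ev (scale k z) = k * ev z"
  by (simp add: ev_def scale_def algebra_simps)

lemma scale_0 [simp]: "scale 0 z = 0"
  by (simp add: scale_def zero_prod_def)

definition lin :: "int \<times> int \<Rightarrow> int \<times> int \<Rightarrow> int \<times> int \<Rightarrow> (nat \<Rightarrow> nat) \<Rightarrow> (nat \<Rightarrow> nat) \<Rightarrow> (nat \<Rightarrow> nat) \<Rightarrow> bool" where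
  "lin \<rho> \<sigma> \<tau> x y z \<longleftrightarrow>
    zero_sum (\<lambda>i. scale (dp (x i)) \<rho> + scale (dp (y i)) \<sigma> + scale (dp (z i)) \<tau>)
      (\<lambda>i. scale (dn (x i)) \<rho> + scale (dn (y i)) \<sigma> + scale (dn (z i)) \<tau>)"

lemma lin_iff:
  assumes "word letters x" "word letters y" "word letters z" "valid x" "valid y" "valid z"
  shows "lin \<rho> \<sigma> \<tau> x y z \<longleftrightarrow> ev \<rho> * val x + ev \<sigma> * val y + ev \<tau> * val z = 0"
proof -
  obtain k s where x: "\<forall>i\<ge>k. dp (x i) = 0" "(\<lambda>i. dp (x i) * \<beta> ^ i) sums s" "(\<lambda>i. dn (x i) / \<beta> ^ i) sums (val x - s)"
    using val_sums assms by blast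
  obtain k' s' where y: "\<forall>i\<ge>k'. dp (y i) = 0" "(\<lambda>i. dp (y i) * \<beta> ^ i) sums s'" "(\<lambda>i. dn (y i) / \<beta> ^ i) sums (val y - s')"
    using val_sums assms by blast
  obtain k'' s'' where z: "\<forall>i\<ge>k''. dp (z i) = 0" "(\<lambda>i. dp (z i) * \<beta> ^ i) sums s''" "(\<lambda>i. dn (z i) / \<beta> ^ i) sums (val z - s'')"
    using val_sums assms by blast
  let ?g = "\<lambda>i. scale (dp (x i)) \<rho> + scale (dp (y i)) \<sigma> + scale (dp (z i)) \<tau>"
  let ?f = "\<lambda>i. scale (dn (x i)) \<rho> + scale (dn (y i)) \<sigma> + scale (dn (z i)) \<tau>"
  have 1: "\<forall>i\<ge>max k (max k' k''). ?g i = 0" using x y z by simp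
  have 2: "(\<lambda>i. ev (?g i) * \<beta> ^ i) sums (ev \<rho> * s + ev \<sigma> * s' + ev \<tau> * s'')"
    using sums_add[OF sums_add[OF sums_mult[OF x(2)] sums_mult[OF y(2)]] sums_mult[OF z(2)], of "ev \<rho>" "ev \<sigma>" "ev \<tau>"]
    by (simp add: ev_scale algebra_simps)
  have 3: "(\<lambda>i. ev (?f i) / \<beta> ^ i) sums (ev \<rho> * (val x - s) + ev \<sigma> * (val y - s') + ev \<tau> * (val z - s''))"
    using sums_add[OF sums_add[OF sums_mult[OF x(3)] sums_mult[OF y(3)]] sums_mult[OF z(3)], of "ev \<rho>" "ev \<sigma>" "ev \<tau>"]
    by (simp add: ev_scale algebra_simps add_divide_distrib)
  show ?thesis unfolding lin_def zero_sum_iff[OF 1 2 3] by (auto simp: algebra_simps)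
qed

lemma recognisable_lin:
  "finite A \<Longrightarrow> recognisable A (\<lambda>w. lin \<rho> \<sigma> \<tau> (\<lambda>i. p (w i)) (\<lambda>i. q (w i)) (\<lambda>i. r (w i)))"
  unfolding lin_def by (rule recognisable_zero_sum)

section \<open>Order and integrality\<close>

definition nonneg_letters :: "nat set" where
  "nonneg_letters = {l. l < letters \<and> 0 \<le> dp l \<and> 0 \<le> dn l}"

lemma nonneg_word:
  assumes "x \<ge> 0" shows "\<exists>w. range w \<subseteq> nonneg_letters \<and> valid w \<and> val w = x"
proof -
  obtain d e :: "nat \<Rightarrow> int" and n s where d: "\<forall>i. 0 \<le> d i \<and> d i \<le> t" "\<forall>i. 0 \<le> e i \<and> e i \<le> t"
    "\<forall>i\<ge>n. d i = 0" "(\<lambda>i. d i * \<beta> ^ i) sums s" "(\<lambda>i. e i / \<beta> ^ i) sums (x - s)"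
    using digits_nonneg[OF assms] by blast
  have "\<bar>d i\<bar> \<le> 3 * t" "\<bar>e i\<bar> \<le> 3 * t" for i using d(1,2)[rule_format, of i] t by auto
  then obtain w where w: "word letters w" "\<And>i. dp (w i) = d i" "\<And>i. dn (w i) = e i"
    using word_ex[of d e] by blast
  have "range w \<subseteq> nonneg_letters" using w d(1,2) by (auto simp: nonneg_letters_def)
  moreover have "valid w" using d(3) by (auto simp: valid_def w)
  moreover have "val w = x" using val_eqI[of w s "x - s"] d(4,5) by (simp add: w)
  ultimately show ?thesis by blast
qed

lemma val_nonneg:
  assumes "range w \<subseteq> nonneg_letters" "valid w" shows "val w \<ge> 0"
proof -
  have w: "word letters w" "0 \<le> dp (w i)" "0 \<le> dn (w i)" for i
    using assms(1) by (auto simp: nonneg_letters_def subset_iff)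
  obtain s where s: "(\<lambda>i. dp (w i) * \<beta> ^ i) sums s" "(\<lambda>i. dn (w i) / \<beta> ^ i) sums (val w - s)"
    by (rule val_sums[OF w(1) assms(2)])
  have "0 \<le> s" by (rule sums_le[OF _ sums_zero s(1)]) (use w \<beta>1 in auto)
  moreover have "0 \<le> val w - s" by (rule sums_le[OF _ sums_zero s(2)]) (use w \<beta>1 in auto)
  ultimately show ?thesis by linarith
qed

lemma val_surj: "\<exists>w. word letters w \<and> valid w \<and> val w = x"
proof (cases "x \<ge> 0")
  case True
  then show ?thesis using nonneg_word[OF True] by (auto simp: nonneg_letters_def)
next
  case False
  then obtain d e :: "nat \<Rightarrow> int" and n s where d: "\<forall>i. 0 \<le> d i \<and> d i \<le> t" "\<forall>i. 0 \<le> e i \<and> e i \<le> t"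
    "\<forall>i\<ge>n. d i = 0" "(\<lambda>i. d i * \<beta> ^ i) sums s" "(\<lambda>i. e i / \<beta> ^ i) sums (- x - s)"
    using digits_nonneg[of "- x"] by auto
  have "\<bar>- d i\<bar> \<le> 3 * t" "\<bar>- e i\<bar> \<le> 3 * t" for i using d(1,2)[rule_format, of i] t by auto
  then obtain w where w: "word letters w" "\<And>i. dp (w i) = - d i" "\<And>i. dn (w i) = - e i"
    using word_ex[of "\<lambda>i. - d i" "\<lambda>i. - e i"] by blast
  moreover have "valid w" using d(3) by (auto simp: valid_def w)
  moreover have "val w = x"
    using val_eqI[of w "- s" "- (- x - s)"] sums_minus[OF d(4)] sums_minus[OF d(5)] by (simp add: w)
  ultimately show ?thesis by blast
qed

text \<open>Index \<open>0\<close> is exempt: both its digits contribute integers, and the surplus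
  \<open>y\<close> of \<open>digits_int\<close> is stored there. Symmetry transfers finiteness from
  the positive powers to the negative ones.\<close>

definition symmetric :: "(nat \<Rightarrow> nat) \<Rightarrow> bool" where
  "symmetric w \<longleftrightarrow> (\<forall>i. dp (w (Suc i)) = dn (w (Suc i))) \<and> (\<exists>k. \<forall>i\<ge>k. dp (w i) = 0)"

text \<open>The sum runs to \<open>Suc n\<close> and not to \<open>n\<close>, because
  \<open>dn (w 0)\<close> may be nonzero even for \<open>n = 0\<close>.\<close>

lemma val_symmetric:
  assumes "\<forall>i. dp (w (Suc i)) = dn (w (Suc i))" "\<forall>i\<ge>n. dp (w i) = 0"
  shows "val w = (\<Sum>i<Suc n. dp (w i) * \<beta> ^ i + dn (w i) / \<beta> ^ i)"
proof -
  have dn0: "dn (w i) = 0" if "i \<ge> Suc n" for i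
    using assms(1)[rule_format, of "i - 1"] assms(2)[rule_format, of i] that by (cases i) auto
  have "(\<lambda>i. dp (w i) * \<beta> ^ i) sums (\<Sum>i<Suc n. dp (w i) * \<beta> ^ i)"
    using assms(2) by (intro sums_finite) auto
  moreover have "(\<lambda>i. dn (w i) / \<beta> ^ i) sums (\<Sum>i<Suc n. dn (w i) / \<beta> ^ i)"
    using dn0 by (intro sums_finite) auto
  ultimately show ?thesis using val_eqI by (simp add: sum.distrib)
qed

lemma val_symmetric_int: "symmetric w \<Longrightarrow> val w \<in> \<int>"
proof -
  assume "symmetric w"
  then obtain n where n: "\<forall>i. dp (w (Suc i)) = dn (w (Suc i))" "\<forall>i\<ge>n. dp (w i) = 0"
    by (auto simp: symmetric_def)
  have "dp (w i) * \<beta> ^ i + dn (w i) / \<beta> ^ i \<in> \<int>" for i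
  proof (cases i)
    case (Suc j)
    then have "dp (w i) * \<beta> ^ i + dn (w i) / \<beta> ^ i = dp (w i) * (\<beta> ^ i + 1 / \<beta> ^ i)"
      using n(1) by (simp add: algebra_simps)
    then show ?thesis using trace_int[of i] by simp
  qed simp
  then show ?thesis unfolding val_symmetric[OF n] by (intro Ints_sum)
qed

lemma int_word:
  fixes z :: int
  shows "\<exists>w. word letters w \<and> symmetric w \<and> val w = z"
proof -
  obtain d :: "nat \<Rightarrow> int" and y :: int and n where d: "\<forall>i. \<bar>d i\<bar> \<le> t" "\<bar>y\<bar> \<le> 2 * t" "\<forall>i\<ge>n. d i = 0"
    "z = y + (\<Sum>i<n. d i * (\<beta> ^ i + 1 / \<beta> ^ i))"
    using digits_int[of z] by blast
  \<comment> \<open>The surplus \<open>y\<close> goes into the positive digit of index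
    \<open>0\<close>, whose size is then at most \<open>t + 2 * t\<close>.\<close>
  let ?e = "\<lambda>i. d i + (if i = 0 then y else 0)"
  have "\<bar>?e i\<bar> \<le> 3 * t" "\<bar>d i\<bar> \<le> 3 * t" for i using d(1)[rule_format, of i] d(2) t by auto
  then obtain w where w: "word letters w" "\<And>i. dp (w i) = ?e i" "\<And>i. dn (w i) = d i"
    using word_ex[of ?e d] by blast
  have s: "\<forall>i. dp (w (Suc i)) = dn (w (Suc i))" by (simp add: w)
  \<comment> \<open>\<open>Suc n\<close> because of the surplus: for \<open>n = 0\<close> the digit
    of index \<open>0\<close> is \<open>y\<close>.\<close>
  have f: "\<forall>i\<ge>Suc n. dp (w i) = 0" using d(3) by (simp add: w)
  have "val w = (\<Sum>i<Suc (Suc n). d i * (\<beta> ^ i + 1 / \<beta> ^ i) + real_of_int (if i = 0 then y else 0))"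
    unfolding val_symmetric[OF s f] w by (intro sum.cong) (auto simp: algebra_simps)
  also have "\<dots> = (\<Sum>i<Suc (Suc n). d i * (\<beta> ^ i + 1 / \<beta> ^ i)) + y"
  proof -
    have "(\<Sum>i<Suc m. real_of_int (if i = 0 then y else 0)) = y" for m by (induction m) auto
    then show ?thesis unfolding sum.distrib by simp
  qed
  also have "(\<Sum>i<Suc (Suc n). d i * (\<beta> ^ i + 1 / \<beta> ^ i)) = (\<Sum>i<n. d i * (\<beta> ^ i + 1 / \<beta> ^ i))"
    using d(3) by simp
  finally have "val w = z" using d(4) by simp
  moreover have "symmetric w" using s f unfolding symmetric_def by blast
  ultimately show ?thesis using w(1) by blast
qed

lemma symmetric_valid: "symmetric w \<Longrightarrow> valid w"
  by (simp add: symmetric_def valid_def)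

text \<open>Order is reduced to addition: the nonnegative reals are exactly the values of valid
  words with nonnegative digits, so such a word \<open>m\<close> for the difference witnesses the
  inequality.\<close>

definition le_rel :: "(nat \<Rightarrow> nat) \<Rightarrow> (nat \<Rightarrow> nat) \<Rightarrow> bool" where
  "le_rel y x \<longleftrightarrow> (\<exists>m. range m \<subseteq> nonneg_letters \<and> valid m \<and> lin (1, 0) (-1, 0) (-1, 0) x y m)"

lemma le_rel_iff:
  assumes "word letters x" "word letters y" "valid x" "valid y"
  shows "le_rel y x \<longleftrightarrow> val y \<le> val x"
proof -
  have *: "lin (1, 0) (-1, 0) (-1, 0) x y m \<longleftrightarrow> val m = val x - val y"
    if "range m \<subseteq> nonneg_letters" "valid m" for m
  proof -
    have "word letters m" using that(1) by (auto simp: nonneg_letters_def)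
    then show ?thesis using assms that by (subst lin_iff) (auto simp: ev_def)
  qed
  show ?thesis
  proof
    assume "le_rel y x"
    then show "val y \<le> val x" unfolding le_rel_def using * val_nonneg by fastforce
  next
    assume "val y \<le> val x"
    then obtain m where "range m \<subseteq> nonneg_letters" "valid m" "val m = val x - val y"
      using nonneg_word[of "val x - val y"] by auto
    then show "le_rel y x" unfolding le_rel_def using * by blast
  qed
qed

text \<open>The symmetric word \<open>m\<close> supplies the integer in
  \<open>\<rho> * val x = ev \<alpha> * z\<close>; its second occurrence has coefficient
  \<open>0\<close> and fills the third place. The pair \<open>1\<close>, \<open>(1, 0)\<close> gives
  the integers, and \<open>\<rho> * a = ev \<alpha>\<close> with \<open>\<rho> \<noteq> 0\<close>
  gives the integer multiples of \<open>a\<close>.\<close>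

definition int_rel :: "int \<Rightarrow> int \<times> int \<Rightarrow> (nat \<Rightarrow> nat) \<Rightarrow> bool" where
  "int_rel \<rho> \<alpha> x \<longleftrightarrow> (\<exists>m. word letters m \<and> symmetric m \<and> lin (\<rho>, 0) (scale (-1) \<alpha>) 0 x m m)"

lemma int_rel_iff:
  assumes "word letters x" "valid x"
  shows "int_rel \<rho> \<alpha> x \<longleftrightarrow> (\<exists>z :: int. \<rho> * val x = ev \<alpha> * z)"
proof -
  have *: "lin (\<rho>, 0) (scale (-1) \<alpha>) 0 x m m \<longleftrightarrow> \<rho> * val x = ev \<alpha> * val m"
    if "word letters m" "symmetric m" for m
  proof -
    have "ev (\<rho>, 0) = \<rho>" by (simp add: ev_def)
    then show ?thesis using assms that symmetric_valid by (subst lin_iff) (auto simp: ev_scale)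
  qed
  show ?thesis
  proof
    assume "int_rel \<rho> \<alpha> x"
    then obtain m where "word letters m" "symmetric m" "lin (\<rho>, 0) (scale (-1) \<alpha>) 0 x m m"
      unfolding int_rel_def by blast
    with * val_symmetric_int[of m] show "\<exists>z :: int. \<rho> * val x = ev \<alpha> * z" by (metis Ints_cases)
  next
    assume "\<exists>z :: int. \<rho> * val x = ev \<alpha> * z"
    then obtain z :: int where z: "\<rho> * val x = ev \<alpha> * z" by blast
    obtain m where "word letters m" "symmetric m" "val m = z" using int_word by blast
    then show "int_rel \<rho> \<alpha> x" unfolding int_rel_def using * z by metis
  qed
qed

abbreviation letter_triples :: "(nat \<times> nat \<times> nat) set" where
  "letter_triples \<equiv> {..<letters} \<times> {..<letters} \<times> {..<letters}"

lemma recognisable_eventually: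
  fixes A :: "'l :: countable set"
  assumes "finite A"
  shows "recognisable A (\<lambda>w. \<exists>k. \<forall>j\<ge>k. G (w j))"
  using recognisable_local[OF assms, of "\<lambda>_. True" "\<lambda>_ _. True" G] by simp

lemma recognisable_le_rel:
  "recognisable letter_triples (\<lambda>w. le_rel (\<lambda>i. fst (snd (w i))) (\<lambda>i. fst (w i)))"
proof -
  have fin: "finite (letter_triples \<times> nonneg_letters)" by (simp add: nonneg_letters_def)
  have "recognisable (letter_triples \<times> nonneg_letters) (\<lambda>w. valid (\<lambda>i. snd (w i)) \<and>
     lin (1, 0) (-1, 0) (-1, 0) (\<lambda>i. fst (fst (w i))) (\<lambda>i. fst (snd (fst (w i)))) (\<lambda>i. snd (w i)))"
    unfolding valid_def
    by (intro recognisable_conj recognisable_lin recognisable_eventually[where G = "\<lambda>l. dp (snd l) = 0"] fin)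
  from recognisable_proj[OF this] show ?thesis by (simp add: le_rel_def)
qed

lemma recognisable_int_rel: "recognisable letter_triples (\<lambda>w. int_rel \<rho> \<alpha> (\<lambda>i. fst (w i)))"
proof -
  have fin: "finite (letter_triples \<times> {..<letters})" by simp
  have "recognisable (letter_triples \<times> {..<letters}) (\<lambda>w. symmetric (\<lambda>i. snd (w i)))"
    unfolding symmetric_def
    using recognisable_local[OF fin, of "\<lambda>_. True" "\<lambda>_ l. dp (snd l) = dn (snd l)" "\<lambda>l. dp (snd l) = 0"] by simp
  then have "recognisable (letter_triples \<times> {..<letters}) (\<lambda>w. symmetric (\<lambda>i. snd (w i)) \<and>
     lin (\<rho>, 0) (scale (-1) \<alpha>) 0 (\<lambda>i. fst (fst (w i))) (\<lambda>i. snd (w i)) (\<lambda>i. snd (w i)))"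
    by (intro recognisable_conj recognisable_lin fin)
  from recognisable_proj[OF this] show ?thesis by (simp add: int_rel_def)
qed

theorem decidable_R_struct:
  assumes \<rho>: "\<rho> \<noteq> 0" and a: "real_of_int \<rho> * a = ev \<alpha>"
  shows "decidable (Th (R_struct a))"
proof -
  define rel where "rel r w \<longleftrightarrow>
    (if r = 0 then lin (1, 0) (1, 0) (-1, 0) (\<lambda>i. fst (w i)) (\<lambda>i. fst (snd (w i))) (\<lambda>i. snd (snd (w i)))
     else if r = 1 then lin (1, 0) (-1, 0) 0 (\<lambda>i. fst (w i)) (\<lambda>i. fst (snd (w i))) (\<lambda>i. fst (snd (w i)))
     else if r = 2 then \<not> le_rel (\<lambda>i. fst (snd (w i))) (\<lambda>i. fst (w i))
     else if r = 3 then int_rel 1 (1, 0) (\<lambda>i. fst (w i))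
     else if r = 4 then int_rel \<rho> \<alpha> (\<lambda>i. fst (w i))
     else valid (\<lambda>i. fst (w i)))" for r :: nat and w :: "nat \<Rightarrow> nat \<times> nat \<times> nat"
  have fin: "finite letter_triples" by simp
  have rec: "recognisable letter_triples (rel r)" for r
  proof -
    consider "r = 0" | "r = 1" | "r = 2" | "r = 3" | "r = 4" | "r > 4" by linarith
    then show ?thesis
    proof cases
      case 6
      have "recognisable letter_triples (\<lambda>w. valid (\<lambda>i. fst (w i)))"
        unfolding valid_def by (rule recognisable_eventually[OF fin])
      then show ?thesis using 6 by (simp add: rel_def[abs_def])
    next
      case 1
      then show ?thesis
        using recognisable_lin[OF fin, of "(1, 0)" "(1, 0)" "(-1, 0)" fst "\<lambda>l. fst (snd l)" "\<lambda>l. snd (snd l)"]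
        by (simp add: rel_def[abs_def])
    next
      case 2
      then show ?thesis
        using recognisable_lin[OF fin, of "(1, 0)" "(-1, 0)" 0 fst "\<lambda>l. fst (snd l)" "\<lambda>l. fst (snd l)"]
        by (simp add: rel_def[abs_def])
    qed (simp_all add: rel_def[abs_def] recognisable_not recognisable_le_rel recognisable_int_rel)
  qed
  interpret relations letters rel "R_struct a" val valid
  proof
    show "\<exists>w. word letters w \<and> valid w \<and> val w = x" for x by (rule val_surj)
    show "rel 5 (\<lambda>p. (x p, x p, x p)) = valid x" for x by (simp add: rel_def)
  next
    fix x y z :: "nat \<Rightarrow> nat"
    assume "word letters x" "word letters y" "word letters z" "valid x" "valid y" "valid z"
    from lin_iff[OF this, of "(1, 0)" "(1, 0)" "(-1, 0)"]
    show "rel 0 (\<lambda>p. (x p, y p, z p)) = (plus_of (R_struct a) (val x) (val y) = val z)"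
      by (auto simp: rel_def R_struct_def ev_def)
  next
    fix x y :: "nat \<Rightarrow> nat"
    assume xy: "word letters x" "word letters y" "valid x" "valid y"
    from lin_iff[of x y y "(1, 0)" "(-1, 0)" 0] this
    show "rel 1 (\<lambda>p. (x p, y p, y p)) = (val x = val y)"
      by (auto simp: rel_def ev_def)
    show "rel 2 (\<lambda>p. (x p, y p, y p)) = lt_of (R_struct a) (val x) (val y)"
      using le_rel_iff[OF xy] by (auto simp: rel_def R_struct_def)
  next
    fix x :: "nat \<Rightarrow> nat"
    assume x: "word letters x" "valid x"
    have "(\<exists>z :: int. real_of_int 1 * val x = ev (1, 0) * z) \<longleftrightarrow> val x \<in> \<int>"
      by (auto simp: ev_def elim: Ints_cases)
    then show "rel 3 (\<lambda>p. (x p, x p, x p)) = (val x \<in> P_of (R_struct a))"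
      using int_rel_iff[OF x, of 1 "(1, 0)"] by (simp add: rel_def R_struct_def)
    have "\<rho> * val x = ev \<alpha> * z \<longleftrightarrow> val x = z * a" for z :: int
      unfolding a[symmetric] using \<rho> by (simp add: mult.assoc mult.commute[of a])
    then show "rel 4 (\<lambda>p. (x p, x p, x p)) = (val x \<in> Q_of (R_struct a))"
      using int_rel_iff[OF x, of \<rho> \<alpha>] by (simp add: rel_def R_struct_def)
  qed
  show ?thesis using letters_pos rec by (rule decidable_if_recognisable)
qed

end

section \<open>Units in quadratic fields\<close>

text \<open>Infinitely many good approximations \<open>h / k\<close> of \<open>sqrt d\<close> have the same norm \<open>h\<^sup>2 - d k\<^sup>2\<close> and are
  congruent modulo it; the quotient of two of them is a unit.\<close>

lemma Pell_solution:
  fixes d :: int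
  assumes d: "d > 0" and irr: "sqrt d \<notin> \<rat>"
  obtains x y :: int where "x\<^sup>2 - d * y\<^sup>2 = 1" "x > 0" "y > 0"
proof -
  define \<theta> where "\<theta> = sqrt d"
  define nm where "nm = (\<lambda>(h, k). h\<^sup>2 - d * k\<^sup>2 :: int)"
  have \<theta>: "\<theta>\<^sup>2 = d" "\<theta> > 0" using d by (simp_all add: \<theta>_def)
  have inf: "infinite (approx_set \<theta>)" using irr rational_iff_finite_approx_set by (simp add: \<theta>_def)
  \<comment> \<open>\<open>|k * \<theta> - h| \<le> 1 / k\<close> and
    \<open>|k * \<theta> + h| \<le> 2 * \<theta> * k + 1\<close> bound the norm by
    \<open>2 * \<theta> + 1 / k\<close>.\<close>
  obtain N :: int where N: "2 * \<theta> + 1 \<le> N" using ex_le_of_int by blast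
  have bound: "\<bar>nm (h, k)\<bar> \<le> N" if hk: "(h, k) \<in> approx_set \<theta>" for h k
  proof -
    have k: "k \<ge> 1" "\<bar>\<theta> - h / k\<bar> < 1 / k\<^sup>2" using hk by (auto simp: approx_set_def)
    have "\<bar>k * \<theta> - h\<bar> = k * \<bar>\<theta> - h / k\<bar>" using k(1) by (simp add: abs_mult_pos' right_diff_distrib)
    also have "\<dots> \<le> k * (1 / k\<^sup>2)" using k by (intro mult_left_mono) auto
    also have "\<dots> = 1 / k" using k(1) by (simp add: power2_eq_square)
    finally have le: "\<bar>k * \<theta> - h\<bar> \<le> 1 / k" .
    have "1 / k \<le> 1" using k(1) by simp
    moreover have "k * \<theta> \<ge> 0" "2 * \<theta> * k = 2 * (k * \<theta>)" using \<theta>(2) k(1) by simp_all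
    ultimately have "\<bar>k * \<theta> + h\<bar> \<le> 2 * \<theta> * k + 1" using le by linarith
    then have "\<bar>k * \<theta> - h\<bar> * \<bar>k * \<theta> + h\<bar> \<le> 1 / k * (2 * \<theta> * k + 1)"
      using le k(1) by (intro mult_mono) auto
    also have "\<dots> = 2 * \<theta> + 1 / k" using k(1) by (simp add: field_simps)
    also have "\<dots> \<le> N" using N \<open>1 / k \<le> 1\<close> by linarith
    finally have "\<bar>(k * \<theta> - h) * (k * \<theta> + h)\<bar> \<le> N" by (simp add: abs_mult)
    moreover have "(k * \<theta> - h) * (k * \<theta> + h) = - real_of_int (nm (h, k))"
      using \<theta>(1) by (simp add: nm_def algebra_simps power2_eq_square)
    ultimately show ?thesis by linarith
  qed
  have "nm ` approx_set \<theta> \<subseteq> {- N..N}" using bound by (fastforce simp: abs_le_iff)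
  then have "finite (nm ` approx_set \<theta>)" by (rule finite_subset) simp
  from pigeonhole_infinite[OF inf this] obtain z where z: "infinite {a \<in> approx_set \<theta>. nm a = nm z}" and zin: "z \<in> approx_set \<theta>"
    by blast
  define n where "n = nm z"
  \<comment> \<open>A pair of norm 0 would make \<open>sqrt d\<close> rational.\<close>
  have n0: "n \<noteq> 0"
  proof
    assume "n = 0"
    obtain h k where hk: "z = (h, k)" by force
    have k: "k > 0" using zin hk by (auto simp: approx_set_def)
    have "h\<^sup>2 = d * k\<^sup>2" using \<open>n = 0\<close> by (simp add: n_def nm_def hk)
    then have "(real_of_int h)\<^sup>2 = d * (real_of_int k)\<^sup>2" by (metis of_int_mult of_int_power)
    then have "(\<bar>real_of_int h\<bar> / k)\<^sup>2 = d" using k by (simp add: power_divide)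
    then have "\<theta> = \<bar>real_of_int h\<bar> / k" using k unfolding \<theta>_def by (intro real_sqrt_unique) auto
    then show False using irr by (simp add: \<theta>_def)
  qed
  let ?S = "{a \<in> approx_set \<theta>. nm a = n}"
  let ?r = "\<lambda>(h, k). (h mod n, k mod n)"
  have "?r ` ?S \<subseteq> {- \<bar>n\<bar>..\<bar>n\<bar>} \<times> {- \<bar>n\<bar>..\<bar>n\<bar>}"
  proof -
    have "\<bar>m mod n\<bar> \<le> \<bar>n\<bar>" for m using abs_mod_less[OF n0, of m] by simp
    then have "m mod n \<in> {- \<bar>n\<bar>..\<bar>n\<bar>}" for m by (metis abs_le_iff atLeastAtMost_iff minus_le_iff)
    then show ?thesis by auto
  qed
  then have "finite (?r ` ?S)" by (rule finite_subset) simp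
  from pigeonhole_infinite[OF z[folded n_def] this] obtain u where u: "infinite {a \<in> ?S. ?r a = ?r u}" by blast
  from infinite_imp_nonempty[OF u] obtain a where a: "a \<in> ?S" "?r a = ?r u" by blast
  have "infinite ({a \<in> ?S. ?r a = ?r u} - {a})" using u by (rule infinite_remove)
  from infinite_imp_nonempty[OF this] obtain b where b: "b \<in> ?S" "?r b = ?r u" "b \<noteq> a" by blast
  obtain h k h' k' where hk: "a = (h, k)" "b = (h', k')" by (metis surj_pair)
  have app: "k > 0" "coprime h k" "k' > 0" "coprime h' k'" using a b by (auto simp: hk approx_set_def)
  have nh: "h\<^sup>2 - d * k\<^sup>2 = n" "h'\<^sup>2 - d * k'\<^sup>2 = n" using a b by (auto simp: hk nm_def)
  have md: "h mod n = h' mod n" "k mod n = k' mod n" using trans[OF a(2) b(2)[symmetric]] by (simp_all add: hk)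
  then obtain s r where s: "h' = h + n * s" and r: "k' = k + n * r"
    by (metis mod_eqE)
  \<comment> \<open>\<open>x + y * \<theta>\<close> is the quotient
    \<open>(h' + k' * \<theta>) / (h + k * \<theta>)\<close>: extending by
    \<open>h - k * \<theta>\<close> produces the denominator \<open>n\<close>, which cancels because
    the two pairs are congruent modulo \<open>n\<close>.\<close>
  define x where "x = 1 + h * s - d * k * r"
  define y where "y = h * r - k * s"
  have x: "n * x = h * h' - d * k * k'" unfolding x_def s r nh(1)[symmetric] by (simp add: algebra_simps power2_eq_square)
  have y: "n * y = h * k' - k * h'" unfolding y_def s r by (simp add: algebra_simps)
  have "n\<^sup>2 * (x\<^sup>2 - d * y\<^sup>2) = (n * x)\<^sup>2 - d * (n * y)\<^sup>2" by (simp add: algebra_simps power2_eq_square)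
  also have "\<dots> = (h\<^sup>2 - d * k\<^sup>2) * (h'\<^sup>2 - d * k'\<^sup>2)" unfolding x y by (simp add: algebra_simps power2_eq_square)
  also have "\<dots> = n\<^sup>2" using nh by (simp add: power2_eq_square)
  finally have pell: "x\<^sup>2 - d * y\<^sup>2 = 1" using n0 by simp
  \<comment> \<open>For \<open>y = 0\<close> the fractions \<open>h / k\<close> and
    \<open>h' / k'\<close> would agree; both are reduced, so the two pairs would be equal.\<close>
  have "y \<noteq> 0"
  proof
    assume "y = 0"
    then have eq: "h * k' = h' * k" using y by (simp add: mult.commute)
    have "k dvd h * k'" "k' dvd h' * k" using eq by (metis dvd_triv_right, metis dvd_triv_right)
    then have "k dvd k'" "k' dvd k" using app by (simp_all add: coprime_dvd_mult_right_iff coprime_commute)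
    then have "k = k'" using app by (simp add: zdvd_antisym_nonneg)
    then show False using eq app(1) b(3) hk by simp
  qed
  have "x \<noteq> 0"
  proof
    assume "x = 0"
    then have "- (d * y\<^sup>2) = 1" using pell by simp
    moreover have "d * y\<^sup>2 \<ge> 0" using d by simp
    ultimately show False by linarith
  qed
  show ?thesis
    by (rule that[of "\<bar>x\<bar>" "\<bar>y\<bar>"]) (use pell \<open>x \<noteq> 0\<close> \<open>y \<noteq> 0\<close> in auto)
qed

lemma sqrt_int_rational:
  fixes d :: int
  assumes "d \<ge> 0" "sqrt d \<in> \<rat>" obtains k :: int where "d = k\<^sup>2"
proof -
  obtain m n :: nat where mn: "n \<noteq> 0" "\<bar>sqrt d\<bar> = m / n" "coprime m n"
    using assms(2) by (rule Rats_abs_nat_div_natE)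
  have "real_of_int d = (m / n)\<^sup>2" using mn(2) assms(1) by (metis of_int_0_le_iff power2_abs real_sqrt_pow2)
  then have "real_of_int (d * (int n)\<^sup>2) = real_of_int ((int m)\<^sup>2)" using mn(1) by (simp add: power_divide)
  then have eq: "d * (int n)\<^sup>2 = (int m)\<^sup>2" by (simp only: of_int_eq_iff)
  then have "(int n)\<^sup>2 dvd (int m)\<^sup>2" by (metis dvd_triv_right)
  then have "int n dvd int m" by simp
  then have "n = 1" using mn(3) by (simp add: coprime_absorb_right)
  then show ?thesis using eq that[of "int m"] by simp
qed

lemma quadratic_integer_equation:
  fixes a :: real
  assumes "quadratic a"
  obtains A B C :: int where "A \<noteq> 0" "A * a\<^sup>2 + B * a + C = 0"
proof -
  obtain p q r :: rat where pqr: "p \<noteq> 0" "of_rat p * a\<^sup>2 + of_rat q * a + of_rat r = 0"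
    using assms by (auto simp: quadratic_def)
  have ex: "\<exists>n m :: int. m \<noteq> 0 \<and> real_of_rat z = real_of_int n / real_of_int m" for z
  proof (cases z)
    case (Fract n m)
    then show ?thesis by (intro exI[of _ n] exI[of _ m]) (simp add: of_rat_rat)
  qed
  obtain n m where p: "m \<noteq> 0" "real_of_rat p = real_of_int n / real_of_int m" using ex by blast
  obtain n' m' where q: "m' \<noteq> 0" "real_of_rat q = real_of_int n' / real_of_int m'" using ex by blast
  obtain n'' m'' where r: "m'' \<noteq> 0" "real_of_rat r = real_of_int n'' / real_of_int m''" using ex by blast
  have "n \<noteq> 0" using p pqr(1) by auto
  show ?thesis
  proof (rule that[of "n * m' * m''" "n' * m * m''" "n'' * m * m'"])
    show "n * m' * m'' \<noteq> 0" using \<open>n \<noteq> 0\<close> q r by simp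
    have "m * m' * m'' * (of_rat p * a\<^sup>2 + of_rat q * a + of_rat r) = 0" using pqr(2) by simp
    then show "(n * m' * m'') * a\<^sup>2 + (n' * m * m'') * a + (n'' * m * m') = 0"
      using p q r by (simp add: algebra_simps)
  qed
qed

theorem theoremA:
  fixes a :: real
  assumes "quadratic a"
  shows "decidable (Th (R_struct a))"
proof -
  obtain A B C :: int where A: "A \<noteq> 0" and eq: "A * a\<^sup>2 + B * a + C = 0"
    using quadratic_integer_equation[OF assms] by blast
  define d where "d = B\<^sup>2 - 4 * A * C"
  \<comment> \<open>Completing the square turns \<open>a\<close> into a square root of the
    discriminant.\<close>
  define s where "s = 2 * A * a + B"
  have "s\<^sup>2 - d = 4 * A * (A * a\<^sup>2 + B * a + C)"
    by (simp add: s_def d_def power2_eq_square algebra_simps)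
  then have s: "s\<^sup>2 = d" using eq by simp
  then have d0: "d \<ge> 0" by (metis of_int_0_le_iff zero_le_power2)
  have sq: "\<bar>s\<bar> = sqrt d" using s by (metis real_sqrt_abs)
  \<comment> \<open>\<open>e\<close> is the sign 1 or -1 that selects the root.\<close>
  then obtain e :: int where e: "s = e * sqrt d" by (metis abs_if mult_1 mult_minus1 minus_minus of_int_1 of_int_minus)
  show ?thesis
  proof (cases "sqrt d \<in> \<rat>")
    case True
    then obtain k :: int where "d = k\<^sup>2" using sqrt_int_rational[OF d0] by blast
    then have k: "sqrt d = \<bar>k\<bar>" by simp
    interpret quadratic_unit 3 "(3 + sqrt 5) / 2"
      by unfold_locales (simp_all add: power2_eq_square field_simps add_pos_nonneg)
    have "real_of_int (2 * A) * a = ev (e * \<bar>k\<bar> - B, 0)"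
      using e k by (simp add: s_def ev_def)
    then show ?thesis using A by (intro decidable_R_struct[of "2 * A"]) simp_all
  next
    case False
    then have "d > 0" using d0 by (cases "d = 0") auto
    then obtain x y :: int where xy: "x\<^sup>2 - d * y\<^sup>2 = 1" "x > 0" "y > 0"
      using Pell_solution False by blast
    \<comment> \<open>This excludes \<open>x = 1\<close>; so \<open>x \<ge> 2\<close>, and the trace
      \<open>2 * x\<close> is at least 3.\<close>
    have "x\<^sup>2 > 1" using xy \<open>d > 0\<close> by (smt (verit) mult_pos_pos zero_less_power)
    then have "x \<noteq> 1" by auto
    then have x: "x \<ge> 2" using xy by simp
    \<comment> \<open>The Pell equation says that \<open>\<beta>\<close> has norm 1; its trace is
      \<open>2 * x\<close>.\<close>
    define \<beta> where "\<beta> = x + y * sqrt d"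
    have "y * sqrt d > 0" using xy \<open>d > 0\<close> by simp
    then have "\<beta> > 1" using x unfolding \<beta>_def by linarith
    moreover have "\<beta>\<^sup>2 = (2 * x) * \<beta> - 1"
    proof -
      define w where "w = sqrt d"
      have "w * w = d" using d0 by (simp add: w_def)
      have "\<beta>\<^sup>2 = real_of_int x * x + 2 * x * y * w + real_of_int y * y * (w * w)"
        by (simp add: \<beta>_def w_def[symmetric] power2_eq_square algebra_simps)
      moreover have "real_of_int x * x = 1 + d * (real_of_int y * y)"
        using arg_cong[OF xy(1), of real_of_int] by (simp add: power2_eq_square)
      ultimately show ?thesis
        unfolding \<open>w * w = d\<close> by (simp add: \<beta>_def w_def[symmetric] algebra_simps)
    qed
    ultimately interpret quadratic_unit "2 * x" \<beta>
      using x by unfold_locales auto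
    have "real_of_int (2 * A * y) * a = ev (- e * x - B * y, e)"
    proof -
      \<comment> \<open>The factor \<open>y\<close> makes \<open>sqrt d\<close> available in
        \<int>[\<beta>], because \<open>y * sqrt d = \<beta> - x\<close>.\<close>
      have "real_of_int (2 * A * y) * a = y * (s - B)" by (simp add: s_def)
      also have "\<dots> = e * (\<beta> - x) - B * y" by (simp add: e \<beta>_def algebra_simps)
      finally show ?thesis by (simp add: ev_def algebra_simps)
    qed
    then show ?thesis using A xy by (intro decidable_R_struct[of "2 * A * y"]) simp_all
  qed
qed

end
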